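(* Suppose favors are substitutable. For any society $(N,\alpha,p,G_f,\delta)$ there is a number $B(\alpha,p,G_f,\delta)\equiv B^*$ such that, for a network $g$ on $N$: (1) if there exists a player $j$ with $d_j(g)>B^*$, then $g$ is not stable; (2) if $d_i(g)=B^*$ for all $i\in N$, then $g$ is stable.
   Context: Networks. $N=\{1,\dots,n\}$ is a finite set of players. A network $g$ is an undirected simple graph on $N$, viewed as its set of links; $ij\in g$ means $i,j$ are linked; $N_i(g)=\{j: ij\in g\}$, $d_i(g)=|N_i(g)|$. Parameters: $\alpha\in(0,1]$ (probability a player needs a favor), $p\in(0,1)$, $\delta\in(0,1)$ (discount factor), $v>c>0$, $\gamma\in[0,c)$. The stage game $G_f$ is determined by $(v,c,\gamma)$ (see (v) below). The notation $B(\alpha,p,G_f,\delta)$ indicates what the bound depends on; in particular it does not depend on $N$. Favor exchange game (substitutable favors). Time is $t=0,1,2,\dots$; $g_t$ is the network at the beginning of period $t$, and $g_0=g$ is common knowledge. In each period: (i) players decide, for each of their links, to keep ($K$) or remove ($R$) it; (ii) any player needs a favor with probability $\alpha$ (for simplicity, at most one player requires a favor in a given period), the type of the favor being uniform on a finite set $F$; (iii) each other player is independently able to provide the favor in that period with probability $p$ (the same $p$ for all players and favor types: this is what "substitutable" means); (iv) if some current neighbors of the requester $i$ are able, one of them, $j$, is selected uniformly at random; (v) $i$ and $j$ play $G_f$: $j$ chooses $C$ (payoff $v$ to $i$, $-c$ to $j$) or $D$ (payoff $0$ to $i$, $-\gamma$ to $j$). All other payoffs are $0$. Player $i$ observes with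 whom she plays, the action profiles in periods in which she plays, and her own neighborhood $N_i(g_t)$, but not $g_t$. Strategies and equilibrium. A strategy $\sigma_i(h_{t,i},j)$ gives, for each private history $h_{t,i}$ and each $j\ne i$, a probability distribution over $i$'s decisions toward $j$ ($K$ or $R$, and the action if playing with $j$). The bilateral history $h_{t,ij}$ contains only the periods and action profiles of all past interactions between $i$ and $j$. A profile $\sigma$ is measurable with respect to bilateral histories if $\sigma_i(h_{t,i},j)=\sigma_i(h'_{t,i},j)$ whenever $h_{t,ij}=h'_{t,ij}$, for all $i,j$. $(g,\sigma)$ is a bilateral equilibrium if $\sigma$ is measurable with respect to bilateral histories and there are beliefs $\mu$ such that $(\sigma,\mu)$ is a sequential equilibrium of the game with $g_0=g$. A bilateral equilibrium is stable if on the equilibrium path all favors are provided and all links are kept. A network $g$ is stable if there is $\sigma$ such that $(g,\sigma)$ is a stable bilateral equilibrium. *)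

theory Defs
  imports "HOL-Probability.Probability"
begin

type_synonym player = nat

text \<open>A network is its set of links; the link between \<open>i\<close> and \<open>j\<close> is the two-element set \<open>{i, j}\<close>.\<close>

type_synonym network = "player set set"

definition nbrs :: "network \<Rightarrow> player \<Rightarrow> player set" where
  "nbrs g i = {j. {i, j} \<in> g}"

definition deg :: "network \<Rightarrow> player \<Rightarrow> nat" where
  "deg g i = card (nbrs g i)"

datatype link_choice = Keep | Remove
datatype favor_choice = Coop | Defect

record favor_game =
  benefit :: real  \<comment> \<open>\<open>v\<close>\<close>
  cost :: real     \<comment> \<open>\<open>c\<close>\<close>
  refusal :: real  \<comment> \<open>\<open>\<gamma>\<close>\<close>

definition favor_game :: "favor_game \<Rightarrow> bool" where
  "favor_game G \<longleftrightarrow> 0 < cost G \<and> cost G < benefit G \<and> 0 \<le> refusal G \<and> refusal G < cost G"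

fun requester_payoff :: "favor_game \<Rightarrow> favor_choice \<Rightarrow> real" where
  "requester_payoff G Coop = benefit G"
| "requester_payoff G Defect = 0"

fun provider_payoff :: "favor_game \<Rightarrow> favor_choice \<Rightarrow> real" where
  "provider_payoff G Coop = - cost G"
| "provider_payoff G Defect = - refusal G"

text \<open>
  \<open>needs\<close> is the joint law, in one period, of the set of players who need a favor;
  \<open>able_prob j f\<close> is the probability that \<open>j\<close> is able to provide a favor of type \<open>f\<close>.
\<close>

record society =
  num_players :: nat
  need_prob :: real  \<comment> \<open>\<open>\<alpha>\<close>\<close>
  needs :: "player set pmf"
  favor_types :: "nat set"
  able_prob :: "player \<Rightarrow> nat \<Rightarrow> real"
  game :: favor_game
  discount :: real   \<comment> \<open>\<open>\<delta>\<close>\<close>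

definition players :: "society \<Rightarrow> player set" where
  "players S = {1..num_players S}"

text \<open>
  Every player needs a favor with the same probability \<open>\<alpha>\<close>, irrespective of the number of players.
  The joint law of the needs is otherwise arbitrary. A law under which at most one player needs
  a favor (\<open>card T \<le> 1\<close> on the support) is one of the laws covered; it exists only if
  \<open>num_players S * \<alpha> \<le> 1\<close>, so imposing it would exclude all large societies for a given \<open>\<alpha>\<close>.
\<close>

definition society :: "society \<Rightarrow> bool" where
  "society S \<longleftrightarrow>
     1 \<le> num_players S \<and>
     0 < need_prob S \<and> need_prob S \<le> 1 \<and>
     set_pmf (needs S) \<subseteq> Pow (players S) \<and>
     (\<forall>i\<in>players S. measure_pmf.prob (needs S) {T. i \<in> T} = need_prob S) \<and>
     finite (favor_types S) \<and> favor_types S \<noteq> {} \<and>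
     favor_game (game S) \<and>
     0 < discount S \<and> discount S < 1"

definition substitutable :: "society \<Rightarrow> real \<Rightarrow> bool" where
  "substitutable S p \<longleftrightarrow> (\<forall>j\<in>players S. \<forall>f\<in>favor_types S. able_prob S j f = p)"

definition network_on :: "society \<Rightarrow> network \<Rightarrow> bool" where
  "network_on S g \<longleftrightarrow> g \<subseteq> {{i, j} |i j. i \<in> players S \<and> j \<in> players S \<and> i \<noteq> j}"

text \<open>
  Outcome \<open>(l, m, a)\<close> of a period: \<open>l (i, j)\<close> is \<open>i\<close>'s choice about the link between \<open>i\<close> and \<open>j\<close>
  (with dummy value \<open>Keep\<close> if there is no such link), \<open>m i = Some j\<close> means that \<open>i\<close> requested
  a favor and \<open>j\<close> was selected to provide it, and \<open>a i\<close> is then the choice of that provider \<open>j\<close>.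
\<close>

type_synonym link_choices = "player \<times> player \<Rightarrow> link_choice"
type_synonym matching = "player \<Rightarrow> player option"
type_synonym favors = "player \<Rightarrow> favor_choice option"
type_synonym outcome = "link_choices \<times> matching \<times> favors"

text \<open>The full history at the beginning of period \<open>t\<close> is the list of the outcomes of periods \<open>0, \<dots>, t - 1\<close>.\<close>

type_synonym history = "outcome list"

definition kept :: "network \<Rightarrow> link_choices \<Rightarrow> network" where
  "kept G l = {e \<in> G. \<forall>i j. e = {i, j} \<longrightarrow> l (i, j) = Keep}"

text \<open>The network \<open>g\<^sub>t\<close> after the history \<open>x\<close> of length \<open>t\<close>, starting from \<open>g\<^sub>0 = g\<close>.\<close>

definition net :: "network \<Rightarrow> history \<Rightarrow> network" where
  "net g x = foldl (\<lambda>G (l, m, a). kept G l) g x"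

text \<open>
  What a player observes of a period: her own link choices, the provider of her own request and his
  choice (if any), and the choices she made as a provider, for each requester.
\<close>

type_synonym observation =
  "(player \<Rightarrow> link_choice) \<times> player option \<times> favor_choice option \<times> (player \<Rightarrow> favor_choice option)"

fun observe :: "player \<Rightarrow> outcome \<Rightarrow> observation" where
  "observe i (l, m, a) =
     ((\<lambda>j. l (i, j)), m i, a i, (\<lambda>j. if m j = Some i then a j else None))"

type_synonym priv_history = "(player set \<times> observation) list \<times> player set"

definition private_history :: "network \<Rightarrow> player \<Rightarrow> history \<Rightarrow> priv_history" where
  "private_history g i x =
     (map (\<lambda>s. (nbrs (net g (take s x)) i, observe i (x ! s))) [0..<length x], nbrs (net g x) i)"

text \<open>For each past period, the action profiles of the interactions of \<open>i\<close> and \<open>j\<close>, if any, in either role.\<close>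

definition bilateral_history ::
    "player \<Rightarrow> player \<Rightarrow> history \<Rightarrow> (favor_choice option \<times> favor_choice option) list" where
  "bilateral_history i j x =
     map (\<lambda>(l, m, a). (if m i = Some j then a i else None, if m j = Some i then a j else None)) x"

text \<open>
  \<open>\<sigma> i h j\<close> gives, at the private history \<open>h\<close> of player \<open>i\<close>, the distribution of \<open>i\<close>'s choice about
  her link with \<open>j\<close> and the distribution of her action if she is to provide a favor to \<open>j\<close>.
\<close>

type_synonym strategy = "priv_history \<Rightarrow> player \<Rightarrow> link_choice pmf \<times> favor_choice pmf"
type_synonym profile = "player \<Rightarrow> strategy"

definition link_stage :: "network \<Rightarrow> profile \<Rightarrow> history \<Rightarrow> link_choices pmf" where
  "link_stage g \<sigma> x =
     Pi_pmf {(i, j). {i, j} \<in> net g x} Keep (\<lambda>(i, j). fst (\<sigma> i (private_history g i x) j))"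

text \<open>
  The law of the provider selected for a favor requested by \<open>i\<close> in the current network \<open>G\<close>.
  The type of the favor and the abilities are drawn anew for each request.
\<close>

definition select :: "society \<Rightarrow> network \<Rightarrow> player \<Rightarrow> player option pmf" where
  "select S G i = do {
     f \<leftarrow> pmf_of_set (favor_types S);
     able \<leftarrow> Pi_pmf (players S - {i}) False (\<lambda>j. bernoulli_pmf (able_prob S j f));
     (let A = {j \<in> nbrs G i. able j}
      in if A = {} then return_pmf None else map_pmf Some (pmf_of_set A))
   }"

definition match_stage :: "society \<Rightarrow> network \<Rightarrow> matching pmf" where
  "match_stage S G = do { T \<leftarrow> needs S; Pi_pmf T None (select S G) }"

definition favor_stage :: "network \<Rightarrow> profile \<Rightarrow> history \<Rightarrow> matching \<Rightarrow> favors pmf" where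
  "favor_stage g \<sigma> x m =
     Pi_pmf {i. m i \<noteq> None} None
       (\<lambda>i. let j = the (m i) in map_pmf Some (snd (\<sigma> j (private_history g j x) i)))"

text \<open>
  Nodes at which players move: the beginning of a period, and the moment at which the selected
  providers choose their actions (given the link choices and the matching of the current period).
\<close>

datatype node = Link_Node history | Favor_Node history link_choices matching

text \<open>\<open>period_end S g \<sigma> nd\<close> is the law of the history at the end of the period of \<open>nd\<close>, given \<open>nd\<close>.\<close>

fun period_end :: "society \<Rightarrow> network \<Rightarrow> profile \<Rightarrow> node \<Rightarrow> history pmf" where
  "period_end S g \<sigma> (Favor_Node x l m) = do {
     a \<leftarrow> favor_stage g \<sigma> x m;
     return_pmf (x @ [(l, m, a)])
   }"
| "period_end S g \<sigma> (Link_Node x) = do {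
     l \<leftarrow> link_stage g \<sigma> x;
     m \<leftarrow> match_stage S (kept (net g x) l);
     a \<leftarrow> favor_stage g \<sigma> x m;
     return_pmf (x @ [(l, m, a)])
   }"

text \<open>The law of the history \<open>s\<close> periods later than the end of the period of \<open>nd\<close>, given \<open>nd\<close>.\<close>

fun play_from :: "society \<Rightarrow> network \<Rightarrow> profile \<Rightarrow> node \<Rightarrow> nat \<Rightarrow> history pmf" where
  "play_from S g \<sigma> nd 0 = period_end S g \<sigma> nd"
| "play_from S g \<sigma> nd (Suc s) = do {
     x \<leftarrow> play_from S g \<sigma> nd s;
     period_end S g \<sigma> (Link_Node x)
   }"

fun history_pmf :: "society \<Rightarrow> network \<Rightarrow> profile \<Rightarrow> nat \<Rightarrow> history pmf" where
  "history_pmf S g \<sigma> 0 = return_pmf []"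
| "history_pmf S g \<sigma> (Suc t) = do {
     x \<leftarrow> history_pmf S g \<sigma> t;
     period_end S g \<sigma> (Link_Node x)
   }"

text \<open>The law of the node reached in the same period and at the same stage as \<open>nd\<close>.\<close>

fun node_pmf :: "society \<Rightarrow> network \<Rightarrow> profile \<Rightarrow> node \<Rightarrow> node pmf" where
  "node_pmf S g \<sigma> (Link_Node x) = map_pmf Link_Node (history_pmf S g \<sigma> (length x))"
| "node_pmf S g \<sigma> (Favor_Node x l m) = do {
     x' \<leftarrow> history_pmf S g \<sigma> (length x);
     l' \<leftarrow> link_stage g \<sigma> x';
     m' \<leftarrow> match_stage S (kept (net g x') l');
     return_pmf (Favor_Node x' l' m')
   }"

definition nodes :: "society \<Rightarrow> network \<Rightarrow> node set" where
  "nodes S g = {nd. \<exists>\<sigma>. nd \<in> set_pmf (node_pmf S g \<sigma> nd)}"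

fun period_payoff :: "society \<Rightarrow> player \<Rightarrow> outcome \<Rightarrow> real" where
  "period_payoff S i (l, m, a) =
     (case a i of None \<Rightarrow> 0 | Some c \<Rightarrow> requester_payoff (game S) c) +
     (\<Sum>j | j \<in> players S \<and> m j = Some i.
        case a j of None \<Rightarrow> 0 | Some c \<Rightarrow> provider_payoff (game S) c)"

definition continuation_payoff ::
    "society \<Rightarrow> network \<Rightarrow> profile \<Rightarrow> player \<Rightarrow> node \<Rightarrow> real" where
  "continuation_payoff S g \<sigma> i nd =
     (\<Sum>s. discount S ^ s *
        measure_pmf.expectation (play_from S g \<sigma> nd s) (\<lambda>x. period_payoff S i (last x)))"

text \<open>
  Two nodes belong to the same information set of \<open>i\<close> iff they have the same view. When providers
  are about to act, \<open>i\<close> knows, on top of her private history, her own link choices and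
  with whom she is playing in the current period.
\<close>

datatype info =
    Link_View priv_history
  | Favor_View priv_history "player \<Rightarrow> link_choice" "player option" "player set"

fun view :: "network \<Rightarrow> player \<Rightarrow> node \<Rightarrow> info" where
  "view g i (Link_Node x) = Link_View (private_history g i x)"
| "view g i (Favor_Node x l m) =
     Favor_View (private_history g i x) (\<lambda>j. l (i, j)) (m i) {j. m j = Some i}"

fun moves_at :: "player \<Rightarrow> node \<Rightarrow> bool" where
  "moves_at i (Link_Node x) = True"
| "moves_at i (Favor_Node x l m) = (\<exists>j. m j = Some i)"

definition info_nodes :: "society \<Rightarrow> network \<Rightarrow> player \<Rightarrow> node set" where
  "info_nodes S g i = {nd \<in> nodes S g. moves_at i nd}"

text \<open>\<open>\<mu> i w\<close> is the belief of \<open>i\<close> over the nodes of her information set with view \<open>w\<close>.\<close>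

type_synonym beliefs = "player \<Rightarrow> info \<Rightarrow> node pmf"

definition sequentially_rational ::
    "society \<Rightarrow> network \<Rightarrow> profile \<Rightarrow> beliefs \<Rightarrow> bool" where
  "sequentially_rational S g \<sigma> \<mu> \<longleftrightarrow>
     (\<forall>i\<in>players S. \<forall>nd\<in>info_nodes S g i. \<forall>\<tau> :: strategy.
        measure_pmf.expectation (\<mu> i (view g i nd)) (continuation_payoff S g (\<sigma>(i := \<tau>)) i)
          \<le> measure_pmf.expectation (\<mu> i (view g i nd)) (continuation_payoff S g \<sigma> i))"

definition completely_mixed :: "profile \<Rightarrow> bool" where
  "completely_mixed \<sigma> \<longleftrightarrow>
     (\<forall>i h j. set_pmf (fst (\<sigma> i h j)) = UNIV \<and> set_pmf (snd (\<sigma> i h j)) = UNIV)"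

text \<open>
  Bayes' rule at the information set of \<open>i\<close> containing \<open>nd\<close>; only meaningful if that set is reached
  with positive probability, as it is under completely mixed profiles for \<open>nd \<in> nodes S g\<close>.
\<close>

definition bayes_belief :: "society \<Rightarrow> network \<Rightarrow> profile \<Rightarrow> player \<Rightarrow> node \<Rightarrow> node pmf" where
  "bayes_belief S g \<sigma> i nd = cond_pmf (node_pmf S g \<sigma> nd) {nd'. view g i nd' = view g i nd}"

definition consistent :: "society \<Rightarrow> network \<Rightarrow> profile \<Rightarrow> beliefs \<Rightarrow> bool" where
  "consistent S g \<sigma> \<mu> \<longleftrightarrow>
     (\<exists>\<tau> :: nat \<Rightarrow> profile.
        (\<forall>k. completely_mixed (\<tau> k)) \<and>
        (\<forall>i h j c. (\<lambda>k. pmf (fst (\<tau> k i h j)) c) \<longlonglongrightarrow> pmf (fst (\<sigma> i h j)) c) \<and>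
        (\<forall>i h j c. (\<lambda>k. pmf (snd (\<tau> k i h j)) c) \<longlonglongrightarrow> pmf (snd (\<sigma> i h j)) c) \<and>
        (\<forall>i\<in>players S. \<forall>nd\<in>info_nodes S g i. \<forall>nd'.
           (\<lambda>k. pmf (bayes_belief S g (\<tau> k) i nd) nd') \<longlonglongrightarrow> pmf (\<mu> i (view g i nd)) nd'))"

definition sequential_equilibrium ::
    "society \<Rightarrow> network \<Rightarrow> profile \<Rightarrow> beliefs \<Rightarrow> bool" where
  "sequential_equilibrium S g \<sigma> \<mu> \<longleftrightarrow> sequentially_rational S g \<sigma> \<mu> \<and> consistent S g \<sigma> \<mu>"

definition bilaterally_measurable :: "society \<Rightarrow> network \<Rightarrow> profile \<Rightarrow> bool" where
  "bilaterally_measurable S g \<sigma> \<longleftrightarrow>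
     (\<forall>i\<in>players S. \<forall>j\<in>players S. \<forall>x x'.
        i \<noteq> j \<longrightarrow> Link_Node x \<in> nodes S g \<longrightarrow> Link_Node x' \<in> nodes S g \<longrightarrow>
        bilateral_history i j x = bilateral_history i j x' \<longrightarrow>
        \<sigma> i (private_history g i x) j = \<sigma> i (private_history g i x') j)"

definition bilateral_equilibrium :: "society \<Rightarrow> network \<Rightarrow> profile \<Rightarrow> bool" where
  "bilateral_equilibrium S g \<sigma> \<longleftrightarrow>
     bilaterally_measurable S g \<sigma> \<and> (\<exists>\<mu>. sequential_equilibrium S g \<sigma> \<mu>)"

definition stable_bilateral_equilibrium :: "society \<Rightarrow> network \<Rightarrow> profile \<Rightarrow> bool" where
  "stable_bilateral_equilibrium S g \<sigma> \<longleftrightarrow>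
     bilateral_equilibrium S g \<sigma> \<and>
     (\<forall>t. \<forall>x\<in>set_pmf (history_pmf S g \<sigma> t).
        net g x = g \<and> (\<forall>(l, m, a)\<in>set x. \<forall>i. m i \<noteq> None \<longrightarrow> a i = Some Coop))"

definition stable_network :: "society \<Rightarrow> network \<Rightarrow> bool" where
  "stable_network S g \<longleftrightarrow> (\<exists>\<sigma>. stable_bilateral_equilibrium S g \<sigma>)"

end

(*
  Losing one of d links costs a player the v p (1 - p)^(d - 1) alpha per period by which her own
  requests are met less often, and saves her the favors for that neighbour, worth c q(d') alpha per
  period, where q(d') = (1 - (1 - p)^d') / d' is the probability that a neighbour with d' links
  selects her. A link is sustainable if delta / (1 - delta) times the difference is at least the
  gain c - gamma from refusing a favor. The bound is the largest d that is sustainable for d = d'.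

  A player with the largest degree in the network has only neighbours of smaller degree, hence with
  larger q, so if her degree exceeds the bound, she prefers to refuse a favor in the first period, to
  cut that link, and to go on as before with everybody else. Because of bilateral measurability the
  others cannot tell this from a history on the path of play.

  In a regular network with degree equal to the bound, every link is governed by a trigger
  strategy. With uniform trembles, the limit beliefs of a player put no weight on deviations that
  do not involve her, so she believes that the neighbours she has not quarrelled with still have all
  their links. The value of her remaining links is then a concave function of their number, and
  the comparison of one link at the time decides.
*)

theory Submission
  imports Defs
begin

section \<open>Finitely supported distributions\<close>

text \<open>The obstacle is beliefs: one information set contains nodes that differ in what the
  others did to each other, and optimality is required only on average over them. For necessity the
  comparison is made where a player is asked in period 0; consistency excludes removed links there,
  and both of her payoffs can be bounded by the same numbers at all remaining nodes. For sufficiency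
  beliefs must be built at every information set. Trembles of one common size e make node
  probabilities products of e, 1 - e and constants, so Bayesian ratios converge. Erasing the
  deviations that a player does not see (\<open>purify\<close>) gives a node of the same information
  set that is likelier by a factor of order 1 / e. Optimality is checked against all strategies at
  once: a function of the history that satisfies a Bellman inequality for every strategy, with
  equality for the trigger profile, bounds continuation payoffs from both sides. Several players may
  request at once under an arbitrary joint law. Payoffs add up over requests, so expected flows
  depend only on the marginal probability \<open>need_prob S\<close>, and the bound does not depend
  on the number of players.\<close>

abbreviation expect :: "'a pmf \<Rightarrow> ('a \<Rightarrow> real) \<Rightarrow> real" where
  "expect \<equiv> measure_pmf.expectation"

lemma expect_bind:
  assumes "finite (set_pmf M)" "\<And>x. x \<in> set_pmf M \<Longrightarrow> finite (set_pmf (f x))"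
  shows "expect (bind_pmf M f) h = expect M (\<lambda>x. expect (f x) h)"
proof -
  have "expect (bind_pmf M f) h = (\<Sum>a\<in>set_pmf M. pmf M a *\<^sub>R expect (f a) h)"
    using assms by (intro pmf_expectation_bind) auto
  also have "\<dots> = expect M (\<lambda>x. expect (f x) h)"
    using assms by (subst integral_measure_pmf[of "set_pmf M"]) auto
  finally show ?thesis .
qed

lemma expect_cong:
  assumes "\<And>x. x \<in> set_pmf M \<Longrightarrow> f x = g x"
  shows "expect M f = expect M g"
  using assms by (intro integral_cong_AE) (auto simp: AE_measure_pmf_iff)

lemma expect_const:
  assumes "\<And>x. x \<in> set_pmf M \<Longrightarrow> f x = c"
  shows "expect M f = c"
  using expect_cong[of M f "\<lambda>_. c"] assms by simp

lemma expect_mono: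
  assumes "finite (set_pmf M)" "\<And>x. x \<in> set_pmf M \<Longrightarrow> f x \<le> g x"
  shows "expect M f \<le> expect M g"
  using assms by (intro integral_mono_AE integrable_measure_pmf_finite) (auto simp: AE_measure_pmf_iff)

lemma expect_le:
  assumes "finite (set_pmf M)" "\<And>x. x \<in> set_pmf M \<Longrightarrow> f x \<le> c"
  shows "expect M f \<le> c"
  using expect_mono[of M f "\<lambda>_. c"] assms by simp

lemma expect_abs_le:
  assumes "finite (set_pmf M)" "\<And>x. x \<in> set_pmf M \<Longrightarrow> \<bar>f x\<bar> \<le> c"
  shows "\<bar>expect M f\<bar> \<le> c"
proof -
  have "expect M f \<le> c" "expect M (\<lambda>x. - f x) \<le> c"
    using assms by (force intro!: expect_le)+
  then show ?thesis by simp
qed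

lemma expect_add:
  assumes "finite (set_pmf M)"
  shows "expect M (\<lambda>x. f x + g x) = expect M f + expect M g"
  using assms by (intro Bochner_Integration.integral_add integrable_measure_pmf_finite)

lemma expect_sum:
  assumes "finite (set_pmf M)"
  shows "expect M (\<lambda>x. \<Sum>j\<in>A. f j x) = (\<Sum>j\<in>A. expect M (f j))"
  using assms by (intro Bochner_Integration.integral_sum integrable_measure_pmf_finite)

text \<open>Histories and nodes record every draw, so each has a single predecessor at each stage.
  This turns their probabilities into plain products.\<close>

lemma pmf_bind_unique:
  assumes "\<And>x'. x' \<in> set_pmf M \<Longrightarrow> y \<in> set_pmf (N x') \<Longrightarrow> x' = x"
  shows "pmf (bind_pmf M N) y = pmf M x * pmf (N x) y"
proof -
  have "pmf (bind_pmf M N) y = expect M (\<lambda>x'. pmf (N x') y)"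
    by (rule pmf_bind)
  also have "\<dots> = (\<Sum>x'\<in>{x}. pmf (N x') y * pmf M x')"
    using assms by (intro integral_measure_pmf_real) (auto simp: set_pmf_eq)
  finally show ?thesis by simp
qed

section \<open>Selection of a provider\<close>

definition selection_prob :: "real \<Rightarrow> nat \<Rightarrow> real" where
  "selection_prob p n = (1 - (1 - p) ^ n) / real n"

definition pick :: "player set \<Rightarrow> (player \<Rightarrow> bool) \<Rightarrow> player option pmf" where
  "pick N able = (let A = {j \<in> N. able j}
      in if A = {} then return_pmf None else map_pmf Some (pmf_of_set A))"

lemma pmf_pick_None: "finite N \<Longrightarrow> pmf (pick N able) None = (if \<exists>j\<in>N. able j then 0 else 1)"
  by (auto simp: pick_def pmf_eq_0_set_pmf)

lemma pmf_pick_Some: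
  assumes "finite N"
  shows "pmf (pick N able) (Some j) =
    (if j \<in> N \<and> able j then 1 / real (card {l\<in>N. able l}) else 0)"
proof (cases "\<exists>j\<in>N. able j")
  case True
  then have ne: "{j \<in> N. able j} \<noteq> {}" by auto
  then have "pmf (pick N able) (Some j) = pmf (pmf_of_set {j \<in> N. able j}) j"
    unfolding pick_def Let_def by (simp only: if_False) (intro pmf_map_inj', simp)
  also have "\<dots> = indicator {j \<in> N. able j} j / real (card {l\<in>N. able l})"
    using assms ne by (intro pmf_of_set) auto
  finally show ?thesis by (simp add: indicator_def)
qed (auto simp: pick_def)

lemma set_pick:
  assumes "finite N"
  shows "set_pmf (pick N able) = (if \<exists>j\<in>N. able j then Some ` {j\<in>N. able j} else {None})"
  using assms by (auto simp: pick_def set_pmf_of_set)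

definition pick_able :: "player set \<Rightarrow> real \<Rightarrow> player set \<Rightarrow> player option pmf" where
  "pick_able P p N = bind_pmf (Pi_pmf P False (\<lambda>_. bernoulli_pmf p)) (pick N)"

text \<open>As 0 < p < 1, every ability vector on \<open>P\<close> has positive probability. Nobody
  being able produces \<open>None\<close>, and j alone being able produces
  \<open>Some j\<close>.\<close>

lemma set_pick_able:
  assumes "finite P" "N \<subseteq> P" "0 < p" "p < 1"
  shows "set_pmf (pick_able P p N) = insert None (Some ` N)"
proof -
  have finN: "finite N" using assms finite_subset by auto
  have all: "able \<in> set_pmf (Pi_pmf P False (\<lambda>_. bernoulli_pmf p))" if "\<forall>x. x \<notin> P \<longrightarrow> \<not> able x" for able
    using assms that by (auto simp: set_Pi_pmf PiE_dflt_def set_pmf_bernoulli)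
  show ?thesis
  proof (intro equalityI subsetI)
    fix y assume "y \<in> set_pmf (pick_able P p N)"
    then show "y \<in> insert None (Some ` N)"
      using finN by (auto simp: pick_able_def set_pick split: if_splits)
  next
    fix y assume "y \<in> insert None (Some ` N)"
    then consider "y = None" | j where "y = Some j" "j \<in> N" by auto
    then show "y \<in> set_pmf (pick_able P p N)"
    proof cases
      case 1
      have "y \<in> set_pmf (pick N (\<lambda>_. False))" using finN 1 by (simp add: set_pick)
      then show ?thesis unfolding pick_able_def set_bind_pmf by (intro UN_I all) auto
    next
      case 2
      have "y \<in> set_pmf (pick N (\<lambda>k. k = j))" using finN 2 by (auto simp: set_pick)
      then show ?thesis unfolding pick_able_def set_bind_pmf using 2 assms by (intro UN_I all) auto
    qed
  qed
qed

lemma pmf_pick_able_None: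
  assumes "finite P" "N \<subseteq> P" "0 < p" "p < 1"
  shows "pmf (pick_able P p N) None = (1 - p) ^ card N"
proof -
  let ?M = "Pi_pmf P False (\<lambda>_. bernoulli_pmf p)"
  have finN: "finite N" using assms finite_subset by auto
  have "pmf (pick_able P p N) None = expect ?M (\<lambda>able. if \<exists>j\<in>N. able j then 0 else 1)"
    using finN by (simp add: pick_able_def pmf_bind pmf_pick_None)
  \<comment> \<open>The event that nobody in \<open>N\<close> is able is a box over all of
    \<open>P\<close>, unconstrained outside \<open>N\<close>, so the product formula
    applies.\<close>
  also have "\<dots> = expect ?M (indicator (Pi P (\<lambda>j. if j \<in> N then {False} else UNIV)))"
    using assms by (intro arg_cong[where f="expect ?M"] ext) (auto simp: indicator_def Pi_def split: if_splits)
  also have "\<dots> = measure_pmf.prob ?M (Pi P (\<lambda>j. if j \<in> N then {False} else UNIV))"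
    by simp
  also have "\<dots> = (\<Prod>j\<in>P. if j \<in> N then 1 - p else 1)"
    using assms by (subst measure_Pi_pmf_Pi) (auto intro!: prod.cong simp: measure_pmf_single)
  also have "\<dots> = (\<Prod>j\<in>N. 1 - p)"
    using assms by (intro prod.mono_neutral_cong_right) auto
  finally show ?thesis by simp
qed

text \<open>The transposition of j and k maps \<open>P\<close> and \<open>N\<close> onto themselves
  and preserves the law of the abilities, because all ability probabilities are equal. Hence
  neighbours are interchangeable.\<close>

lemma pmf_pick_able_Some_eq:
  assumes "finite P" "N \<subseteq> P" "j \<in> N" "k \<in> N"
  shows "pmf (pick_able P p N) (Some j) = pmf (pick_able P p N) (Some k)"
proof -
  let ?M = "Pi_pmf P False (\<lambda>_. bernoulli_pmf p)" and ?t = "Transposition.transpose j k"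
  have finN: "finite N" using assms finite_subset by auto
  have bij: "bij_betw ?t P P"
    by (rule bij_betw_byWitness[where f'="?t"])
       (use assms in \<open>auto simp: Transposition.transpose_def split: if_splits\<close>)
  have *: "?M = map_pmf (\<lambda>g. g \<circ> ?t) ?M"
    using assms bij
    by (intro Pi_pmf_bij_betw) (auto simp: Transposition.transpose_def split: if_splits)
  have card: "card {l\<in>N. g (?t l)} = card {l\<in>N. g l}" for g :: "player \<Rightarrow> bool"
    by (rule bij_betw_same_card[of ?t], rule bij_betw_byWitness[where f'="?t"])
       (use assms in \<open>auto simp: Transposition.transpose_def split: if_splits\<close>)
  have "pmf (pick_able P p N) (Some j) = expect ?M (\<lambda>g. pmf (pick N g) (Some j))"
    by (simp add: pick_able_def pmf_bind)
  also have "\<dots> = expect ?M (\<lambda>g. pmf (pick N (g \<circ> ?t)) (Some j))"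
    by (subst *) simp
  also have "\<dots> = expect ?M (\<lambda>g. pmf (pick N g) (Some k))"
    using assms finN by (intro expect_cong) (simp add: pmf_pick_Some card)
  finally show ?thesis by (simp add: pick_able_def pmf_bind)
qed

text \<open>The probabilities of all outcomes sum to 1. After subtracting that of
  \<open>None\<close>, the rest is shared by \<open>card N\<close> equal terms.\<close>

lemma pmf_pick_able_Some:
  assumes "finite P" "N \<subseteq> P" "0 < p" "p < 1" "j \<in> N"
  shows "pmf (pick_able P p N) (Some j) = selection_prob p (card N)"
proof -
  let ?M = "pick_able P p N"
  have finN: "finite N" using assms finite_subset by auto
  have "1 = (\<Sum>y\<in>insert None (Some ` N). pmf ?M y)"
    using finN by (intro sum_pmf_eq_1[symmetric]) (auto simp: set_pick_able[OF assms(1-4)])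
  also have "\<dots> = pmf ?M None + (\<Sum>k\<in>N. pmf ?M (Some k))"
    using finN by (simp add: sum.reindex)
  also have "(\<Sum>k\<in>N. pmf ?M (Some k)) = (\<Sum>k\<in>N. pmf ?M (Some j))"
    using assms by (intro sum.cong pmf_pick_able_Some_eq) auto
  finally have "1 = (1 - p) ^ card N + real (card N) * pmf ?M (Some j)"
    using pmf_pick_able_None[OF assms(1-4)] by simp
  moreover have "card N > 0" using finN assms by (auto simp: card_gt_0_iff)
  ultimately show ?thesis by (simp add: selection_prob_def field_simps)
qed

text \<open>By the geometric sum, \<open>selection_prob p n\<close> is p times the average of the
  first n powers of 1 - p. These powers decrease, and so does their average.\<close>

lemma selection_prob_antimono:
  assumes "0 < p" "p < 1" "0 < m" "m \<le> n"
  shows "selection_prob p n \<le> selection_prob p m"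
proof -
  have geo: "1 - (1 - p) ^ k = p * (\<Sum>i<k. (1 - p) ^ i)" for k
    using assms by (simp add: sum_gp_strict)
  have "real m * (\<Sum>i<n. (1 - p) ^ i) \<le> real n * (\<Sum>i<m. (1 - p) ^ i)"
    using \<open>m \<le> n\<close>
  proof (induction n rule: dec_induct)
    case (step n)
    have "real m * (1 - p) ^ n = (\<Sum>i<m. (1 - p) ^ n)" by simp
    also have "\<dots> \<le> (\<Sum>i<m. (1 - p) ^ i)"
      using assms step by (intro sum_mono power_decreasing) auto
    finally show ?case using step by (simp add: algebra_simps)
  qed simp
  then have "p * (real m * (\<Sum>i<n. (1 - p) ^ i)) \<le> p * (real n * (\<Sum>i<m. (1 - p) ^ i))"
    using assms by (intro mult_left_mono) auto
  then have "real m * (1 - (1 - p) ^ n) \<le> real n * (1 - (1 - p) ^ m)"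
    unfolding geo by (simp add: algebra_simps)
  then show ?thesis using assms by (simp add: selection_prob_def field_simps)
qed

section \<open>Feasible histories\<close>

lemma finite_set_match: "finite {i. m i \<noteq> None}" if "m \<in> set_pmf (match_stage S G)"
  and "set_pmf (needs S) \<subseteq> Pow P" and "finite P"
proof -
  from that(1) obtain T where T: "T \<in> set_pmf (needs S)" "m \<in> set_pmf (Pi_pmf T None (select S G))"
    unfolding match_stage_def set_bind_pmf by (elim UN_E)
  have "finite T" by (rule finite_subset[OF _ that(3)]) (use T(1) that(2) in blast)
  then have "m \<in> PiE_dflt T None (set_pmf \<circ> select S G)" using T(2) by (simp add: set_Pi_pmf)
  then have "{i. m i \<noteq> None} \<subseteq> T" unfolding PiE_dflt_def
    by (metis (mono_tags, lifting) mem_Collect_eq subsetI)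
  then show ?thesis using \<open>finite T\<close> by (rule finite_subset)
qed

lemma mem_kept: "{i, j} \<in> kept G l \<longleftrightarrow> {i, j} \<in> G \<and> l (i, j) = Keep \<and> l (j, i) = Keep"
proof
  assume "{i, j} \<in> kept G l"
  then have "{i, j} \<in> G" "\<forall>a b. {i, j} = {a, b} \<longrightarrow> l (a, b) = Keep"
    unfolding kept_def by simp_all
  then show "{i, j} \<in> G \<and> l (i, j) = Keep \<and> l (j, i) = Keep"
    by (metis insert_commute)
next
  assume "{i, j} \<in> G \<and> l (i, j) = Keep \<and> l (j, i) = Keep"
  then show "{i, j} \<in> kept G l"
    unfolding kept_def mem_Collect_eq doubleton_eq_iff by blast
qed

lemma kept_subset: "kept G l \<subseteq> G"
  by (auto simp: kept_def)

lemma net_Nil [simp]: "net g [] = g"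
  by (simp add: net_def)

lemma net_snoc [simp]: "net g (x @ [(l, m, a)]) = kept (net g x) l"
  by (simp add: net_def)

lemma net_subset: "net g x \<subseteq> g"
proof (induction x rule: rev_induct)
  case (snoc o' x)
  obtain l m a where "o' = (l, m, a)" by (cases o')
  then show ?case using subset_trans[OF kept_subset snoc.IH] by simp
qed simp

lemma mem_nbrs: "j \<in> nbrs G i \<longleftrightarrow> {i, j} \<in> G"
  by (simp add: nbrs_def)

lemma nbrs_sym: "j \<in> nbrs G i \<longleftrightarrow> i \<in> nbrs G j"
  by (simp add: nbrs_def insert_commute)

lemma length_private_history: "length (fst (private_history g i x)) = length x"
  by (simp add: private_history_def)

lemma expect_period_end_Favor:
  "expect (period_end S g \<sigma> (Favor_Node x l m)) h =
     expect (favor_stage g \<sigma> x m) (\<lambda>a. h (x @ [(l, m, a)]))"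
proof -
  have "period_end S g \<sigma> (Favor_Node x l m) = map_pmf (\<lambda>a. x @ [(l, m, a)]) (favor_stage g \<sigma> x m)"
    by (simp add: map_pmf_def)
  then show ?thesis by (simp only: integral_map_pmf)
qed

section \<open>Laws of matchings and flow payoffs in a substitutable society\<close>

locale favor_network =
  fixes S :: society and p :: real and g :: network
  assumes soc: "society S" and p0: "0 < p" and p1: "p < 1"
    and sub: "substitutable S p" and on: "network_on S g"
begin

abbreviation "\<alpha> \<equiv> need_prob S"
abbreviation "\<delta> \<equiv> discount S"
abbreviation "v \<equiv> benefit (game S)"
abbreviation "c \<equiv> cost (game S)"
abbreviation "\<gamma> \<equiv> refusal (game S)"

lemma params: "0 < \<alpha>" "\<alpha> \<le> 1" "0 < \<delta>" "\<delta> < 1" "0 < c" "c < v" "0 \<le> \<gamma>" "\<gamma> < c"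
  using soc unfolding society_def favor_game_def by blast+

lemma finite_players [simp]: "finite (players S)"
  by (simp add: players_def)

lemma needs_subset: "set_pmf (needs S) \<subseteq> Pow (players S)"
  using soc unfolding society_def by blast

lemma prob_need: "i \<in> players S \<Longrightarrow> measure_pmf.prob (needs S) {T. i \<in> T} = \<alpha>"
  using soc unfolding society_def by blast

lemma link_players:
  assumes "{i, j} \<in> g"
  shows "i \<in> players S" "j \<in> players S" "i \<noteq> j"
proof -
  have "{i, j} \<in> {{i, j} |i j. i \<in> players S \<and> j \<in> players S \<and> i \<noteq> j}"
    using assms on unfolding network_on_def by (rule subsetD[rotated])
  then obtain a b where "{i, j} = {a, b}" and ab: "a \<in> players S" "b \<in> players S" "a \<noteq> b"
    by (elim CollectE exE conjE) (rule that)
  then have "i = a \<and> j = b \<or> i = b \<and> j = a" by (simp only: doubleton_eq_iff)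
  with ab show "i \<in> players S" "j \<in> players S" "i \<noteq> j" by auto
qed

lemma finite_links:
  assumes "G \<subseteq> g"
  shows "finite {(i, j). {i, j} \<in> G}"
  by (rule finite_subset[of _ "players S \<times> players S"]) (use assms link_players in blast, simp)

lemma nbrs_subset: "G \<subseteq> g \<Longrightarrow> nbrs G i \<subseteq> players S - {i}"
  using link_players unfolding nbrs_def by blast

lemma finite_nbrs: "G \<subseteq> g \<Longrightarrow> finite (nbrs G i)"
  by (rule finite_subset[OF nbrs_subset]) auto

text \<open>All types have the same ability probability p, so the draw of the type has no effect on
  the abilities.\<close>

lemma select_eq:
  assumes "G \<subseteq> g"
  shows "select S G i = pick_able (players S - {i}) p (nbrs G i)"
proof -
  have F: "finite (favor_types S)" "favor_types S \<noteq> {}" using soc by (auto simp: society_def)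
  have "select S G i = bind_pmf (pmf_of_set (favor_types S)) (\<lambda>_. pick_able (players S - {i}) p (nbrs G i))"
    unfolding select_def
  proof (rule bind_pmf_cong[OF refl])
    fix f assume "f \<in> set_pmf (pmf_of_set (favor_types S))"
    then have f: "f \<in> favor_types S" using F by simp
    have "Pi_pmf (players S - {i}) False (\<lambda>j. bernoulli_pmf (able_prob S j f)) =
        Pi_pmf (players S - {i}) False (\<lambda>_. bernoulli_pmf p)"
      using sub f by (intro Pi_pmf_cong) (auto simp: substitutable_def)
    then show "bind_pmf (Pi_pmf (players S - {i}) False (\<lambda>j. bernoulli_pmf (able_prob S j f)))
       (\<lambda>able. let A = {j \<in> nbrs G i. able j} in if A = {} then return_pmf None else map_pmf Some (pmf_of_set A))
      = pick_able (players S - {i}) p (nbrs G i)"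
      by (simp add: pick_able_def pick_def[abs_def])
  qed
  then show ?thesis by (simp add: bind_pmf_const)
qed

lemma set_select: "G \<subseteq> g \<Longrightarrow> set_pmf (select S G i) = insert None (Some ` nbrs G i)"
  using nbrs_subset p0 p1 by (simp add: select_eq set_pick_able)

lemma pmf_select_None: "G \<subseteq> g \<Longrightarrow> pmf (select S G i) None = (1 - p) ^ deg G i"
  using nbrs_subset p0 p1 by (simp add: select_eq pmf_pick_able_None deg_def)

lemma pmf_select_Some:
  "G \<subseteq> g \<Longrightarrow> j \<in> nbrs G i \<Longrightarrow> pmf (select S G i) (Some j) = selection_prob p (deg G i)"
  using nbrs_subset p0 p1 by (simp add: select_eq pmf_pick_able_Some deg_def)

lemma finite_needs: "finite (set_pmf (needs S))"
  by (rule finite_subset[OF needs_subset]) simp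

lemma needs_finite: "T \<in> set_pmf (needs S) \<Longrightarrow> finite T"
  using needs_subset by (blast intro: finite_subset[OF _ finite_players])

lemma set_match_stage:
  assumes "G \<subseteq> g"
  shows "set_pmf (match_stage S G) =
    (\<Union>T\<in>set_pmf (needs S). {m. \<forall>i. if i \<in> T then m i \<in> insert None (Some ` nbrs G i) else m i = None})"
proof -
  have "set_pmf (Pi_pmf T None (select S G)) =
      {m. \<forall>i. if i \<in> T then m i \<in> insert None (Some ` nbrs G i) else m i = None}"
    if "T \<in> set_pmf (needs S)" for T
    using needs_finite[OF that] assms by (simp add: set_Pi_pmf PiE_dflt_def set_select)
  then show ?thesis unfolding match_stage_def set_bind_pmf by (intro SUP_cong) auto
qed

lemma finite_match_stage:
  assumes "G \<subseteq> g"
  shows "finite (set_pmf (match_stage S G))"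
proof -
  show ?thesis unfolding match_stage_def set_bind_pmf
  proof (intro finite_UN_I finite_needs)
    fix T assume "T \<in> set_pmf (needs S)"
    then show "finite (set_pmf (Pi_pmf T None (select S G)))"
      using needs_finite assms finite_nbrs by (auto simp: set_Pi_pmf set_select intro!: finite_PiE_dflt)
  qed
qed

lemma match_stage_link:
  assumes "m \<in> set_pmf (match_stage S G)" "G \<subseteq> g" "m i = Some j"
  shows "{i, j} \<in> G"
  using assms(1,3) unfolding set_match_stage[OF assms(2)]
  by (auto simp: mem_nbrs dest!: spec[of _ i] split: if_splits)

lemma match_stage_players:
  assumes "m \<in> set_pmf (match_stage S G)" "G \<subseteq> g" "m i = Some j"
  shows "i \<in> players S" "j \<in> players S" "i \<noteq> j"
  using link_players[OF subsetD[OF assms(2) match_stage_link[OF assms]]] by auto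

text \<open>An additional link only adds possible providers. A matching that occurs after links were
  cut can therefore be replayed in a larger network, in particular in \<open>g\<close>.\<close>

lemma match_stage_mono:
  assumes "G \<subseteq> G'" "G' \<subseteq> g"
  shows "set_pmf (match_stage S G) \<subseteq> set_pmf (match_stage S G')"
proof -
  have "m i \<in> insert None (Some ` nbrs G' i)" if "m i \<in> insert None (Some ` nbrs G i)" for m i
    using that assms(1) by (auto simp: nbrs_def)
  then show ?thesis
    unfolding set_match_stage[OF assms(2)] set_match_stage[OF subset_trans[OF assms]]
    by (intro UN_mono subset_refl Collect_mono impI allI) meson
qed

lemma finite_requesters: "m \<in> set_pmf (match_stage S G) \<Longrightarrow> finite {i. m i \<noteq> None}"
  by (rule finite_set_match[OF _ needs_subset finite_players])

text \<open>Positive \<open>need_prob S\<close> yields a possible set T of needs that contains i.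
  Every other member of T may find no able neighbour, so a single matched request is possible even
  if T is never a singleton.\<close>

lemma single_request_match:
  assumes "G \<subseteq> g" "{i, j} \<in> G"
  shows "(\<lambda>_. None)(i := Some j) \<in> set_pmf (match_stage S G)"
proof -
  have i: "i \<in> players S" using link_players(1)[OF subsetD[OF assms]] .
  have "\<exists>T\<in>set_pmf (needs S). i \<in> T"
  proof (rule ccontr)
    assume "\<not> ?thesis"
    then have "measure_pmf.prob (needs S) {T. i \<in> T} = 0" by (simp add: measure_pmf_zero_iff disjoint_iff)
    then show False using prob_need[OF i] params by simp
  qed
  then show ?thesis using assms(2) unfolding set_match_stage[OF assms(1)] mem_nbrs[symmetric] by force
qed

text \<open>Given the set of needs, requests are matched independently. Expected payoffs are sums
  over requesters, so these marginals are all that is needed of the joint law.\<close>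

lemma match_component:
  "map_pmf (\<lambda>m. m i) (match_stage S G) =
    bind_pmf (needs S) (\<lambda>T. if i \<in> T then select S G i else return_pmf None)"
  unfolding match_stage_def map_bind_pmf
  by (intro bind_pmf_cong refl) (simp add: Pi_pmf_component needs_finite)

lemma pmf_match_component_Some:
  assumes "i \<in> players S"
  shows "pmf (map_pmf (\<lambda>m. m i) (match_stage S G)) (Some j) = \<alpha> * pmf (select S G i) (Some j)"
proof -
  have "pmf (map_pmf (\<lambda>m. m i) (match_stage S G)) (Some j) =
      expect (needs S) (\<lambda>T. pmf (select S G i) (Some j) * indicator {T. i \<in> T} T)"
    unfolding match_component pmf_bind by (intro expect_cong) (auto simp: indicator_def)
  also have "\<dots> = pmf (select S G i) (Some j) * measure_pmf.prob (needs S) {T. i \<in> T}"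
    by simp
  finally show ?thesis using prob_need[OF assms] by simp
qed

lemma pmf_match_component_None:
  assumes "i \<in> players S"
  shows "pmf (map_pmf (\<lambda>m. m i) (match_stage S G)) None = 1 - \<alpha> * (1 - pmf (select S G i) None)"
proof -
  have "pmf (map_pmf (\<lambda>m. m i) (match_stage S G)) None =
      expect (needs S) (\<lambda>T. 1 - (1 - pmf (select S G i) None) * indicator {T. i \<in> T} T)"
    unfolding match_component pmf_bind by (intro expect_cong) (auto simp: indicator_def)
  also have "\<dots> = 1 - (1 - pmf (select S G i) None) * measure_pmf.prob (needs S) {T. i \<in> T}"
    using finite_needs by (subst Bochner_Integration.integral_diff) (auto intro!: integrable_measure_pmf_finite)
  finally show ?thesis using prob_need[OF assms] by simp
qed

text \<open>The expected payoff of i per period when all links of \<open>G\<close> are in place and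
  all favors involving i are provided.\<close>

definition flow :: "network \<Rightarrow> player \<Rightarrow> real" where
  "flow G i = \<alpha> * (v * (1 - (1 - p) ^ deg G i) - c * (\<Sum>j\<in>nbrs G i. selection_prob p (deg G j)))"

definition coop_payoff :: "player \<Rightarrow> matching \<Rightarrow> real" where
  "coop_payoff i m = (if m i = None then 0 else v) - c * real (card {j\<in>players S. m j = Some i})"

lemma expect_coop_payoff:
  assumes "G \<subseteq> g" "i \<in> players S"
  shows "expect (match_stage S G) (coop_payoff i) = flow G i"
proof -
  let ?M = "match_stage S G"
  note fin = finite_match_stage[OF assms(1)]
  have req: "expect ?M (\<lambda>m. if m i = None then 0 else v) = \<alpha> * (v * (1 - (1 - p) ^ deg G i))"
  proof -
    have "expect ?M (\<lambda>m. if m i = None then 0 else v) =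
        expect (map_pmf (\<lambda>m. m i) ?M) (\<lambda>y. v - v * indicator {None} y)"
      unfolding integral_map_pmf by (intro expect_cong) auto
    also have "\<dots> = v - v * pmf (map_pmf (\<lambda>m. m i) ?M) None"
      using fin by (subst Bochner_Integration.integral_diff)
        (auto intro!: integrable_measure_pmf_finite simp: measure_pmf_single)
    finally show ?thesis
      using pmf_match_component_None[OF assms(2)] pmf_select_None[OF assms(1)] by (simp add: algebra_simps)
  qed
  have one: "expect ?M (\<lambda>m. if m j = Some i then 1 else 0) =
      (if j \<in> nbrs G i then \<alpha> * selection_prob p (deg G j) else 0)" if "j \<in> players S" for j
  proof -
    have "expect ?M (\<lambda>m. if m j = Some i then 1 else 0) =
        expect (map_pmf (\<lambda>m. m j) ?M) (indicator {Some i})"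
      unfolding integral_map_pmf by (intro expect_cong) auto
    also have "\<dots> = pmf (map_pmf (\<lambda>m. m j) ?M) (Some i)" by (simp add: measure_pmf_single)
    also have "\<dots> = \<alpha> * pmf (select S G j) (Some i)" by (rule pmf_match_component_Some[OF that])
    also have "pmf (select S G j) (Some i) = (if j \<in> nbrs G i then selection_prob p (deg G j) else 0)"
      using pmf_select_Some[OF assms(1), of i j] set_select[OF assms(1), of j]
      by (auto simp: nbrs_sym[of i G j] pmf_eq_0_set_pmf)
    finally show ?thesis by simp
  qed
  have "expect ?M (coop_payoff i) = expect ?M (\<lambda>m. (if m i = None then 0 else v) +
      (\<Sum>j\<in>players S. - c * (if m j = Some i then 1 else 0)))"
    by (intro expect_cong) (simp add: coop_payoff_def sum.If_cases Int_def sum_distrib_left[symmetric] sum_negf)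
  also have "\<dots> = \<alpha> * (v * (1 - (1 - p) ^ deg G i)) +
      (\<Sum>j\<in>players S. - c * (if j \<in> nbrs G i then \<alpha> * selection_prob p (deg G j) else 0))"
    using one by (subst expect_add[OF fin], subst expect_sum[OF fin]) (simp add: req)
  also have "(\<Sum>j\<in>players S. - c * (if j \<in> nbrs G i then \<alpha> * selection_prob p (deg G j) else 0)) =
      (\<Sum>j\<in>nbrs G i. - c * (\<alpha> * selection_prob p (deg G j)))"
    using nbrs_subset[OF assms(1), of i] by (intro sum.mono_neutral_cong_right) auto
  finally show ?thesis
    by (simp add: flow_def algebra_simps sum_distrib_left sum_negf)
qed

section \<open>Feasible histories as the supports of completely mixed play\<close>

definition feasible_links :: "network \<Rightarrow> link_choices \<Rightarrow> bool" where
  "feasible_links G l \<longleftrightarrow> (\<forall>i j. {i, j} \<notin> G \<longrightarrow> l (i, j) = Keep)"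

definition feasible_favors :: "matching \<Rightarrow> favors \<Rightarrow> bool" where
  "feasible_favors m a \<longleftrightarrow> (\<forall>i. a i = None \<longleftrightarrow> m i = None)"

text \<open>The histories reached with positive probability under completely mixed profiles,
  described without reference to a profile.\<close>

inductive feasible :: "history \<Rightarrow> bool" where
  Nil: "feasible []"
| snoc: "feasible x \<Longrightarrow> feasible_links (net g x) l \<Longrightarrow> m \<in> set_pmf (match_stage S (kept (net g x) l)) \<Longrightarrow>
    feasible_favors m a \<Longrightarrow> feasible (x @ [(l, m, a)])"

fun feasible_node :: "node \<Rightarrow> bool" where
  "feasible_node (Link_Node x) = feasible x"
| "feasible_node (Favor_Node x l m) \<longleftrightarrow>
    feasible x \<and> feasible_links (net g x) l \<and> m \<in> set_pmf (match_stage S (kept (net g x) l))"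

lemma feasible_snoc_iff:
  "feasible (x @ [(l, m, a)]) \<longleftrightarrow> feasible_node (Favor_Node x l m) \<and> feasible_favors m a"
  by (auto elim: feasible.cases intro: feasible.intros)

lemma kept_net_subset: "kept (net g x) l \<subseteq> g"
  using kept_subset net_subset by blast

lemma link_stage_Pi:
  "set_pmf (link_stage g \<sigma> x) =
    {l. \<forall>i j. if {i, j} \<in> net g x then l (i, j) \<in> set_pmf (fst (\<sigma> i (private_history g i x) j)) else l (i, j) = Keep}"
  unfolding link_stage_def using finite_links[OF net_subset, of x]
  by (auto simp: set_Pi_pmf PiE_dflt_def)

lemma favor_stage_Pi:
  assumes "finite {i. m i \<noteq> None}"
  shows "set_pmf (favor_stage g \<sigma> x m) =
    {a. \<forall>i. case m i of None \<Rightarrow> a i = None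
        | Some j \<Rightarrow> a i \<in> Some ` set_pmf (snd (\<sigma> j (private_history g j x) i))}"
  unfolding favor_stage_def using assms
  by (auto simp: set_Pi_pmf PiE_dflt_def Let_def split: option.splits)

lemma finite_link_choice [simp]: "finite (X :: link_choice set)"
proof -
  have "(UNIV :: link_choice set) = {Keep, Remove}" using link_choice.exhaust by auto
  then show ?thesis by (metis finite.emptyI finite.insertI finite_subset subset_UNIV)
qed

lemma finite_favor_choice [simp]: "finite (X :: favor_choice set)"
proof -
  have "(UNIV :: favor_choice set) = {Coop, Defect}" using favor_choice.exhaust by auto
  then show ?thesis by (metis finite.emptyI finite.insertI finite_subset subset_UNIV)
qed

lemma finite_link_stage: "finite (set_pmf (link_stage g \<sigma> x))"
  unfolding link_stage_def using finite_links[OF net_subset, of x]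
  by (auto simp: set_Pi_pmf intro!: finite_PiE_dflt)

lemma finite_favor_stage: "finite {i. m i \<noteq> None} \<Longrightarrow> finite (set_pmf (favor_stage g \<sigma> x m))"
  unfolding favor_stage_def by (auto simp: set_Pi_pmf Let_def intro!: finite_PiE_dflt)

lemma link_stage_feasible: "l \<in> set_pmf (link_stage g \<sigma> x) \<Longrightarrow> feasible_links (net g x) l"
  unfolding link_stage_Pi feasible_links_def by (fastforce split: if_splits)

lemma favor_stage_feasible:
  assumes "finite {i. m i \<noteq> None}" "a \<in> set_pmf (favor_stage g \<sigma> x m)"
  shows "feasible_favors m a"
  unfolding feasible_favors_def
proof
  fix i
  have "case m i of None \<Rightarrow> a i = None
        | Some j \<Rightarrow> a i \<in> Some ` set_pmf (snd (\<sigma> j (private_history g j x) i))"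
    using assms unfolding favor_stage_Pi[OF assms(1)] by blast
  then show "(a i = None) = (m i = None)" by (auto split: option.splits)
qed

lemma expect_period_end_Link:
  "expect (period_end S g \<sigma> (Link_Node x)) h =
     expect (link_stage g \<sigma> x) (\<lambda>l. expect (match_stage S (kept (net g x) l))
       (\<lambda>m. expect (favor_stage g \<sigma> x m) (\<lambda>a. h (x @ [(l, m, a)]))))"
proof -
  let ?F = "\<lambda>l m. map_pmf (\<lambda>a. x @ [(l, m, a)]) (favor_stage g \<sigma> x m)"
  let ?M = "\<lambda>l. match_stage S (kept (net g x) l)"
  have F: "finite (set_pmf (?F l m))" if "m \<in> set_pmf (?M l)" for l m
    using finite_favor_stage[OF finite_requesters[OF that]] by simp
  have M: "finite (set_pmf (?M l))" for l
    by (rule finite_match_stage[OF kept_net_subset])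
  have MF: "finite (set_pmf (bind_pmf (?M l) (?F l)))" for l
    unfolding set_bind_pmf using M F by (intro finite_UN_I)
  have "period_end S g \<sigma> (Link_Node x) = bind_pmf (link_stage g \<sigma> x) (\<lambda>l. bind_pmf (?M l) (?F l))"
    by (simp add: map_pmf_def)
  then have "expect (period_end S g \<sigma> (Link_Node x)) h =
      expect (link_stage g \<sigma> x) (\<lambda>l. expect (bind_pmf (?M l) (?F l)) h)"
    using expect_bind[OF finite_link_stage MF] by simp
  also have "\<dots> = expect (link_stage g \<sigma> x) (\<lambda>l. expect (?M l) (\<lambda>m. expect (?F l m) h))"
    by (intro expect_cong expect_bind M F)
  finally show ?thesis by simp
qed

lemma set_period_end_Link:
  "set_pmf (period_end S g \<sigma> (Link_Node x)) =
    {x @ [(l, m, a)] |l m a. l \<in> set_pmf (link_stage g \<sigma> x) \<and>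
       m \<in> set_pmf (match_stage S (kept (net g x) l)) \<and> a \<in> set_pmf (favor_stage g \<sigma> x m)}"
  unfolding period_end.simps set_bind_pmf set_return_pmf by blast

lemma set_period_end_Favor:
  "set_pmf (period_end S g \<sigma> (Favor_Node x l m)) =
    {x @ [(l, m, a)] |a. a \<in> set_pmf (favor_stage g \<sigma> x m)}"
  unfolding period_end.simps set_bind_pmf set_return_pmf by blast

lemma finite_period_end:
  assumes "feasible_node nd"
  shows "finite (set_pmf (period_end S g \<sigma> nd))"
proof (cases nd)
  case (Link_Node x)
  show ?thesis
    unfolding Link_Node period_end.simps set_bind_pmf
    by (intro finite_UN_I finite_link_stage finite_match_stage[OF kept_net_subset] finite_favor_stage)
       (auto dest: finite_requesters)
next
  case (Favor_Node x l m)
  then have "finite {i. m i \<noteq> None}" using assms finite_requesters by auto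
  then show ?thesis
    unfolding Favor_Node period_end.simps set_bind_pmf by (intro finite_UN_I finite_favor_stage) auto
qed

lemma period_end_feasible:
  assumes "feasible_node nd" "y \<in> set_pmf (period_end S g \<sigma> nd)"
  shows "feasible y"
proof (cases nd)
  case (Link_Node x)
  then obtain l m a where y: "y = x @ [(l, m, a)]" "l \<in> set_pmf (link_stage g \<sigma> x)"
    "m \<in> set_pmf (match_stage S (kept (net g x) l))" "a \<in> set_pmf (favor_stage g \<sigma> x m)"
    using assms(2) unfolding Link_Node set_period_end_Link by blast
  show ?thesis
    unfolding y(1)
    using assms(1) Link_Node y(3) link_stage_feasible[OF y(2)]
      favor_stage_feasible[OF finite_requesters[OF y(3)] y(4)]
    by (auto intro: feasible.snoc)
next
  case (Favor_Node x l m)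
  then obtain a where y: "y = x @ [(l, m, a)]" "a \<in> set_pmf (favor_stage g \<sigma> x m)"
    using assms(2) unfolding Favor_Node set_period_end_Favor by blast
  have m: "m \<in> set_pmf (match_stage S (kept (net g x) l))" using assms(1) Favor_Node by simp
  show ?thesis
    unfolding y(1) feasible_snoc_iff
    using assms(1) Favor_Node favor_stage_feasible[OF finite_requesters[OF m] y(2)] by auto
qed

lemma history_feasible:
  "x \<in> set_pmf (history_pmf S g \<sigma> t) \<Longrightarrow> feasible x \<and> length x = t"
proof (induction t arbitrary: x)
  case 0
  then show ?case by (simp add: feasible.Nil)
next
  case (Suc t)
  obtain y where y: "y \<in> set_pmf (history_pmf S g \<sigma> t)"
    "x \<in> set_pmf (period_end S g \<sigma> (Link_Node y))"
    using Suc.prems unfolding history_pmf.simps set_bind_pmf by (elim UN_E)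
  have 1: "feasible y \<and> length y = t" by (rule Suc.IH[OF y(1)])
  obtain l m a where x: "x = y @ [(l, m, a)]" using y(2) unfolding set_period_end_Link by auto
  have "feasible x" by (rule period_end_feasible[OF _ y(2)]) (use 1 in simp)
  then show ?case using 1 x by simp
qed

lemma finite_history_pmf: "finite (set_pmf (history_pmf S g \<sigma> t))"
proof (induction t)
  case (Suc t)
  show ?case
    unfolding history_pmf.simps set_bind_pmf
  proof (intro finite_UN_I Suc finite_period_end)
    fix x assume "x \<in> set_pmf (history_pmf S g \<sigma> t)"
    then show "feasible_node (Link_Node x)" by (auto dest: history_feasible)
  qed
qed simp

lemma completely_mixed_link_stage:
  assumes "completely_mixed \<sigma>"
  shows "set_pmf (link_stage g \<sigma> x) = {l. feasible_links (net g x) l}"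
proof -
  have "set_pmf (fst (\<sigma> i h j)) = UNIV" for i h j
    using assms unfolding completely_mixed_def by blast
  then show ?thesis unfolding link_stage_Pi feasible_links_def by simp
qed

lemma completely_mixed_favor_stage:
  assumes "completely_mixed \<sigma>" "finite {i. m i \<noteq> None}"
  shows "set_pmf (favor_stage g \<sigma> x m) = {a. feasible_favors m a}"
proof -
  have mixed: "set_pmf (snd (\<sigma> i h j)) = UNIV" for i h j
    using assms unfolding completely_mixed_def by blast
  show ?thesis
    unfolding favor_stage_Pi[OF assms(2)] feasible_favors_def mixed
  proof (intro Collect_cong iff_allI)
    fix a :: favors and i
    show "(case m i of None \<Rightarrow> a i = None | Some j \<Rightarrow> a i \<in> range Some) = ((a i = None) = (m i = None))"
      by (cases "m i"; cases "a i") auto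
  qed
qed

lemma completely_mixed_history:
  assumes "completely_mixed \<sigma>"
  shows "set_pmf (history_pmf S g \<sigma> t) = {x. feasible x \<and> length x = t}"
proof (intro equalityI subsetI)
  fix x assume "x \<in> {x. feasible x \<and> length x = t}"
  then have "feasible x" "t = length x" by auto
  then show "x \<in> set_pmf (history_pmf S g \<sigma> t)"
  proof (induction arbitrary: t rule: feasible.induct)
    case (snoc x l m a)
    have "l \<in> set_pmf (link_stage g \<sigma> x)"
      unfolding completely_mixed_link_stage[OF assms] using snoc.hyps(2) by simp
    moreover have "a \<in> set_pmf (favor_stage g \<sigma> x m)"
      unfolding completely_mixed_favor_stage[OF assms finite_requesters[OF snoc.hyps(3)]]
      using snoc.hyps(4) by simp
    ultimately have step: "x @ [(l, m, a)] \<in> set_pmf (period_end S g \<sigma> (Link_Node x))"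
      unfolding set_period_end_Link using snoc.hyps(3) by blast
    have "x \<in> set_pmf (history_pmf S g \<sigma> (length x))" by (rule snoc.IH) simp
    then show ?case
      unfolding snoc.prems length_append_singleton history_pmf.simps set_bind_pmf
      by (rule UN_I[of x _ "x @ [(l, m, a)]" "\<lambda>y. set_pmf (period_end S g \<sigma> (Link_Node y))", OF _ step])
  qed simp
next
  fix x assume "x \<in> set_pmf (history_pmf S g \<sigma> t)"
  then show "x \<in> {x. feasible x \<and> length x = t}" using history_feasible[of x \<sigma> t] by simp
qed

text \<open>\<open>node_pmf\<close> depends on its node only through the class of this relation: the
  kind of node and the number of past periods.\<close>

fun same_stage :: "node \<Rightarrow> node \<Rightarrow> bool" where
  "same_stage (Link_Node x) (Link_Node x') = (length x = length x')"
| "same_stage (Favor_Node x _ _) (Favor_Node x' _ _) = (length x = length x')"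
| "same_stage _ _ = False"

lemma set_node_pmf_Link:
  "set_pmf (node_pmf S g \<sigma> (Link_Node x)) = Link_Node ` set_pmf (history_pmf S g \<sigma> (length x))"
  by simp

lemma set_node_pmf_Favor:
  "set_pmf (node_pmf S g \<sigma> (Favor_Node x l m)) =
    {Favor_Node x' l' m' |x' l' m'. x' \<in> set_pmf (history_pmf S g \<sigma> (length x)) \<and>
      l' \<in> set_pmf (link_stage g \<sigma> x') \<and> m' \<in> set_pmf (match_stage S (kept (net g x') l'))}"
  unfolding node_pmf.simps set_bind_pmf set_return_pmf by blast

lemma node_pmf_feasible:
  assumes "nd' \<in> set_pmf (node_pmf S g \<sigma> nd)"
  shows "feasible_node nd' \<and> same_stage nd nd'"
proof (cases nd)
  case (Link_Node x)
  then show ?thesis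
    using assms unfolding Link_Node set_node_pmf_Link by (auto dest: history_feasible)
next
  case (Favor_Node x l m)
  then obtain x' l' m' where "nd' = Favor_Node x' l' m'" "x' \<in> set_pmf (history_pmf S g \<sigma> (length x))"
      "l' \<in> set_pmf (link_stage g \<sigma> x')" "m' \<in> set_pmf (match_stage S (kept (net g x') l'))"
    using assms unfolding Favor_Node set_node_pmf_Favor by blast
  then show ?thesis using Favor_Node by (auto dest: history_feasible link_stage_feasible)
qed

lemma completely_mixed_node_pmf:
  assumes "completely_mixed \<sigma>"
  shows "set_pmf (node_pmf S g \<sigma> nd) = {nd'. feasible_node nd' \<and> same_stage nd nd'}"
proof -
  have "nd' \<in> set_pmf (node_pmf S g \<sigma> nd)" if "feasible_node nd'" "same_stage nd nd'" for nd'
  proof (cases nd)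
    case (Link_Node x)
    with that show ?thesis
      unfolding Link_Node set_node_pmf_Link completely_mixed_history[OF assms]
      by (cases nd') auto
  next
    case (Favor_Node x l m)
    with that show ?thesis
      unfolding Favor_Node set_node_pmf_Favor completely_mixed_history[OF assms]
        completely_mixed_link_stage[OF assms]
      by (cases nd') auto
  qed
  then show ?thesis using node_pmf_feasible by blast
qed

lemma finite_node_pmf: "finite (set_pmf (node_pmf S g \<sigma> nd))"
proof (cases nd)
  case (Link_Node x)
  show ?thesis unfolding Link_Node set_node_pmf_Link by (intro finite_imageI finite_history_pmf)
next
  case (Favor_Node x l m)
  show ?thesis
    unfolding Favor_Node node_pmf.simps set_bind_pmf
    by (intro finite_UN_I finite_history_pmf finite_link_stage finite_match_stage[OF kept_net_subset]) auto
qed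

lemma same_stage_refl [simp]: "same_stage nd nd"
  by (cases nd) auto

text \<open>The uniform profile is completely mixed and reaches every feasible node, which
  eliminates the quantifier over profiles in \<open>nodes\<close>.\<close>

lemma nodes_eq: "nodes S g = {nd. feasible_node nd}"
proof -
  define u :: "link_choice pmf \<times> favor_choice pmf" where
    "u = (pmf_of_set UNIV, pmf_of_set UNIV)"
  have u: "completely_mixed (\<lambda>_ _ _. u)"
    by (auto simp: completely_mixed_def u_def set_pmf_of_set)
  have "nd \<in> set_pmf (node_pmf S g (\<lambda>_ _ _. u) nd)" if "feasible_node nd" for nd
    unfolding completely_mixed_node_pmf[OF u] using that by simp
  then show ?thesis
    using node_pmf_feasible unfolding nodes_def by blast
qed

end

section \<open>Continuation payoffs\<close>

text \<open>A verification argument: \<open>w s\<close> is a candidate bound for the value from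
  period s + 1 on. Iterating \<open>step\<close> bounds every partial sum plus the tail
  \<open>d ^ Suc n * w n\<close>, and the tail vanishes because w is bounded.\<close>

lemma discounted_sum_le:
  fixes r w :: "nat \<Rightarrow> real"
  assumes d: "0 < d" "d < 1" and r: "\<And>s. \<bar>r s\<bar> \<le> K" and w: "\<And>s. \<bar>w s\<bar> \<le> L"
    and step: "\<And>s. r (Suc s) + d * w (Suc s) \<le> w s"
  shows "(\<Sum>s. d ^ s * r s) \<le> r 0 + d * w 0"
proof -
  have summ: "summable (\<lambda>s. d ^ s * r s)"
  proof (rule summable_comparison_test)
    show "\<exists>N. \<forall>n\<ge>N. norm (d ^ n * r n) \<le> K * d ^ n"
      using d r by (auto simp: abs_mult mult.commute intro!: mult_left_mono)
    show "summable (\<lambda>n. K * d ^ n)" using d by (intro summable_mult summable_geometric) auto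
  qed
  have partial: "(\<Sum>s\<le>n. d ^ s * r s) + d ^ Suc n * w n \<le> r 0 + d * w 0" for n
  proof (induction n)
    case (Suc n)
    have "d ^ Suc n * (r (Suc n) + d * w (Suc n)) \<le> d ^ Suc n * w n"
      using d step by (intro mult_left_mono) auto
    then show ?case using Suc by (simp add: algebra_simps)
  qed simp
  have "(\<lambda>n. (\<Sum>s\<le>n. d ^ s * r s) + d ^ Suc n * w n) \<longlonglongrightarrow> (\<Sum>s. d ^ s * r s) + 0"
  proof (intro tendsto_add)
    show "(\<lambda>n. \<Sum>s\<le>n. d ^ s * r s) \<longlonglongrightarrow> (\<Sum>s. d ^ s * r s)"
      using summ by (rule summable_LIMSEQ')
    have "(\<lambda>n. d ^ Suc n) \<longlonglongrightarrow> 0" using d by (intro LIMSEQ_Suc LIMSEQ_realpow_zero) auto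
    moreover have "Bfun w sequentially"
      using w by (intro BfunI[where K=L]) auto
    ultimately show "(\<lambda>n. d ^ Suc n * w n) \<longlonglongrightarrow> 0"
      unfolding tendsto_Zfun_iff by (simp add: bounded_bilinear.Zfun_prod_Bfun[OF bounded_bilinear_mult])
  qed
  then show ?thesis using partial by (intro LIMSEQ_le_const2[where a="r 0 + d * w 0"]) auto
qed

lemma discounted_sum_ge:
  fixes r w :: "nat \<Rightarrow> real"
  assumes "0 < d" "d < 1" "\<And>s. \<bar>r s\<bar> \<le> K" "\<And>s. \<bar>w s\<bar> \<le> L"
    and "\<And>s. r (Suc s) + d * w (Suc s) \<ge> w s"
  shows "(\<Sum>s. d ^ s * r s) \<ge> r 0 + d * w 0"
proof -
  have "(\<Sum>s. d ^ s * (- r s)) \<le> - r 0 + d * (- w 0)"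
  proof (rule discounted_sum_le[where K=K and L=L])
    show "- r (Suc s) + d * - w (Suc s) \<le> - w s" for s using assms(5)[of s] by simp
  qed (use assms in simp_all)
  moreover have "summable (\<lambda>s. d ^ s * r s)"
  proof (rule summable_comparison_test)
    show "\<exists>N. \<forall>n\<ge>N. norm (d ^ n * r n) \<le> K * d ^ n"
      using assms by (auto simp: abs_mult mult.commute intro!: mult_left_mono)
    show "summable (\<lambda>n. K * d ^ n)" using assms by (intro summable_mult summable_geometric) auto
  qed
  ultimately show ?thesis by (simp add: suminf_minus)
qed

context favor_network
begin

lemma period_payoff_bound:
  "\<bar>period_payoff S i o'\<bar> \<le> v + real (card (players S)) * c"
proof -
  obtain l m a where o: "o' = (l, m, a)" by (cases o')
  have 1: "\<bar>case a i of None \<Rightarrow> 0 | Some k \<Rightarrow> requester_payoff (game S) k\<bar> \<le> v"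
    using params by (cases "a i"; cases "the (a i)") auto
  have "\<bar>case a j of None \<Rightarrow> 0 | Some k \<Rightarrow> provider_payoff (game S) k\<bar> \<le> c" for j
    using params by (cases "a j"; cases "the (a j)") auto
  then have "(\<Sum>j | j \<in> players S \<and> m j = Some i.
      \<bar>case a j of None \<Rightarrow> 0 | Some k \<Rightarrow> provider_payoff (game S) k\<bar>)
      \<le> real (card {j. j \<in> players S \<and> m j = Some i}) * c"
    by (intro sum_bounded_above)
  also have "\<dots> \<le> real (card (players S)) * c"
    using params by (intro mult_right_mono of_nat_mono card_mono) auto
  finally have "\<bar>\<Sum>j | j \<in> players S \<and> m j = Some i.
      case a j of None \<Rightarrow> 0 | Some k \<Rightarrow> provider_payoff (game S) k\<bar> \<le> real (card (players S)) * c"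
    by (rule order_trans[OF sum_abs])
  then show ?thesis using 1 unfolding o period_payoff.simps by linarith
qed

lemma play_from_invariant:
  assumes "feasible_node nd" "\<And>y. y \<in> set_pmf (period_end S g \<sigma> nd) \<Longrightarrow> I y"
    and "\<And>x y. feasible x \<Longrightarrow> I x \<Longrightarrow> y \<in> set_pmf (period_end S g \<sigma> (Link_Node x)) \<Longrightarrow> I y"
  shows "finite (set_pmf (play_from S g \<sigma> nd s)) \<and> (\<forall>y\<in>set_pmf (play_from S g \<sigma> nd s). feasible y \<and> I y)"
proof (induction s)
  case 0
  show ?case
    unfolding play_from.simps
    by (intro conjI ballI finite_period_end[OF assms(1)] period_end_feasible[OF assms(1)] assms(2))
next
  case (Suc s)
  have "feasible_node (Link_Node x)" if "x \<in> set_pmf (play_from S g \<sigma> nd s)" for x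
    using Suc that by simp
  note fin = finite_period_end[OF this] period_end_feasible[OF this]
  show ?case
    unfolding play_from.simps set_bind_pmf
  proof (intro conjI ballI)
    show "finite (\<Union>x\<in>set_pmf (play_from S g \<sigma> nd s). set_pmf (period_end S g \<sigma> (Link_Node x)))"
      using Suc by (intro finite_UN_I fin(1)) (rule conjunct1)
    fix y assume "y \<in> (\<Union>x\<in>set_pmf (play_from S g \<sigma> nd s). set_pmf (period_end S g \<sigma> (Link_Node x)))"
    then obtain x where x: "x \<in> set_pmf (play_from S g \<sigma> nd s)"
      "y \<in> set_pmf (period_end S g \<sigma> (Link_Node x))" by (elim UN_E)
    show "feasible y" by (rule fin(2)[OF x])
    show "I y" using assms(3)[OF _ _ x(2)] Suc x(1) by blast
  qed
qed

text \<open>The invariant \<open>I\<close> restricts the Bellman inequality for \<open>w\<close> to the histories that can occur.\<close>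

lemma continuation_payoff_le_or_ge:
  fixes i :: player and w :: "history \<Rightarrow> real"
  assumes nd: "feasible_node nd" "\<And>y. y \<in> set_pmf (period_end S g \<sigma> nd) \<Longrightarrow> I y"
    and I: "\<And>x y. feasible x \<Longrightarrow> I x \<Longrightarrow> y \<in> set_pmf (period_end S g \<sigma> (Link_Node x)) \<Longrightarrow> I y"
    and w: "\<And>x. feasible x \<Longrightarrow> I x \<Longrightarrow> \<bar>w x\<bar> \<le> L"
  defines "h \<equiv> \<lambda>y. period_payoff S i (last y) + \<delta> * w y"
  shows "(\<forall>x. feasible x \<longrightarrow> I x \<longrightarrow> expect (period_end S g \<sigma> (Link_Node x)) h \<le> w x) \<Longrightarrow>
      continuation_payoff S g \<sigma> i nd \<le> expect (period_end S g \<sigma> nd) h" (is "?A \<Longrightarrow> ?P")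
    and "(\<forall>x. feasible x \<longrightarrow> I x \<longrightarrow> expect (period_end S g \<sigma> (Link_Node x)) h \<ge> w x) \<Longrightarrow>
      continuation_payoff S g \<sigma> i nd \<ge> expect (period_end S g \<sigma> nd) h" (is "?B \<Longrightarrow> ?Q")
proof -
  define r where "r = (\<lambda>s. expect (play_from S g \<sigma> nd s) (\<lambda>y. period_payoff S i (last y)))"
  define u where "u = (\<lambda>s. expect (play_from S g \<sigma> nd s) w)"
  have inv: "finite (set_pmf (play_from S g \<sigma> nd s)) \<and>
      (\<forall>y\<in>set_pmf (play_from S g \<sigma> nd s). feasible y \<and> I y)" for s
    by (rule play_from_invariant) (fact nd(1), fact nd(2), fact I)
  then have fin: "finite (set_pmf (play_from S g \<sigma> nd s))"
    and invD: "y \<in> set_pmf (play_from S g \<sigma> nd s) \<Longrightarrow> feasible y \<and> I y" for s y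
    by blast+
  have r: "\<bar>r s\<bar> \<le> v + real (card (players S)) * c" for s
    unfolding r_def by (rule expect_abs_le[OF fin]) (rule period_payoff_bound)
  have u: "\<bar>u s\<bar> \<le> L" for s
    unfolding u_def
  proof (rule expect_abs_le[OF fin])
    fix x assume "x \<in> set_pmf (play_from S g \<sigma> nd s)"
    then have "feasible x" "I x" by (simp_all add: invD)
    then show "\<bar>w x\<bar> \<le> L" by (rule w)
  qed
  have h: "expect (play_from S g \<sigma> nd s) h = r s + \<delta> * u s" for s
    unfolding h_def r_def u_def expect_add[OF fin] by (simp del: play_from.simps)
  have h0: "expect (period_end S g \<sigma> nd) h = r 0 + \<delta> * u 0"
    using h[of 0] unfolding play_from.simps .
  have hSuc: "r (Suc s) + \<delta> * u (Suc s) =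
      expect (play_from S g \<sigma> nd s) (\<lambda>x. expect (period_end S g \<sigma> (Link_Node x)) h)" for s
  proof -
    have "finite (set_pmf (period_end S g \<sigma> (Link_Node x)))" if "x \<in> set_pmf (play_from S g \<sigma> nd s)" for x
      by (rule finite_period_end) (simp add: invD[OF that])
    then show ?thesis
      unfolding h[symmetric] play_from.simps by (rule expect_bind[OF fin])
  qed
  have cont: "continuation_payoff S g \<sigma> i nd = (\<Sum>s. \<delta> ^ s * r s)"
    by (simp add: continuation_payoff_def r_def)
  show ?P if ?A
    unfolding cont h0
  proof (rule discounted_sum_le[OF params(3,4) r u])
    show "r (Suc s) + \<delta> * u (Suc s) \<le> u s" for s
      unfolding hSuc unfolding u_def
      by (rule expect_mono[OF fin], rule that[rule_format]) (simp_all add: invD)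
  qed
  show ?Q if ?B
    unfolding cont h0
  proof (rule discounted_sum_ge[OF params(3,4) r u])
    show "r (Suc s) + \<delta> * u (Suc s) \<ge> u s" for s
      unfolding hSuc unfolding u_def
      by (rule expect_mono[OF fin], rule that[rule_format]) (simp_all add: invD)
  qed
qed

end

section \<open>Networks with a large degree\<close>

text \<open>The conjunct \<open>0 < d\<close> excludes the case in which \<open>d - 1\<close> and
  the division in \<open>selection_prob\<close> take their default values.\<close>

definition sustainable :: "real \<Rightarrow> real \<Rightarrow> favor_game \<Rightarrow> real \<Rightarrow> nat \<Rightarrow> bool" where
  "sustainable \<alpha> p G \<delta> d \<longleftrightarrow> 0 < d \<and>
     cost G - refusal G \<le>
       \<delta> / (1 - \<delta>) * (\<alpha> * (benefit G * (p * (1 - p) ^ (d - 1)) - cost G * selection_prob p d))"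

definition all_coop :: "matching \<Rightarrow> favors" where
  "all_coop m = (\<lambda>k. if m k = None then None else Some Coop)"

text \<open>
  Every feasible matching is also feasible in the full network, so the cooperative version of a
  feasible history is on the path of play of a stable equilibrium.
\<close>

definition cooperative :: "history \<Rightarrow> history" where
  "cooperative = map (\<lambda>(l, m, a). (\<lambda>_. Keep, m, all_coop m))"

lemma cooperative_snoc [simp]:
  "cooperative (x @ [(l, m, a)]) = cooperative x @ [(\<lambda>_. Keep, m, all_coop m)]"
  by (simp add: cooperative_def)

lemma length_cooperative [simp]: "length (cooperative x) = length x"
  by (simp add: cooperative_def)

lemma kept_Keep [simp]: "kept G (\<lambda>_. Keep) = G"
  by (simp add: kept_def)

context favor_network
begin

lemma link_cases:
  assumes "e \<in> g"
  obtains k k' where "e = {k, k'}" "k \<noteq> k'"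
proof -
  have "e \<in> {{i, j} |i j. i \<in> players S \<and> j \<in> players S \<and> i \<noteq> j}"
    using assms on unfolding network_on_def by (rule subsetD[rotated])
  then show ?thesis using that by (elim CollectE exE conjE) simp
qed

lemma nbrs_remove_self: "nbrs (G - {{i, j}}) i = nbrs G i - {j}"
  by (auto simp: nbrs_def doubleton_eq_iff)

lemma nbrs_remove_other: "k \<noteq> i \<Longrightarrow> k \<noteq> j \<Longrightarrow> nbrs (G - {{i, j}}) k = nbrs G k"
  by (auto simp: nbrs_def doubleton_eq_iff)

text \<open>Only i and j lose a link. The remaining neighbours of i keep their degrees, so on the
  cost side exactly the share of j disappears, and on the benefit side two consecutive powers of 1 -
  p differ.\<close>

lemma flow_remove:
  assumes "{i, j} \<in> g"
  shows "flow g i - flow (g - {{i, j}}) i =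
    \<alpha> * (v * (p * (1 - p) ^ (deg g i - 1)) - c * selection_prob p (deg g j))"
proof -
  let ?G = "g - {{i, j}}"
  have j: "j \<in> nbrs g i" and fin: "finite (nbrs g i)"
    using assms finite_nbrs[OF subset_refl] by (simp_all add: nbrs_def)
  have ij: "i \<noteq> j" by (rule link_players(3)[OF assms])
  have pos: "0 < deg g i" using j fin by (auto simp: deg_def card_gt_0_iff)
  have "deg ?G i = deg g i - 1"
    using j fin by (simp add: deg_def nbrs_remove_self)
  then obtain d where d: "deg g i = Suc d" "deg ?G i = d" using pos by (cases "deg g i") auto
  have "(\<Sum>k\<in>nbrs ?G i. selection_prob p (deg ?G k)) =
      (\<Sum>k\<in>nbrs g i - {j}. selection_prob p (deg g k))"
    unfolding nbrs_remove_self
  proof (rule sum.cong[OF refl])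
    fix k assume k: "k \<in> nbrs g i - {j}"
    then have "i \<noteq> k" using link_players(3)[of i k] by (simp add: nbrs_def)
    then show "selection_prob p (deg ?G k) = selection_prob p (deg g k)"
      using k by (simp add: deg_def nbrs_remove_other)
  qed
  also have "\<dots> = (\<Sum>k\<in>nbrs g i. selection_prob p (deg g k)) - selection_prob p (deg g j)"
    using j fin by (simp add: sum_diff1)
  finally have sum: "(\<Sum>k\<in>nbrs ?G i. selection_prob p (deg ?G k)) =
      (\<Sum>k\<in>nbrs g i. selection_prob p (deg g k)) - selection_prob p (deg g j)" .
  show ?thesis unfolding flow_def sum d by (simp add: algebra_simps)
qed

lemma period_payoff_coop:
  assumes "\<And>k k'. m k = Some k' \<Longrightarrow> k = i \<or> k' = i \<Longrightarrow> a k = Some Coop" "feasible_favors m a"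
  shows "period_payoff S i (l, m, a) = coop_payoff i m"
proof -
  have "(case a i of None \<Rightarrow> 0 | Some k \<Rightarrow> requester_payoff (game S) k) = (if m i = None then 0 else v)"
    using assms(1)[of i] assms(2)[unfolded feasible_favors_def, rule_format, of i]
    by (cases "m i") simp_all
  moreover have "(\<Sum>j | j \<in> players S \<and> m j = Some i.
        case a j of None \<Rightarrow> 0 | Some k \<Rightarrow> provider_payoff (game S) k) =
      (\<Sum>j | j \<in> players S \<and> m j = Some i. - c)"
    using assms(1)[of _ i] by (intro sum.cong) auto
  ultimately show ?thesis by (simp add: coop_payoff_def)
qed

definition perpetuity :: "network \<Rightarrow> player \<Rightarrow> real" where
  "perpetuity G i = flow G i / (1 - \<delta>)"

lemma perpetuity_eq: "flow G i + \<delta> * perpetuity G i = perpetuity G i"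
  using params by (simp add: perpetuity_def field_simps)

text \<open>The perpetuity is a fixed point of the one-period operator whenever the links kept are
  exactly those of \<open>G\<close> and all favors involving i are provided; favors among others do
  not enter her payoff. It serves both for \<open>g\<close> on the path and for \<open>g\<close>
  without one link after the deviation.\<close>

lemma period_value:
  assumes "i \<in> players S" "G \<subseteq> g"
    and links: "\<And>l. l \<in> set_pmf (link_stage g \<sigma> x) \<Longrightarrow> kept (net g x) l = G"
    and favors: "\<And>m a k k'. m \<in> set_pmf (match_stage S G) \<Longrightarrow> a \<in> set_pmf (favor_stage g \<sigma> x m) \<Longrightarrow>
      m k = Some k' \<Longrightarrow> k = i \<or> k' = i \<Longrightarrow> a k = Some Coop"
  shows "expect (period_end S g \<sigma> (Link_Node x)) (\<lambda>y. period_payoff S i (last y) + \<delta> * perpetuity G i) = perpetuity G i"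
  unfolding expect_period_end_Link last_snoc
proof (rule expect_const)
  fix l assume l: "l \<in> set_pmf (link_stage g \<sigma> x)"
  have "expect (favor_stage g \<sigma> x m) (\<lambda>a. period_payoff S i (l, m, a) + \<delta> * perpetuity G i) =
      coop_payoff i m + \<delta> * perpetuity G i"
    if m: "m \<in> set_pmf (match_stage S G)" for m
  proof (rule expect_const)
    fix a assume a: "a \<in> set_pmf (favor_stage g \<sigma> x m)"
    have "period_payoff S i (l, m, a) = coop_payoff i m"
      by (rule period_payoff_coop[OF favors[OF m a] favor_stage_feasible[OF finite_requesters[OF m] a]])
    then show "period_payoff S i (l, m, a) + \<delta> * perpetuity G i = coop_payoff i m + \<delta> * perpetuity G i" by simp
  qed
  then have "expect (match_stage S (kept (net g x) l))
      (\<lambda>m. expect (favor_stage g \<sigma> x m) (\<lambda>a. period_payoff S i (l, m, a) + \<delta> * perpetuity G i)) =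
      expect (match_stage S G) (\<lambda>m. coop_payoff i m + \<delta> * perpetuity G i)"
    unfolding links[OF l] by (rule expect_cong)
  also have "\<dots> = flow G i + \<delta> * perpetuity G i"
    using expect_coop_payoff[OF assms(2,1)] by (simp add: expect_add[OF finite_match_stage[OF assms(2)]])
  finally show "expect (match_stage S (kept (net g x) l))
      (\<lambda>m. expect (favor_stage g \<sigma> x m) (\<lambda>a. period_payoff S i (l, m, a) + \<delta> * perpetuity G i)) = perpetuity G i"
    unfolding perpetuity_eq .
qed

text \<open>At given link choices the matching is a move of chance, so only the first factor varies
  along a sequence of trembles.\<close>

lemma pmf_node_pmf_Favor_Nil:
  "pmf (node_pmf S g \<sigma> (Favor_Node [] l0 m0)) (Favor_Node [] l m) =
    pmf (link_stage g \<sigma> []) l * pmf (match_stage S (kept g l)) m"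
proof -
  have "node_pmf S g \<sigma> (Favor_Node [] l0 m0) =
      bind_pmf (link_stage g \<sigma> []) (\<lambda>l'. map_pmf (Favor_Node [] l') (match_stage S (kept g l')))"
    by (simp add: bind_return_pmf map_pmf_def)
  also have "pmf \<dots> (Favor_Node [] l m) =
      pmf (link_stage g \<sigma> []) l * pmf (map_pmf (Favor_Node [] l) (match_stage S (kept g l))) (Favor_Node [] l m)"
    by (rule pmf_bind_unique) auto
  also have "pmf (map_pmf (Favor_Node [] l) (match_stage S (kept g l))) (Favor_Node [] l m) =
      pmf (match_stage S (kept g l)) m"
    by (rule pmf_map_inj') (simp add: inj_def)
  finally show ?thesis .
qed

lemma tendsto_link_stage:
  assumes "\<And>i h j k. (\<lambda>n. pmf (fst (\<tau> n i h j)) k) \<longlonglongrightarrow> pmf (fst (\<sigma> i h j)) k"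
  shows "(\<lambda>n. pmf (link_stage g (\<tau> n) x) l) \<longlonglongrightarrow> pmf (link_stage g \<sigma> x) l"
  unfolding link_stage_def pmf_Pi[OF finite_links[OF net_subset]]
  by (cases "\<forall>e. e \<notin> {(i, j). {i, j} \<in> net g x} \<longrightarrow> l e = Keep")
     (simp_all only: if_True if_False, auto intro!: tendsto_prod assms)

end

section \<open>Play on the path of a stable equilibrium and after refusing one neighbour\<close>

locale stable_equilibrium = favor_network +
  fixes \<sigma> :: profile
  assumes stable: "stable_bilateral_equilibrium S g \<sigma>"
begin

abbreviation on_path :: "history \<Rightarrow> bool" where
  "on_path x \<equiv> x \<in> set_pmf (history_pmf S g \<sigma> (length x))"

lemma on_path_net: "on_path x \<Longrightarrow> net g x = g"
  using stable unfolding stable_bilateral_equilibrium_def by blast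

lemma on_path_favor: "on_path x \<Longrightarrow> (l, m, a) \<in> set x \<Longrightarrow> m i \<noteq> None \<Longrightarrow> a i = Some Coop"
  using stable unfolding stable_bilateral_equilibrium_def by fast

lemma on_path_snoc:
  assumes "on_path x" "l \<in> set_pmf (link_stage g \<sigma> x)"
    "m \<in> set_pmf (match_stage S (kept (net g x) l))" "a \<in> set_pmf (favor_stage g \<sigma> x m)"
  shows "on_path (x @ [(l, m, a)])"
proof -
  have "x @ [(l, m, a)] \<in> set_pmf (period_end S g \<sigma> (Link_Node x))"
    unfolding set_period_end_Link using assms(2-4) by blast
  then show ?thesis
    unfolding length_append_singleton history_pmf.simps set_bind_pmf
    by (rule UN_I[of x _ "x @ [(l, m, a)]" "\<lambda>y. set_pmf (period_end S g \<sigma> (Link_Node y))", OF assms(1)])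
qed

text \<open>A removal chosen with positive probability would extend to a history on the path whose
  network is smaller than \<open>g\<close>. Where there is no link, \<open>Keep\<close> is the dummy
  value.\<close>

lemma on_path_link_stage:
  assumes "on_path x"
  shows "set_pmf (link_stage g \<sigma> x) = {\<lambda>_. Keep}"
proof -
  have "l = (\<lambda>_. Keep)" if l: "l \<in> set_pmf (link_stage g \<sigma> x)" for l
  proof -
    obtain m where m: "m \<in> set_pmf (match_stage S (kept (net g x) l))"
      using set_pmf_not_empty by fast
    obtain a where a: "a \<in> set_pmf (favor_stage g \<sigma> x m)"
      using set_pmf_not_empty by fast
    have "kept g l = g"
      using on_path_net[OF on_path_snoc[OF assms l m a]] on_path_net[OF assms] by simp
    moreover have "feasible_links g l"
      using link_stage_feasible[OF l] on_path_net[OF assms] by simp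
    ultimately have "l (i, j) = Keep" for i j
      using mem_kept[of i j g l] unfolding feasible_links_def by (cases "{i, j} \<in> g") auto
    then show ?thesis by (auto simp: fun_eq_iff)
  qed
  then show ?thesis using set_pmf_not_empty[of "link_stage g \<sigma> x"] by blast
qed

lemma on_path_favor_stage:
  assumes "on_path x" "m \<in> set_pmf (match_stage S g)"
  shows "set_pmf (favor_stage g \<sigma> x m) = {all_coop m}"
proof -
  have "a = all_coop m" if a: "a \<in> set_pmf (favor_stage g \<sigma> x m)" for a
  proof
    fix i
    have "on_path (x @ [(\<lambda>_. Keep, m, a)])"
      by (rule on_path_snoc[OF assms(1) _ _ a])
         (simp_all add: on_path_link_stage[OF assms(1)] on_path_net[OF assms(1)] assms(2))
    from on_path_favor[OF this, of "\<lambda>_. Keep" m a i]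
    have "m i \<noteq> None \<Longrightarrow> a i = Some Coop" by simp
    moreover have "feasible_favors m a"
      by (rule favor_stage_feasible[OF finite_requesters[OF assms(2)] a])
    ultimately show "a i = all_coop m i"
      by (auto simp: all_coop_def feasible_favors_def)
  qed
  then show ?thesis using set_pmf_not_empty[of "favor_stage g \<sigma> x m"] by blast
qed

text \<open>The stage laws are products, so changing one coordinate within the support of its factor
  stays in the support of the product, which is a singleton. For the action of k toward k', a
  matching with this single request isolates the coordinate.\<close>

lemma on_path_choices:
  assumes "on_path x" "{k, k'} \<in> g"
  shows "set_pmf (fst (\<sigma> k (private_history g k x) k')) = {Keep}"
    and "set_pmf (snd (\<sigma> k (private_history g k x) k')) = {Coop}"
proof -
  have "u = Keep" if u: "u \<in> set_pmf (fst (\<sigma> k (private_history g k x) k'))" for u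
  proof -
    have "(\<lambda>_. Keep) \<in> set_pmf (link_stage g \<sigma> x)" using on_path_link_stage[OF assms(1)] by simp
    then have "((\<lambda>_. Keep)((k, k') := u)) \<in> set_pmf (link_stage g \<sigma> x)"
      using u assms(2) on_path_net[OF assms(1)] unfolding link_stage_Pi by simp
    then have "(\<lambda>_. Keep)((k, k') := u) = (\<lambda>_. Keep)" using on_path_link_stage[OF assms(1)] by simp
    from fun_cong[OF this, of "(k, k')"] show ?thesis by simp
  qed
  then show "set_pmf (fst (\<sigma> k (private_history g k x) k')) = {Keep}"
    using set_pmf_not_empty[of "fst (\<sigma> k (private_history g k x) k')"] by blast
  have "u = Coop" if u: "u \<in> set_pmf (snd (\<sigma> k (private_history g k x) k'))" for u
  proof -
    let ?m = "(\<lambda>_. None)(k' := Some k)"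
    have m: "?m \<in> set_pmf (match_stage S g)"
      using assms(2) by (intro single_request_match) (simp_all add: insert_commute)
    have "((\<lambda>_. None)(k' := Some u)) \<in> set_pmf (favor_stage g \<sigma> x ?m)"
      unfolding favor_stage_Pi[OF finite_requesters[OF m]] using u by (auto split: option.splits)
    then have "(\<lambda>_. None)(k' := Some u) = all_coop ?m" using on_path_favor_stage[OF assms(1) m] by simp
    from fun_cong[OF this, of k'] show ?thesis by (simp add: all_coop_def)
  qed
  then show "set_pmf (snd (\<sigma> k (private_history g k x) k')) = {Coop}"
    using set_pmf_not_empty[of "snd (\<sigma> k (private_history g k x) k')"] by blast
qed

lemma on_path_cooperative:
  assumes "feasible x"
  shows "on_path (cooperative x)"
  using assms
proof (induction rule: feasible.induct)
  case Nil
  then show ?case by (simp add: cooperative_def)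
next
  case (snoc x l m a)
  have m: "m \<in> set_pmf (match_stage S g)"
    using snoc.hyps(3) match_stage_mono[OF kept_net_subset subset_refl] by (rule subsetD[rotated])
  show ?case
    unfolding cooperative_snoc
    by (rule on_path_snoc)
       (use snoc.IH m in \<open>simp_all add: on_path_link_stage on_path_net on_path_favor_stage del: length_cooperative\<close>)
qed

text \<open>This is where bilateral measurability of the equilibrium enters: toward k', player k
  acts as she would after the cooperative version of the history, which is on the path.\<close>

lemma cooperative_choices:
  assumes "feasible x" "{k, k'} \<in> g" "bilateral_history k k' x = bilateral_history k k' (cooperative x)"
  shows "set_pmf (fst (\<sigma> k (private_history g k x) k')) = {Keep}"
    and "set_pmf (snd (\<sigma> k (private_history g k x) k')) = {Coop}"
proof -
  note path = on_path_cooperative[OF assms(1)]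
  have nodes: "Link_Node x \<in> nodes S g" "Link_Node (cooperative x) \<in> nodes S g"
    using assms(1) history_feasible[OF path] by (simp_all add: nodes_eq)
  have "bilaterally_measurable S g \<sigma>"
    using stable unfolding stable_bilateral_equilibrium_def bilateral_equilibrium_def by blast
  then have "\<sigma> k (private_history g k x) k' = \<sigma> k (private_history g k (cooperative x)) k'"
    using link_players[OF assms(2)] nodes assms(3) unfolding bilaterally_measurable_def by blast
  then show "set_pmf (fst (\<sigma> k (private_history g k x) k')) = {Keep}"
    and "set_pmf (snd (\<sigma> k (private_history g k x) k')) = {Coop}"
    using on_path_choices[OF path assms(2)] by simp_all
qed

text \<open>Started at a favor node, this refuses j in the current period and cuts the link at the
  beginning of the next one.\<close>

definition deviation :: "player \<Rightarrow> strategy" where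
  "deviation j = (\<lambda>h k. if k = j then (return_pmf Remove, return_pmf Defect) else (return_pmf Keep, return_pmf Coop))"

text \<open>The invariant of play after the deviation. It leaves open whether the link between i and
  j is still present, since it is cut only one period after the refusal.\<close>

definition after_deviation :: "player \<Rightarrow> player \<Rightarrow> history \<Rightarrow> bool" where
  "after_deviation i j x \<longleftrightarrow> g - {{i, j}} \<subseteq> net g x \<and>
     (\<forall>(l, m, a)\<in>set x. \<forall>k k'. m k = Some k' \<longrightarrow> {k, k'} \<noteq> {i, j} \<longrightarrow> a k = Some Coop)"

lemma after_deviation_bilateral_history:
  assumes "after_deviation i j x" "{k, k'} \<noteq> {i, j}"
  shows "bilateral_history k k' x = bilateral_history k k' (cooperative x)"
  unfolding bilateral_history_def cooperative_def map_map
proof (rule map_cong[OF refl])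
  fix z assume "z \<in> set x"
  moreover obtain l m a where z: "z = (l, m, a)" by (cases z)
  ultimately have *: "\<forall>k k'. m k = Some k' \<longrightarrow> {k, k'} \<noteq> {i, j} \<longrightarrow> a k = Some Coop"
    using assms(1) unfolding after_deviation_def by fast
  have "m k = Some k' \<Longrightarrow> a k = Some Coop" "m k' = Some k \<Longrightarrow> a k' = Some Coop"
    using *[rule_format, of k k'] *[rule_format, of k' k] assms(2) by (simp_all add: insert_commute)
  then show "(case z of (l, m, a) \<Rightarrow> (if m k = Some k' then a k else None, if m k' = Some k then a k' else None)) =
      ((\<lambda>(l, m, a). (if m k = Some k' then a k else None, if m k' = Some k then a k' else None)) \<circ>
       (\<lambda>(l, m, a). (\<lambda>_. Keep, m, all_coop m))) z"
    by (simp add: z all_coop_def)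
qed

lemma after_deviation_choices:
  assumes "feasible x" "after_deviation i j x" "{k, k'} \<in> g" "{k, k'} \<noteq> {i, j}"
  shows "set_pmf (fst ((\<sigma>(i := deviation j)) k (private_history g k x) k')) = {Keep}"
    and "set_pmf (snd ((\<sigma>(i := deviation j)) k (private_history g k x) k')) = {Coop}"
  using cooperative_choices[OF assms(1,3) after_deviation_bilateral_history[OF assms(2,4)]] assms(4)
  by (auto simp: deviation_def)

lemma deviation_links:
  assumes x: "feasible x" "after_deviation i j x"
    and l: "l \<in> set_pmf (link_stage g (\<sigma>(i := deviation j)) x)"
  shows "kept (net g x) l = g - {{i, j}}"
proof (intro equalityI subsetI)
  fix e assume e: "e \<in> kept (net g x) l"
  then have eg: "e \<in> g" using kept_net_subset by (rule subsetD[rotated])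
  have "{i, j} \<notin> kept (net g x) l"
  proof
    assume "{i, j} \<in> kept (net g x) l"
    then have "{i, j} \<in> net g x" "l (i, j) = Keep" by (simp_all add: mem_kept)
    moreover have "if {i, j} \<in> net g x then l (i, j) \<in> set_pmf (fst ((\<sigma>(i := deviation j)) i (private_history g i x) j))
        else l (i, j) = Keep"
      using l unfolding link_stage_Pi by blast
    ultimately show False by (simp add: deviation_def)
  qed
  with e eg show "e \<in> g - {{i, j}}" by auto
next
  fix e assume e: "e \<in> g - {{i, j}}"
  then obtain k k' where k: "e = {k, k'}" using link_cases by blast
  have net: "{k, k'} \<in> net g x" using e k x(2) unfolding after_deviation_def by blast
  have Keep: "l (a, b) = Keep" if ab: "{a, b} = {k, k'}" for a b
  proof -
    have "if {a, b} \<in> net g x then l (a, b) \<in> set_pmf (fst ((\<sigma>(i := deviation j)) a (private_history g a x) b))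
        else l (a, b) = Keep"
      using l unfolding link_stage_Pi by blast
    moreover have "set_pmf (fst ((\<sigma>(i := deviation j)) a (private_history g a x) b)) = {Keep}"
      using e k ab by (intro after_deviation_choices(1)[OF x]) simp_all
    ultimately show ?thesis by (simp split: if_splits)
  qed
  show "e \<in> kept (net g x) l"
    unfolding k mem_kept using net Keep[of k k'] Keep[of k' k] by (simp add: insert_commute)
qed

lemma deviation_favors:
  assumes x: "feasible x" "after_deviation i j x"
    and m: "m \<in> set_pmf (match_stage S g)" and a: "a \<in> set_pmf (favor_stage g (\<sigma>(i := deviation j)) x m)"
    and k: "m k = Some k'" "{k, k'} \<noteq> {i, j}"
  shows "a k = Some Coop"
proof -
  have "case m k of None \<Rightarrow> a k = None
        | Some j' \<Rightarrow> a k \<in> Some ` set_pmf (snd ((\<sigma>(i := deviation j)) j' (private_history g j' x) k))"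
    using a unfolding favor_stage_Pi[OF finite_requesters[OF m]] by blast
  moreover have "set_pmf (snd ((\<sigma>(i := deviation j)) k' (private_history g k' x) k)) = {Coop}"
    using match_stage_link[OF m subset_refl k(1)] k(2)
    by (intro after_deviation_choices(2)[OF x]) (simp_all add: insert_commute)
  ultimately show ?thesis using k(1) by simp
qed

lemma deviation_step:
  assumes x: "feasible x" "after_deviation i j x"
    and y: "y \<in> set_pmf (period_end S g (\<sigma>(i := deviation j)) (Link_Node x))"
  shows "after_deviation i j y"
proof -
  obtain l m a where y': "y = x @ [(l, m, a)]" and l: "l \<in> set_pmf (link_stage g (\<sigma>(i := deviation j)) x)"
    and m: "m \<in> set_pmf (match_stage S (kept (net g x) l))"
    and a: "a \<in> set_pmf (favor_stage g (\<sigma>(i := deviation j)) x m)"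
    using y unfolding set_period_end_Link by blast
  have m': "m \<in> set_pmf (match_stage S g)"
    using m match_stage_mono[OF kept_net_subset subset_refl] by (rule subsetD[rotated])
  show ?thesis
    using deviation_favors[OF x m' a] x(2) deviation_links[OF x l]
    unfolding after_deviation_def y' by auto
qed

lemma deviation_value:
  assumes "feasible x" "after_deviation i j x" "{i, j} \<in> g"
  shows "expect (period_end S g (\<sigma>(i := deviation j)) (Link_Node x))
      (\<lambda>y. period_payoff S i (last y) + \<delta> * perpetuity (g - {{i, j}}) i) = perpetuity (g - {{i, j}}) i"
proof (rule period_value)
  fix m a k k'
  assume m: "m \<in> set_pmf (match_stage S (g - {{i, j}}))"
    and a: "a \<in> set_pmf (favor_stage g (\<sigma>(i := deviation j)) x m)" and k: "m k = Some k'"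
  have "{k, k'} \<in> g - {{i, j}}" by (rule match_stage_link[OF m _ k]) simp
  then have "{k, k'} \<noteq> {i, j}" by blast
  moreover have "m \<in> set_pmf (match_stage S g)"
    using m match_stage_mono[of "g - {{i, j}}" g] by blast
  ultimately show "a k = Some Coop" by (intro deviation_favors[OF assms(1,2) _ a k])
qed (use assms deviation_links link_players(1) in simp_all)

lemma on_path_value:
  assumes "on_path x" "i \<in> players S"
  shows "expect (period_end S g \<sigma> (Link_Node x))
      (\<lambda>y. period_payoff S i (last y) + \<delta> * perpetuity g i) = perpetuity g i"
proof (rule period_value)
  fix m a k k'
  assume "m \<in> set_pmf (match_stage S g)" "a \<in> set_pmf (favor_stage g \<sigma> x m)" "m k = Some k'"
  then show "a k = Some Coop" using on_path_favor_stage[OF assms(1)] by (simp add: all_coop_def)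
qed (use assms on_path_link_stage on_path_net in simp_all)

lemma on_path_period_end:
  assumes "on_path x" "y \<in> set_pmf (period_end S g \<sigma> (Link_Node x))"
  shows "on_path y"
  using assms(2) on_path_snoc[OF assms(1)] unfolding set_period_end_Link by blast

section \<open>Cooperating against refusing and cutting, when j is the only one to ask i\<close>

context
  fixes i j :: player and m :: matching
  assumes ij: "{i, j} \<in> g" and m: "m \<in> set_pmf (match_stage S g)"
    and mi: "m i = None" and asks: "{k. m k = Some i} = {j}"
begin

lemma selected_by: "m j = Some i"
  using asks by blast

lemma payoff_Nil:
  assumes "a j = Some u" "a i = None"
  shows "period_payoff S i (l, m, a) = provider_payoff (game S) u"
proof -
  have "{k. k \<in> players S \<and> m k = Some i} = {j}"
    using asks link_players(2)[OF ij] by blast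
  then show ?thesis using assms by simp
qed

lemma cooperate_payoff:
  "continuation_payoff S g \<sigma> i (Favor_Node [] (\<lambda>_. Keep) m) \<le> - c + \<delta> * perpetuity g i"
proof -
  have Nil: "on_path []" by simp
  have fav: "set_pmf (favor_stage g \<sigma> [] m) = {all_coop m}" by (rule on_path_favor_stage[OF Nil m])
  let ?nd = "Favor_Node [] (\<lambda>_. Keep) m" and ?h = "\<lambda>y. period_payoff S i (last y) + \<delta> * perpetuity g i"
  have path: "on_path y" if "y \<in> set_pmf (period_end S g \<sigma> ?nd)" for y
  proof -
    have "y = [] @ [(\<lambda>_. Keep, m, all_coop m)]"
      using that unfolding set_period_end_Favor fav by simp
    moreover have "on_path ([] @ [(\<lambda>_. Keep, m, all_coop m)])"
      by (rule on_path_snoc[OF Nil]) (use on_path_link_stage[OF Nil] fav m in simp_all)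
    ultimately show ?thesis by simp
  qed
  have "continuation_payoff S g \<sigma> i ?nd \<le> expect (period_end S g \<sigma> ?nd) ?h"
  proof (rule continuation_payoff_le_or_ge(1)[where I=on_path and L="\<bar>perpetuity g i\<bar>"])
    show "feasible_node ?nd" using m by (simp add: feasible.Nil feasible_links_def)
    show "\<forall>x. feasible x \<longrightarrow> on_path x \<longrightarrow> expect (period_end S g \<sigma> (Link_Node x)) ?h \<le> perpetuity g i"
      by (intro allI impI eq_refl on_path_value link_players(1)[OF ij])
    show "on_path y" if "on_path x" "y \<in> set_pmf (period_end S g \<sigma> (Link_Node x))" for x y
      using that by (rule on_path_period_end)
  qed (fact path, rule order_refl)
  also have "\<dots> = expect (favor_stage g \<sigma> [] m) (\<lambda>a. period_payoff S i (\<lambda>_. Keep, m, a) + \<delta> * perpetuity g i)"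
    unfolding expect_period_end_Favor last_snoc ..
  also have "\<dots> = - c + \<delta> * perpetuity g i"
  proof (rule expect_const)
    fix a assume "a \<in> set_pmf (favor_stage g \<sigma> [] m)"
    then have "a j = Some Coop" "a i = None" using selected_by mi by (simp_all add: fav all_coop_def)
    then show "period_payoff S i (\<lambda>_. Keep, m, a) + \<delta> * perpetuity g i = - c + \<delta> * perpetuity g i"
      using payoff_Nil[of a Coop "\<lambda>_. Keep"] by simp
  qed
  finally show ?thesis .
qed

lemma deviate_payoff:
  "continuation_payoff S g (\<sigma>(i := deviation j)) i (Favor_Node [] (\<lambda>_. Keep) m)
    \<ge> - \<gamma> + \<delta> * perpetuity (g - {{i, j}}) i"
proof -
  let ?\<sigma> = "\<sigma>(i := deviation j)" and ?G = "g - {{i, j}}"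
  let ?nd = "Favor_Node [] (\<lambda>_. Keep) m" and ?h = "\<lambda>y. period_payoff S i (last y) + \<delta> * perpetuity ?G i"
  have Nil: "feasible []" "after_deviation i j []" by (auto simp: feasible.Nil after_deviation_def)
  have inv: "after_deviation i j y" if y_in: "y \<in> set_pmf (period_end S g ?\<sigma> ?nd)" for y
  proof -
    obtain a where y: "y = [] @ [(\<lambda>_. Keep, m, a)]" and a: "a \<in> set_pmf (favor_stage g ?\<sigma> [] m)"
      using y_in unfolding set_period_end_Favor by blast
    show ?thesis
      using deviation_favors[OF Nil m a] unfolding y after_deviation_def net_snoc net_Nil kept_Keep by auto
  qed
  have "continuation_payoff S g ?\<sigma> i ?nd \<ge> expect (period_end S g ?\<sigma> ?nd) ?h"
  proof (rule continuation_payoff_le_or_ge(2)[where I="after_deviation i j" and L="\<bar>perpetuity ?G i\<bar>"])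
    show "feasible_node ?nd" using m by (simp add: feasible.Nil feasible_links_def)
    show "\<forall>x. feasible x \<longrightarrow> after_deviation i j x \<longrightarrow>
        expect (period_end S g ?\<sigma> (Link_Node x)) ?h \<ge> perpetuity ?G i"
      by (intro allI impI eq_refl[OF sym] deviation_value ij)
  qed (fact inv, fact deviation_step, rule order_refl)
  moreover have "expect (period_end S g ?\<sigma> ?nd) ?h =
      expect (favor_stage g ?\<sigma> [] m) (\<lambda>a. period_payoff S i (\<lambda>_. Keep, m, a) + \<delta> * perpetuity ?G i)"
    unfolding expect_period_end_Favor last_snoc ..
  moreover have "\<dots> = - \<gamma> + \<delta> * perpetuity ?G i"
  proof (rule expect_const)
    fix a assume a: "a \<in> set_pmf (favor_stage g ?\<sigma> [] m)"
    have "case m j of None \<Rightarrow> a j = None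
        | Some j' \<Rightarrow> a j \<in> Some ` set_pmf (snd (?\<sigma> j' (private_history g j' []) j))"
      using a unfolding favor_stage_Pi[OF finite_requesters[OF m]] by blast
    then have "a j = Some Defect" using selected_by by (simp add: deviation_def)
    moreover have "a i = None"
      using favor_stage_feasible[OF finite_requesters[OF m] a] mi by (simp add: feasible_favors_def)
    ultimately show "period_payoff S i (\<lambda>_. Keep, m, a) + \<delta> * perpetuity ?G i = - \<gamma> + \<delta> * perpetuity ?G i"
      using payoff_Nil[of a Defect "\<lambda>_. Keep"] by simp
  qed
  ultimately show ?thesis by simp
qed

end

text \<open>The view of i fixes who asks her but not what the others did to their links. Along the
  trembles, a node with a removed link has probability tending to 0, while that of \<open>nd\<close>
  tends to the positive probability of its matching. Hence the belief puts no weight on removed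
  links.\<close>

lemma belief_support:
  assumes seq: "sequential_equilibrium S g \<sigma> \<mu>" and ij: "{i, j} \<in> g"
  defines "nd \<equiv> Favor_Node [] (\<lambda>_. Keep) ((\<lambda>_. None)(j := Some i))"
  assumes nd': "nd' \<in> set_pmf (\<mu> i (view g i nd))"
  obtains m where "nd' = Favor_Node [] (\<lambda>_. Keep) m" "m \<in> set_pmf (match_stage S g)" "m i = None"
    "{k. m k = Some i} = {j}"
proof -
  let ?m = "(\<lambda>_. None)(j := Some i)"
  have neq: "i \<noteq> j" by (rule link_players(3)[OF ij])
  have m0: "?m \<in> set_pmf (match_stage S g)"
    using ij by (intro single_request_match) (simp_all add: insert_commute)
  have fnd: "feasible_node nd"
    using m0 by (simp add: nd_def feasible.Nil feasible_links_def)
  have info: "nd \<in> info_nodes S g i"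
    using fnd by (auto simp: info_nodes_def nodes_eq nd_def)
  obtain \<tau> where mixed: "\<And>k. completely_mixed (\<tau> k)"
    and lim: "\<And>i h j c. (\<lambda>k. pmf (fst (\<tau> k i h j)) c) \<longlonglongrightarrow> pmf (fst (\<sigma> i h j)) c"
    and bayes: "\<And>nd'. (\<lambda>k. pmf (bayes_belief S g (\<tau> k) i nd) nd') \<longlonglongrightarrow> pmf (\<mu> i (view g i nd)) nd'"
    using seq info link_players(1)[OF ij] unfolding sequential_equilibrium_def consistent_def by metis
  let ?P = "\<lambda>k. node_pmf S g (\<tau> k) nd" and ?V = "{nd'. view g i nd' = view g i nd}"
  have nd_in: "nd \<in> set_pmf (?P k)" for k
    unfolding completely_mixed_node_pmf[OF mixed] using fnd by simp
  then have ne: "set_pmf (?P k) \<inter> ?V \<noteq> {}" for k by blast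
  have pb: "pmf (bayes_belief S g (\<tau> k) i nd) y = (if y \<in> ?V then pmf (?P k) y / measure_pmf.prob (?P k) ?V else 0)" for k y
    unfolding bayes_belief_def by (rule pmf_cond[OF ne])
  have "pmf (\<mu> i (view g i nd)) nd' > 0" using nd' by (simp add: pmf_positive)
  \<comment> \<open>A node with positive weight in the limit has positive weight for some k, so it
    is reachable and has the same view as \<open>nd\<close>.\<close>
  then have "eventually (\<lambda>k. 0 < pmf (bayes_belief S g (\<tau> k) i nd) nd') sequentially"
    using bayes by (rule order_tendstoD(1)[rotated])
  then obtain k where k: "0 < pmf (bayes_belief S g (\<tau> k) i nd) nd'"
    by (auto simp: eventually_sequentially)
  then have V: "view g i nd' = view g i nd" and supp: "nd' \<in> set_pmf (?P k)"
    unfolding pb by (auto split: if_splits simp: set_pmf_iff)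
  obtain l m where nd'': "nd' = Favor_Node [] l m" and mi: "m i = None" and asks: "{k. m k = Some i} = {j}"
  proof (cases nd')
    case (Link_Node x)
    then show ?thesis using V by (simp add: nd_def)
  next
    case (Favor_Node x l m)
    then have "length x = 0"
      using node_pmf_feasible[OF supp] by (simp add: nd_def)
    moreover have "m i = None" "{k. m k = Some i} = {j}"
      using V neq by (auto simp: Favor_Node nd_def split: if_splits)
    ultimately show ?thesis using that Favor_Node by simp
  qed
  have l: "l = (\<lambda>_. Keep)"
  proof (rule ccontr)
    assume "l \<noteq> (\<lambda>_. Keep)"
    then have "pmf (link_stage g \<sigma> []) l = 0"
      using on_path_link_stage[of "[]"] by (simp add: pmf_eq_0_set_pmf)
    then have "(\<lambda>k. pmf (link_stage g (\<tau> k) []) l) \<longlonglongrightarrow> 0"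
      using tendsto_link_stage[of \<tau> \<sigma> "[]" l, OF lim] by simp
    then have "(\<lambda>k. pmf (?P k) nd') \<longlonglongrightarrow> 0"
      unfolding nd'' nd_def pmf_node_pmf_Favor_Nil by (rule tendsto_mult_left_zero)
    moreover have "(\<lambda>k. pmf (?P k) nd) \<longlonglongrightarrow> pmf (match_stage S g) ?m"
    proof -
      have "set_pmf (link_stage g \<sigma> []) = {\<lambda>_. Keep}" using on_path_link_stage[of "[]"] by simp
      then have "link_stage g \<sigma> [] = return_pmf (\<lambda>_. Keep)" by (simp add: set_pmf_subset_singleton[symmetric])
      then show ?thesis
        using tendsto_mult[OF tendsto_link_stage[of \<tau> \<sigma> "[]" "\<lambda>_. Keep", OF lim] tendsto_const[of "pmf (match_stage S g) ?m"]]
        unfolding nd_def pmf_node_pmf_Favor_Nil by simp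
    qed
    ultimately have "(\<lambda>k. pmf (?P k) nd' / pmf (?P k) nd) \<longlonglongrightarrow> 0 / pmf (match_stage S g) ?m"
      using m0 by (intro tendsto_divide) (auto simp: set_pmf_iff)
    then have "(\<lambda>k. pmf (?P k) nd' / pmf (?P k) nd) \<longlonglongrightarrow> 0" by simp
    \<comment> \<open>\<open>nd\<close> itself lies in the information set, so its probability
      bounds the normalising constant from below.\<close>
    moreover have "pmf (bayes_belief S g (\<tau> k) i nd) nd' \<le> pmf (?P k) nd' / pmf (?P k) nd" for k
    proof -
      have "pmf (?P k) nd \<le> measure_pmf.prob (?P k) ?V"
        unfolding measure_pmf_single[symmetric] by (rule measure_pmf.finite_measure_mono) auto
      moreover have "0 < pmf (?P k) nd" using nd_in by (rule pmf_positive)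
      ultimately show ?thesis unfolding pb by (auto intro!: divide_left_mono mult_pos_pos)
    qed
    ultimately have "pmf (\<mu> i (view g i nd)) nd' \<le> 0"
      by (intro LIMSEQ_le[OF bayes]) auto
    with \<open>pmf (\<mu> i (view g i nd)) nd' > 0\<close> show False by simp
  qed
  have "m \<in> set_pmf (match_stage S g)"
    using node_pmf_feasible[OF supp] unfolding nd'' l by simp
  with that nd'' l mi asks show ?thesis by blast
qed

text \<open>The bounds of \<open>cooperate_payoff\<close> and \<open>deviate_payoff\<close> are the
  same at every node that i considers possible. Averaging over the belief therefore turns sequential
  rationality into an inequality between two numbers.\<close>

lemma sustained_link:
  assumes ij: "{i, j} \<in> g"
  shows "c - \<gamma> \<le> \<delta> / (1 - \<delta>) * (\<alpha> * (v * (p * (1 - p) ^ (deg g i - 1)) - c * selection_prob p (deg g j)))"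
proof -
  obtain \<mu> where seq: "sequential_equilibrium S g \<sigma> \<mu>"
    using stable unfolding stable_bilateral_equilibrium_def bilateral_equilibrium_def by blast
  let ?nd = "Favor_Node [] (\<lambda>_. Keep) ((\<lambda>_. None)(j := Some i))" and ?G = "g - {{i, j}}"
  let ?\<mu> = "\<mu> i (view g i ?nd)"
  have m0: "(\<lambda>_. None)(j := Some i) \<in> set_pmf (match_stage S g)"
    using ij by (intro single_request_match) (simp_all add: insert_commute)
  then have info: "?nd \<in> info_nodes S g i"
    by (auto simp: info_nodes_def nodes_eq feasible.Nil feasible_links_def)
  have fin: "finite (set_pmf ?\<mu>)"
  proof (rule finite_subset)
    show "set_pmf ?\<mu> \<subseteq> Favor_Node [] (\<lambda>_. Keep) ` set_pmf (match_stage S g)"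
      using belief_support[OF seq ij] by blast
    show "finite (Favor_Node [] (\<lambda>_. Keep) ` set_pmf (match_stage S g))"
      by (intro finite_imageI finite_match_stage[OF subset_refl])
  qed
  have "- \<gamma> + \<delta> * perpetuity ?G i = expect ?\<mu> (\<lambda>_. - \<gamma> + \<delta> * perpetuity ?G i)" by simp
  also have "\<dots> \<le> expect ?\<mu> (continuation_payoff S g (\<sigma>(i := deviation j)) i)"
  proof (rule expect_mono[OF fin])
    fix nd' assume "nd' \<in> set_pmf ?\<mu>"
    then obtain m where "nd' = Favor_Node [] (\<lambda>_. Keep) m" "m \<in> set_pmf (match_stage S g)" "m i = None"
      "{k. m k = Some i} = {j}" by (rule belief_support[OF seq ij])
    then show "- \<gamma> + \<delta> * perpetuity ?G i \<le> continuation_payoff S g (\<sigma>(i := deviation j)) i nd'"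
      using deviate_payoff[OF ij] by simp
  qed
  also have "\<dots> \<le> expect ?\<mu> (continuation_payoff S g \<sigma> i)"
    using seq info link_players(1)[OF ij]
    unfolding sequential_equilibrium_def sequentially_rational_def by blast
  also have "\<dots> \<le> expect ?\<mu> (\<lambda>_. - c + \<delta> * perpetuity g i)"
  proof (rule expect_mono[OF fin])
    fix nd' assume "nd' \<in> set_pmf ?\<mu>"
    then obtain m where "nd' = Favor_Node [] (\<lambda>_. Keep) m" "m \<in> set_pmf (match_stage S g)" "m i = None"
      "{k. m k = Some i} = {j}" by (rule belief_support[OF seq ij])
    then show "continuation_payoff S g \<sigma> i nd' \<le> - c + \<delta> * perpetuity g i"
      using cooperate_payoff[OF ij] by simp
  qed
  finally have "c - \<gamma> \<le> \<delta> * (perpetuity g i - perpetuity ?G i)" by (simp add: algebra_simps)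
  also have "perpetuity g i - perpetuity ?G i = (flow g i - flow ?G i) / (1 - \<delta>)"
    by (simp add: perpetuity_def diff_divide_distrib)
  finally show ?thesis unfolding flow_remove[OF ij] by simp
qed

end

text \<open>The witness is the largest degree in the network. At a player who has it, replacing the
  selection probability of her neighbour by the one at her own degree only weakens the
  inequality.\<close>

lemma (in favor_network) stable_imp_sustainable:
  assumes "stable_network S g" "j \<in> players S" "0 < deg g j"
  obtains d where "deg g j \<le> d" "sustainable \<alpha> p (game S) \<delta> d"
proof -
  obtain \<sigma> where "stable_bilateral_equilibrium S g \<sigma>" using assms(1) unfolding stable_network_def by blast
  then interpret stable_equilibrium S p g \<sigma> by unfold_locales
  have "finite (deg g ` players S)" "deg g ` players S \<noteq> {}" using assms(2) by auto
  then obtain i where i: "i \<in> players S" and max: "\<And>k. k \<in> players S \<Longrightarrow> deg g k \<le> deg g i"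
    using Max_in[of "deg g ` players S"] Max_ge[of "deg g ` players S"] by (metis (no_types, lifting) imageE imageI)
  have d: "0 < deg g i" using max[OF assms(2)] assms(3) by simp
  then obtain k where k: "{i, k} \<in> g" unfolding deg_def by (auto simp: card_gt_0_iff nbrs_def)
  have dk: "deg g k \<le> deg g i" by (rule max[OF link_players(2)[OF k]])
  have "i \<in> nbrs g k" using k by (simp add: nbrs_def insert_commute)
  then have "0 < deg g k" using finite_nbrs[OF subset_refl] by (auto simp: deg_def card_gt_0_iff)
  then have "selection_prob p (deg g i) \<le> selection_prob p (deg g k)"
    by (rule selection_prob_antimono[OF p0 p1 _ dk])
  then have "\<delta> / (1 - \<delta>) * (\<alpha> * (v * (p * (1 - p) ^ (deg g i - 1)) - c * selection_prob p (deg g k)))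
      \<le> \<delta> / (1 - \<delta>) * (\<alpha> * (v * (p * (1 - p) ^ (deg g i - 1)) - c * selection_prob p (deg g i)))"
    using params by (intro mult_left_mono diff_left_mono) auto
  then have "sustainable \<alpha> p (game S) \<delta> (deg g i)"
    using sustained_link[OF k] d by (simp add: sustainable_def)
  then show ?thesis using that max[OF assms(2)] by blast
qed

section \<open>The trigger profile\<close>

text \<open>Only refusals, in either role, count as a quarrel. Link removals are absent from the
  bilateral history, and a removed link allows no further interaction anyway.\<close>

definition good :: "player \<Rightarrow> player \<Rightarrow> history \<Rightarrow> bool" where
  "good i j x \<longleftrightarrow> (\<forall>(l, m, a)\<in>set x. \<not> (m i = Some j \<and> a i = Some Defect) \<and> \<not> (m j = Some i \<and> a j = Some Defect))"

text \<open>The predicate \<open>good\<close> as player i can evaluate it: \<open>r\<close> and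
  \<open>u\<close> are the provider and the answer to her own request, \<open>f j\<close> is her own
  answer to j.\<close>

definition trusted :: "priv_history \<Rightarrow> player \<Rightarrow> bool" where
  "trusted h j \<longleftrightarrow> (\<forall>(N, ls, r, u, f)\<in>set (fst h). \<not> (r = Some j \<and> u = Some Defect) \<and> f j \<noteq> Some Defect)"

definition trigger :: profile where
  "trigger = (\<lambda>i h j. if trusted h j then (return_pmf Keep, return_pmf Coop) else (return_pmf Remove, return_pmf Defect))"

lemma good_sym: "good i j x \<longleftrightarrow> good j i x"
  by (auto simp: good_def)

lemma good_snoc:
  "good i j (x @ [(l, m, a)]) \<longleftrightarrow>
    good i j x \<and> \<not> (m i = Some j \<and> a i = Some Defect) \<and> \<not> (m j = Some i \<and> a j = Some Defect)"
  by (auto simp: good_def)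

lemma trusted_private_history: "trusted (private_history g i x) j \<longleftrightarrow> good i j x"
proof -
  have "trusted (private_history g i x) j \<longleftrightarrow>
      (\<forall>s<length x. case observe i (x ! s) of (ls, r, u, f) \<Rightarrow> \<not> (r = Some j \<and> u = Some Defect) \<and> f j \<noteq> Some Defect)"
    unfolding trusted_def all_set_conv_all_nth by (simp add: private_history_def)
  also have "\<dots> \<longleftrightarrow> (\<forall>s<length x. case x ! s of (l, m, a) \<Rightarrow>
      \<not> (m i = Some j \<and> a i = Some Defect) \<and> \<not> (m j = Some i \<and> a j = Some Defect))"
    by (intro all_cong) (auto split: prod.splits)
  also have "\<dots> \<longleftrightarrow> good i j x"
    unfolding good_def all_set_conv_all_nth ..
  finally show ?thesis .
qed

lemma good_bilateral_history:
  "good i j x \<longleftrightarrow> (\<forall>(u, w)\<in>set (bilateral_history i j x). u \<noteq> Some Defect \<and> w \<noteq> Some Defect)"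
proof -
  have "(\<forall>(u, w)\<in>set (bilateral_history i j x). u \<noteq> Some Defect \<and> w \<noteq> Some Defect) \<longleftrightarrow>
      (\<forall>s<length x. case x ! s of (l, m, a) \<Rightarrow>
        (if m i = Some j then a i else None) \<noteq> Some Defect \<and> (if m j = Some i then a j else None) \<noteq> Some Defect)"
    unfolding all_set_conv_all_nth
    by (simp add: bilateral_history_def case_prod_unfold)
  also have "\<dots> \<longleftrightarrow> (\<forall>s<length x. case x ! s of (l, m, a) \<Rightarrow>
      \<not> (m i = Some j \<and> a i = Some Defect) \<and> \<not> (m j = Some i \<and> a j = Some Defect))"
    by (intro all_cong) (auto split: prod.splits if_splits)
  also have "\<dots> \<longleftrightarrow> good i j x"
    unfolding good_def all_set_conv_all_nth ..
  finally show ?thesis ..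
qed

lemma trigger_private_history:
  "trigger i (private_history g i x) j =
    (if good i j x then (return_pmf Keep, return_pmf Coop) else (return_pmf Remove, return_pmf Defect))"
  by (simp add: trigger_def trusted_private_history)

lemma trigger_bilaterally_measurable: "bilaterally_measurable S g trigger"
  unfolding bilaterally_measurable_def trigger_private_history good_bilateral_history by simp

text \<open>No player other than i ever deviated from \<open>trigger\<close> toward another such
  player. The beliefs of i will be concentrated on these histories.\<close>

definition clean :: "player \<Rightarrow> history \<Rightarrow> bool" where
  "clean i x \<longleftrightarrow> (\<forall>(l, m, a)\<in>set x. \<forall>j k. j \<noteq> i \<longrightarrow> k \<noteq> i \<longrightarrow>
     l (j, k) = Keep \<and> (m j = Some k \<longrightarrow> a j \<noteq> Some Defect))"

definition clean_links :: "player \<Rightarrow> link_choices \<Rightarrow> bool" where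
  "clean_links i l \<longleftrightarrow> (\<forall>j k. j \<noteq> i \<longrightarrow> k \<noteq> i \<longrightarrow> l (j, k) = Keep)"

definition clean_favors :: "player \<Rightarrow> matching \<Rightarrow> favors \<Rightarrow> bool" where
  "clean_favors i m a \<longleftrightarrow> (\<forall>j k. j \<noteq> i \<longrightarrow> k \<noteq> i \<longrightarrow> m j = Some k \<longrightarrow> a j \<noteq> Some Defect)"

fun clean_node :: "player \<Rightarrow> node \<Rightarrow> bool" where
  "clean_node i (Link_Node x) = clean i x"
| "clean_node i (Favor_Node x l m) \<longleftrightarrow> clean i x \<and> clean_links i l"

lemma clean_Nil [simp]: "clean i []"
  by (simp add: clean_def)

lemma clean_snoc: "clean i (x @ [(l, m, a)]) \<longleftrightarrow> clean i x \<and> clean_links i l \<and> clean_favors i m a"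
  by (auto simp: clean_def clean_links_def clean_favors_def)

lemma clean_good: "clean i x \<Longrightarrow> j \<noteq> i \<Longrightarrow> k \<noteq> i \<Longrightarrow> good j k x"
  unfolding clean_def good_def by fast

lemma clean_net:
  assumes "clean i x" "{j, k} \<in> g" "j \<noteq> i" "k \<noteq> i"
  shows "{j, k} \<in> net g x"
  using assms(1)
proof (induction x rule: rev_induct)
  case Nil
  then show ?case using assms(2) by simp
next
  case (snoc z x)
  obtain l m a where z: "z = (l, m, a)" by (cases z)
  have "clean i x" "clean_links i l" using snoc.prems unfolding z clean_snoc by simp_all
  then show ?case
    using snoc.IH assms(3,4) unfolding z net_snoc mem_kept clean_links_def by simp
qed

text \<open>Both conditions matter: a link can be cut without a refusal, and after a refusal it
  exists until the next link stage.\<close>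

definition alive :: "network \<Rightarrow> player \<Rightarrow> history \<Rightarrow> player set" where
  "alive G i x = {j \<in> nbrs G i. good i j x}"

text \<open>The alternative \<open>d = 0\<close> covers parameters for which no degree is
  sustainable; the network then has no links.\<close>

locale regular_network = favor_network +
  fixes d :: nat
  assumes regular: "\<And>i. i \<in> players S \<Longrightarrow> deg g i = d"
    and sustainable: "d = 0 \<or> sustainable \<alpha> p (game S) \<delta> d"
begin

text \<open>The value of having \<open>k\<close> intact links with players all of whose \<open>d\<close> links are intact.\<close>

definition W :: "nat \<Rightarrow> real" where
  "W k = \<alpha> * (v * (1 - (1 - p) ^ k) - c * (real k * selection_prob p d)) / (1 - \<delta>)"

text \<open>The increment of \<open>W\<close> from k to k + 1 decreases in k, so sustainability of
  d, which is the claim for k = d - 1, is the hardest case.\<close>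

lemma W_Suc:
  assumes "k < d"
  shows "\<delta> * W k + (c - \<gamma>) \<le> \<delta> * W (Suc k)"
proof -
  have "c - \<gamma> \<le> \<delta> / (1 - \<delta>) * (\<alpha> * (v * (p * (1 - p) ^ (d - 1)) - c * selection_prob p d))"
    using sustainable assms unfolding sustainable_def by auto
  also have "\<dots> \<le> \<delta> / (1 - \<delta>) * (\<alpha> * (v * (p * (1 - p) ^ k) - c * selection_prob p d))"
    using params p0 p1 assms by (intro mult_left_mono diff_right_mono power_decreasing) auto
  also have "\<dots> = \<delta> * W (Suc k) - \<delta> * W k"
  proof -
    have "W (Suc k) = W k + \<alpha> * (v * (p * (1 - p) ^ k) - c * selection_prob p d) / (1 - \<delta>)"
      unfolding W_def add_divide_distrib[symmetric]
      by (rule arg_cong[where f="\<lambda>z. z / (1 - \<delta>)"]) (simp add: algebra_simps)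
    then show ?thesis by (simp add: distrib_left)
  qed
  finally show ?thesis by simp
qed

text \<open>Several neighbours may ask i in the same period, and she may refuse n of them at once.
  Summing the increments shows that n refusals together gain no more than they cost.\<close>

lemma W_add: "k + n \<le> d \<Longrightarrow> \<delta> * W k + real n * (c - \<gamma>) \<le> \<delta> * W (k + n)"
proof (induction n)
  case (Suc n)
  then show ?case using W_Suc[of "k + n"] by (simp add: algebra_simps)
qed simp

lemma W_mono:
  assumes "k \<le> n" "n \<le> d"
  shows "W k \<le> W n"
proof -
  have "\<delta> * W k + real (n - k) * (c - \<gamma>) \<le> \<delta> * W n"
    using W_add[of k "n - k"] assms by simp
  moreover have "0 \<le> real (n - k) * (c - \<gamma>)" using params by simp
  ultimately have "\<delta> * W k \<le> \<delta> * W n" by linarith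
  then show ?thesis using params by simp
qed

lemma finite_alive: "G \<subseteq> g \<Longrightarrow> finite (alive G i x)"
  using finite_nbrs[of G i] by (simp add: alive_def)

lemma card_alive_le:
  assumes "G \<subseteq> g" "i \<in> players S"
  shows "card (alive G i x) \<le> d"
proof -
  have "alive G i x \<subseteq> nbrs g i" using assms(1) by (auto simp: alive_def nbrs_def)
  then have "card (alive G i x) \<le> card (nbrs g i)"
    using finite_nbrs[OF subset_refl] by (intro card_mono)
  then show ?thesis using regular[OF assms(2)] by (simp add: deg_def)
qed

text \<open>The integrand of \<open>continuation_payoff_le_or_ge\<close>, with \<open>W\<close> at
  the number of alive links as the candidate value.\<close>

abbreviation potential :: "player \<Rightarrow> history \<Rightarrow> real" where
  "potential i y \<equiv> period_payoff S i (last y) + \<delta> * W (card (alive (net g y) i y))"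

text \<open>The value to i of complying with \<open>trigger\<close> at a favor node: good requesters
  are served, the others refused, and no alive link is lost. The realised actions no longer occur in
  it.\<close>

definition favor_value :: "player \<Rightarrow> history \<Rightarrow> link_choices \<Rightarrow> matching \<Rightarrow> real" where
  "favor_value i x l m = (case m i of None \<Rightarrow> 0 | Some j \<Rightarrow> if good i j x then v else 0) +
     (\<Sum>j | j \<in> players S \<and> m j = Some i. if good i j x then - c else - \<gamma>) +
     \<delta> * W (card (alive (kept (net g x) l) i x))"

lemma favor_stage_other:
  assumes "finite {i. m i \<noteq> None}" "a \<in> set_pmf (favor_stage g (trigger(i := \<tau>)) x m)"
    and "m j = Some k" "k \<noteq> i"
  shows "a j = Some (if good k j x then Coop else Defect)"
proof -
  have "case m j of None \<Rightarrow> a j = None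
        | Some k \<Rightarrow> a j \<in> Some ` set_pmf (snd ((trigger(i := \<tau>)) k (private_history g k x) j))"
    using assms(2) unfolding favor_stage_Pi[OF assms(1)] by blast
  then show ?thesis using assms(3,4) by (simp add: trigger_private_history split: if_splits)
qed

lemma favor_stage_trigger:
  assumes "finite {i. m i \<noteq> None}" "a \<in> set_pmf (favor_stage g trigger x m)" "m j = Some k"
  shows "a j = Some (if good k j x then Coop else Defect)"
proof -
  have "case m j of None \<Rightarrow> a j = None
        | Some k \<Rightarrow> a j \<in> Some ` set_pmf (snd (trigger k (private_history g k x) j))"
    using assms(2) unfolding favor_stage_Pi[OF assms(1)] by blast
  then show ?thesis using assms(3) by (simp add: trigger_private_history split: if_splits)
qed

section \<open>Comparison of actions at a favor node\<close>

context
  fixes i :: player and x :: history and l :: link_choices and m :: matching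
  assumes i: "i \<in> players S" and node: "feasible_node (Favor_Node x l m)"
begin

lemma matching_possible: "m \<in> set_pmf (match_stage S (kept (net g x) l))"
  using node by simp

lemma finite_matching: "finite {i. m i \<noteq> None}"
  by (rule finite_requesters[OF matching_possible])

text \<open>The others never refuse a partner in good standing, so among the alive links only those
  spoiled by a refusal of i herself are lost.\<close>

lemma alive_snoc:
  assumes a: "a \<in> set_pmf (favor_stage g (trigger(i := \<tau>)) x m)"
  shows "alive (net g (x @ [(l, m, a)])) i (x @ [(l, m, a)]) =
    alive (kept (net g x) l) i x - {j. m j = Some i \<and> a j = Some Defect}"
proof -
  have "a i \<noteq> Some Defect" if "m i = Some j" "good i j x" for j
  proof -
    have "j \<noteq> i" using match_stage_players(3)[OF matching_possible kept_net_subset that(1)] by simp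
    then show ?thesis
      using favor_stage_other[OF finite_matching a that(1)] that(2) good_sym[of i j x] by simp
  qed
  then have "good i j x \<and> \<not> (m i = Some j \<and> a i = Some Defect) \<and> \<not> (m j = Some i \<and> a j = Some Defect) \<longleftrightarrow>
      good i j x \<and> \<not> (m j = Some i \<and> a j = Some Defect)" for j by meson
  then show ?thesis unfolding alive_def net_snoc good_snoc by auto
qed

lemma requester_part:
  assumes a: "a \<in> set_pmf (favor_stage g (trigger(i := \<tau>)) x m)"
  shows "(case a i of None \<Rightarrow> 0 | Some k \<Rightarrow> requester_payoff (game S) k) =
    (case m i of None \<Rightarrow> 0 | Some j \<Rightarrow> if good i j x then v else 0)"
proof (cases "m i")
  case None
  then show ?thesis
    using favor_stage_feasible[OF finite_matching a, unfolded feasible_favors_def, rule_format, of i] by simp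
next
  case (Some j)
  then have "j \<noteq> i" using match_stage_players(3)[OF matching_possible kept_net_subset Some] by simp
  then show ?thesis using favor_stage_other[OF finite_matching a Some] Some good_sym[of i j x] by simp
qed

text \<open>\<open>?D\<close> consists of the alive requesters whom i refuses. Each brings c -
  \<gamma> now and costs one alive link, so \<open>W_add\<close> offsets all of them together.
  Serving a requester in bad standing only replaces -\<gamma> by the smaller -c.\<close>

lemma potential_le_favor_value:
  assumes a: "a \<in> set_pmf (favor_stage g (trigger(i := \<tau>)) x m)"
  shows "potential i (x @ [(l, m, a)]) \<le> favor_value i x l m"
proof -
  let ?N = "alive (kept (net g x) l) i x" and ?A = "{j. j \<in> players S \<and> m j = Some i}"
  let ?D = "{j. m j = Some i \<and> a j = Some Defect} \<inter> ?N"
  have finN: "finite ?N" by (rule finite_alive[OF kept_net_subset])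
  have DA: "?D \<subseteq> ?A" using match_stage_players(1)[OF matching_possible kept_net_subset] by auto
  have cardN: "card ?N \<le> d" by (rule card_alive_le[OF kept_net_subset i])
  have card: "card (?N - {j. m j = Some i \<and> a j = Some Defect}) + card ?D = card ?N"
  proof -
    have "?N - {j. m j = Some i \<and> a j = Some Defect} = ?N - ?D" by blast
    moreover have "card (?N - ?D) = card ?N - card ?D" using finN by (intro card_Diff_subset) auto
    moreover have "card ?D \<le> card ?N" using finN by (intro card_mono) auto
    ultimately show ?thesis by simp
  qed
  have "(case a j of None \<Rightarrow> 0 | Some k \<Rightarrow> provider_payoff (game S) k) \<le>
      (if good i j x then - c else - \<gamma>) + (if j \<in> ?D then c - \<gamma> else 0)" if j: "j \<in> ?A" for j
  proof -
    have mj: "m j = Some i" using j by simp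
    then obtain u where u: "a j = Some u"
      using favor_stage_feasible[OF finite_matching a, unfolded feasible_favors_def, rule_format, of j] by auto
    have "j \<in> nbrs (kept (net g x) l) i"
      using match_stage_link[OF matching_possible kept_net_subset mj] by (simp add: nbrs_def insert_commute)
    then have "j \<in> ?D \<longleftrightarrow> u = Defect \<and> good i j x"
      using mj u by (simp add: alive_def)
    then show ?thesis using params u by (cases u) simp_all
  qed
  then have "(\<Sum>j\<in>?A. case a j of None \<Rightarrow> 0 | Some k \<Rightarrow> provider_payoff (game S) k) \<le>
      (\<Sum>j\<in>?A. (if good i j x then - c else - \<gamma>) + (if j \<in> ?D then c - \<gamma> else 0))"
    by (rule sum_mono)
  also have "\<dots> = (\<Sum>j\<in>?A. if good i j x then - c else - \<gamma>) + real (card ?D) * (c - \<gamma>)"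
  proof -
    have "(\<Sum>j\<in>?A. if j \<in> ?D then c - \<gamma> else 0) = (\<Sum>j\<in>?D. c - \<gamma>)"
      using DA by (intro sum.mono_neutral_cong_right) auto
    then show ?thesis by (simp add: sum.distrib)
  qed
  finally have "(\<Sum>j\<in>?A. case a j of None \<Rightarrow> 0 | Some k \<Rightarrow> provider_payoff (game S) k) \<le>
      (\<Sum>j\<in>?A. if good i j x then - c else - \<gamma>) + real (card ?D) * (c - \<gamma>)" .
  moreover have "\<delta> * W (card (?N - {j. m j = Some i \<and> a j = Some Defect})) + real (card ?D) * (c - \<gamma>) \<le> \<delta> * W (card ?N)"
    using W_add[of "card (?N - {j. m j = Some i \<and> a j = Some Defect})" "card ?D"] cardN card by simp
  ultimately show ?thesis
    unfolding alive_snoc[OF a] favor_value_def last_snoc period_payoff.simps requester_part[OF a] by linarith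
qed

lemma potential_eq_favor_value:
  assumes a: "a \<in> set_pmf (favor_stage g trigger x m)"
  shows "potential i (x @ [(l, m, a)]) = favor_value i x l m"
proof -
  have a': "a \<in> set_pmf (favor_stage g (trigger(i := trigger i)) x m)" using a by simp
  have aj: "a j = Some (if good i j x then Coop else Defect)" if "m j = Some i" for j
    by (rule favor_stage_trigger[OF finite_matching a that])
  have "alive (kept (net g x) l) i x - {j. m j = Some i \<and> a j = Some Defect} = alive (kept (net g x) l) i x"
    using aj by (auto simp: alive_def)
  moreover have "(\<Sum>j | j \<in> players S \<and> m j = Some i. case a j of None \<Rightarrow> 0 | Some k \<Rightarrow> provider_payoff (game S) k) =
      (\<Sum>j | j \<in> players S \<and> m j = Some i. if good i j x then - c else - \<gamma>)"
    using aj by (intro sum.cong) auto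
  ultimately show ?thesis
    unfolding alive_snoc[OF a'] favor_value_def last_snoc period_payoff.simps requester_part[OF a'] by simp
qed

end

section \<open>Bellman inequality at a link node after a clean history\<close>

context
  fixes i :: player and x :: history
  assumes i: "i \<in> players S" and x: "feasible x" "clean i x"
begin

lemma links_other:
  assumes "l \<in> set_pmf (link_stage g (trigger(i := \<tau>)) x)" "j \<noteq> i" "{j, k} \<in> net g x"
  shows "l (j, k) = (if good j k x then Keep else Remove)"
proof -
  have "if {j, k} \<in> net g x then l (j, k) \<in> set_pmf (fst ((trigger(i := \<tau>)) j (private_history g j x) k)) else l (j, k) = Keep"
    using assms(1) unfolding link_stage_Pi by blast
  then show ?thesis using assms(2,3) by (simp add: trigger_private_history split: if_splits)
qed

lemma links_clean:
  assumes "l \<in> set_pmf (link_stage g (trigger(i := \<tau>)) x)"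
  shows "clean_links i l"
  unfolding clean_links_def
proof (intro allI impI)
  fix j k assume jk: "j \<noteq> i" "k \<noteq> i"
  show "l (j, k) = Keep"
  proof (cases "{j, k} \<in> net g x")
    case True
    then show ?thesis using links_other[OF assms jk(1) True] clean_good[OF x(2) jk] by simp
  next
    case False
    then show ?thesis using link_stage_feasible[OF assms] by (simp add: feasible_links_def)
  qed
qed

text \<open>Whatever i chooses, the other endpoint removes a link on which a favor was refused, so
  the surviving links of i are good.\<close>

lemma nbrs_good:
  assumes l: "l \<in> set_pmf (link_stage g (trigger(i := \<tau>)) x)" and j: "j \<in> nbrs (kept (net g x) l) i"
  shows "good i j x" "{i, j} \<in> net g x"
proof -
  show ij: "{i, j} \<in> net g x" using j by (simp add: nbrs_def mem_kept)
  then have "i \<noteq> j" using link_players(3) net_subset by blast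
  then have "l (j, i) = (if good j i x then Keep else Remove)"
    using ij by (intro links_other[OF l]) (simp_all add: insert_commute)
  moreover have "l (j, i) = Keep" using j by (simp add: nbrs_def mem_kept)
  ultimately show "good i j x" by (simp add: good_sym[of i j] split: if_splits)
qed

lemma alive_kept:
  assumes l: "l \<in> set_pmf (link_stage g (trigger(i := \<tau>)) x)"
  shows "alive (kept (net g x) l) i x = nbrs (kept (net g x) l) i"
  using nbrs_good[OF l] by (auto simp: alive_def)

text \<open>After a clean history all links not involving i survive, so a remaining neighbour j
  still has d links. This is where what i believes about unseen links matters: it makes j select her
  with probability \<open>selection_prob p d\<close>.\<close>

lemma deg_kept:
  assumes l: "l \<in> set_pmf (link_stage g (trigger(i := \<tau>)) x)" and j: "j \<in> nbrs (kept (net g x) l) i"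
  shows "deg (kept (net g x) l) j = d"
proof -
  have ij: "{i, j} \<in> g" using nbrs_good(2)[OF l j] net_subset by blast
  note ne = link_players(3)[OF ij]
  have "{j, k} \<in> kept (net g x) l" if jk: "{j, k} \<in> g" for k
  proof (cases "k = i")
    case True
    then show ?thesis using j by (simp add: nbrs_def insert_commute)
  next
    case False
    then show ?thesis
      using clean_net[OF x(2) jk] links_clean[OF l] ne by (simp add: mem_kept clean_links_def)
  qed
  then have "nbrs (kept (net g x) l) j = nbrs g j"
    using kept_net_subset[of x l] by (auto simp: nbrs_def)
  then show ?thesis using regular[OF link_players(2)[OF ij]] by (simp add: deg_def)
qed

text \<open>All remaining partners are in good standing and have d links, so the flow of i equals (1
  - \<delta>) times \<open>W\<close> at her number of links. Adding the continuation term gives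
  \<open>W\<close> itself.\<close>

lemma expect_favor_value:
  assumes l: "l \<in> set_pmf (link_stage g (trigger(i := \<tau>)) x)"
  defines "G \<equiv> kept (net g x) l"
  shows "expect (match_stage S G) (favor_value i x l) = W (card (nbrs G i))"
proof -
  have G: "G \<subseteq> g" unfolding G_def by (rule kept_net_subset)
  have "expect (match_stage S G) (favor_value i x l) =
      expect (match_stage S G) (\<lambda>m. coop_payoff i m + \<delta> * W (card (nbrs G i)))"
  proof (rule expect_cong)
    fix m assume m: "m \<in> set_pmf (match_stage S G)"
    have good: "good i j x" if "m i = Some j \<or> m j = Some i" for j
    proof -
      have "{i, j} \<in> G"
        using that match_stage_link[OF m G, of i j] match_stage_link[OF m G, of j i]
        by (auto simp: insert_commute)
      then show ?thesis using nbrs_good(1)[OF l, of j] by (simp add: nbrs_def G_def)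
    qed
    then have "(case m i of None \<Rightarrow> 0 | Some j \<Rightarrow> if good i j x then v else 0) = (if m i = None then 0 else v)"
      by (auto split: option.splits)
    moreover have "(\<Sum>j | j \<in> players S \<and> m j = Some i. if good i j x then - c else - \<gamma>) =
        (\<Sum>j | j \<in> players S \<and> m j = Some i. - c)"
      using good by (intro sum.cong) auto
    ultimately show "favor_value i x l m = coop_payoff i m + \<delta> * W (card (nbrs G i))"
      using alive_kept[OF l] by (simp add: favor_value_def coop_payoff_def G_def)
  qed
  also have "\<dots> = flow G i + \<delta> * W (card (nbrs G i))"
    using expect_coop_payoff[OF G i] by (simp add: expect_add[OF finite_match_stage[OF G]])
  also have "flow G i = (1 - \<delta>) * W (card (nbrs G i))"
  proof -
    have "(\<Sum>j\<in>nbrs G i. selection_prob p (deg G j)) = (\<Sum>j\<in>nbrs G i. selection_prob p d)"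
      using deg_kept[OF l] unfolding G_def by (intro sum.cong) auto
    then show ?thesis using params by (simp add: flow_def W_def deg_def[of G i])
  qed
  finally show ?thesis by (simp add: algebra_simps)
qed

text \<open>Value can be lost in two ways only: by cutting an alive link, where
  \<open>W_mono\<close> applies, and by deviating at the favor stage, where
  \<open>potential_le_favor_value\<close> applies.\<close>

lemma potential_Link_le:
  "expect (period_end S g (trigger(i := \<tau>)) (Link_Node x)) (potential i) \<le> W (card (alive (net g x) i x))"
  unfolding expect_period_end_Link
proof (rule expect_le[OF finite_link_stage])
  fix l assume l: "l \<in> set_pmf (link_stage g (trigger(i := \<tau>)) x)"
  let ?G = "kept (net g x) l"
  note finM = finite_match_stage[OF kept_net_subset[of x l]]
  have "expect (match_stage S ?G) (\<lambda>m. expect (favor_stage g (trigger(i := \<tau>)) x m) (\<lambda>a. potential i (x @ [(l, m, a)])))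
      \<le> expect (match_stage S ?G) (favor_value i x l)"
  proof (rule expect_mono[OF finM])
    fix m assume m: "m \<in> set_pmf (match_stage S ?G)"
    have node: "feasible_node (Favor_Node x l m)"
      using x(1) m link_stage_feasible[OF l] by simp
    show "expect (favor_stage g (trigger(i := \<tau>)) x m) (\<lambda>a. potential i (x @ [(l, m, a)])) \<le> favor_value i x l m"
      by (rule expect_le[OF finite_favor_stage[OF finite_requesters[OF m]] potential_le_favor_value[OF i node]])
  qed
  also have "\<dots> = W (card (nbrs ?G i))" by (rule expect_favor_value[OF l])
  also have "\<dots> \<le> W (card (alive (net g x) i x))"
  proof (rule W_mono)
    have "nbrs ?G i \<subseteq> alive (net g x) i x"
      using nbrs_good[OF l] unfolding alive_def by (auto simp: nbrs_def)
    then show "card (nbrs ?G i) \<le> card (alive (net g x) i x)"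
      by (rule card_mono[OF finite_alive[OF net_subset]])
    show "card (alive (net g x) i x) \<le> d" by (rule card_alive_le[OF net_subset i])
  qed
  finally show "expect (match_stage S ?G) (\<lambda>m. expect (favor_stage g (trigger(i := \<tau>)) x m) (\<lambda>a. potential i (x @ [(l, m, a)])))
      \<le> W (card (alive (net g x) i x))" .
qed

text \<open>When i follows \<open>trigger\<close> as well, both endpoints keep every alive link and
  no alive requester is refused, so neither loss of \<open>potential_Link_le\<close> occurs.\<close>

lemma potential_Link_eq:
  "expect (period_end S g trigger (Link_Node x)) (potential i) = W (card (alive (net g x) i x))"
  unfolding expect_period_end_Link
proof (rule expect_const)
  fix l assume l: "l \<in> set_pmf (link_stage g trigger x)"
  then have l': "l \<in> set_pmf (link_stage g (trigger(i := trigger i)) x)" by simp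
  let ?G = "kept (net g x) l"
  have "expect (match_stage S ?G) (\<lambda>m. expect (favor_stage g trigger x m) (\<lambda>a. potential i (x @ [(l, m, a)])))
      = expect (match_stage S ?G) (favor_value i x l)"
  proof (rule expect_cong)
    fix m assume m: "m \<in> set_pmf (match_stage S ?G)"
    have node: "feasible_node (Favor_Node x l m)"
      using x(1) m link_stage_feasible[OF l] by simp
    show "expect (favor_stage g trigger x m) (\<lambda>a. potential i (x @ [(l, m, a)])) = favor_value i x l m"
      by (rule expect_const[OF potential_eq_favor_value[OF i node]])
  qed
  also have "\<dots> = W (card (nbrs ?G i))" by (rule expect_favor_value[OF l'])
  also have "nbrs ?G i = alive (net g x) i x"
  proof -
    have "l (i, j) = Keep \<and> l (j, i) = Keep" if "{i, j} \<in> net g x" "good i j x" for j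
    proof -
      have "if {a, b} \<in> net g x then l (a, b) \<in> set_pmf (fst (trigger a (private_history g a x) b)) else l (a, b) = Keep" for a b
        using l unfolding link_stage_Pi by blast
      from this[of i j] this[of j i] show ?thesis
        using that by (simp add: trigger_private_history insert_commute good_sym[of j i])
    qed
    then have "j \<in> nbrs ?G i" if "j \<in> alive (net g x) i x" for j
      using that by (simp add: alive_def nbrs_def mem_kept)
    moreover have "j \<in> alive (net g x) i x" if "j \<in> nbrs ?G i" for j
      using nbrs_good[OF l' that] by (simp add: alive_def nbrs_def)
    ultimately show ?thesis by blast
  qed
  finally show "expect (match_stage S ?G) (\<lambda>m. expect (favor_stage g trigger x m) (\<lambda>a. potential i (x @ [(l, m, a)])))
      = W (card (alive (net g x) i x))" .
qed

end

lemma favors_clean: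
  assumes "finite {i. m i \<noteq> None}" "a \<in> set_pmf (favor_stage g (trigger(i := \<tau>)) x m)" "clean i x"
  shows "clean_favors i m a"
  unfolding clean_favors_def
proof (intro allI impI)
  fix j k assume jk: "j \<noteq> i" "k \<noteq> i" "m j = Some k"
  then show "a j \<noteq> Some Defect"
    using favor_stage_other[OF assms(1,2) jk(3,2)] clean_good[OF assms(3) jk(2,1)] by simp
qed

text \<open>The others are in good standing with each other and follow \<open>trigger\<close>, so no
  strategy of i can disturb cleanness. This makes \<open>clean i\<close> an invariant for all of her
  deviations.\<close>

lemma clean_period_end:
  assumes i: "i \<in> players S" and nd: "feasible_node nd" "clean_node i nd"
    and y: "y \<in> set_pmf (period_end S g (trigger(i := \<tau>)) nd)"
  shows "clean i y"
proof (cases nd)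
  case (Link_Node x)
  then obtain l m a where y': "y = x @ [(l, m, a)]" and l: "l \<in> set_pmf (link_stage g (trigger(i := \<tau>)) x)"
    and m: "m \<in> set_pmf (match_stage S (kept (net g x) l))"
    and a: "a \<in> set_pmf (favor_stage g (trigger(i := \<tau>)) x m)"
    using y unfolding Link_Node set_period_end_Link by blast
  have x: "feasible x" "clean i x" using nd Link_Node by simp_all
  show ?thesis
    unfolding y' clean_snoc using x(2) links_clean[OF i x l] favors_clean[OF finite_requesters[OF m] a x(2)] by simp
next
  case (Favor_Node x l m)
  then obtain a where y': "y = x @ [(l, m, a)]" and a: "a \<in> set_pmf (favor_stage g (trigger(i := \<tau>)) x m)"
    using y unfolding Favor_Node set_period_end_Favor by blast
  have m: "m \<in> set_pmf (match_stage S (kept (net g x) l))" using nd Favor_Node by simp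
  show ?thesis
    unfolding y' clean_snoc using nd(2) Favor_Node favors_clean[OF finite_requesters[OF m] a] by simp
qed

text \<open>The Bellman inequality bounds every strategy of i by the expected potential, the current
  period is compared directly, and equality for \<open>trigger\<close> attains the bound. Deviations
  in any number of periods are thus covered without a reduction to single ones.\<close>

lemma trigger_optimal:
  assumes i: "i \<in> players S" and nd: "feasible_node nd" "clean_node i nd"
  shows "continuation_payoff S g (trigger(i := \<tau>)) i nd \<le> continuation_payoff S g trigger i nd"
proof -
  define L where "L = (\<Sum>k\<le>d. \<bar>W k\<bar>)"
  \<comment> \<open>At most d links are alive, so only finitely many values of \<open>W\<close>
    occur and their absolute sum is a uniform bound.\<close>
  have L: "\<bar>W (card (alive (net g x) i x))\<bar> \<le> L" for x
    unfolding L_def using card_alive_le[OF net_subset i, of x x]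
    by (intro member_le_sum[where f="\<lambda>k. \<bar>W k\<bar>"]) auto
  have step: "clean i y" if "feasible x" "clean i x" "y \<in> set_pmf (period_end S g (trigger(i := \<tau>)) (Link_Node x))" for x y \<tau>
    by (rule clean_period_end[OF i _ _ that(3)]) (simp_all add: that)
  have "continuation_payoff S g (trigger(i := \<tau>)) i nd \<le> expect (period_end S g (trigger(i := \<tau>)) nd) (potential i)"
  proof (rule continuation_payoff_le_or_ge(1)[where I="clean i" and L=L])
    show "\<forall>x. feasible x \<longrightarrow> clean i x \<longrightarrow>
        expect (period_end S g (trigger(i := \<tau>)) (Link_Node x)) (potential i) \<le> W (card (alive (net g x) i x))"
      by (intro allI impI potential_Link_le i)
  qed (fact nd(1), erule clean_period_end[OF i nd], erule (2) step, rule L)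
  also have "\<dots> \<le> expect (period_end S g trigger nd) (potential i)"
  proof (cases nd)
    case (Link_Node x)
    then have "feasible x" "clean i x" using nd by simp_all
    then show ?thesis unfolding Link_Node by (simp only: potential_Link_eq[OF i] potential_Link_le[OF i])
  next
    case (Favor_Node x l m)
    then have node: "feasible_node (Favor_Node x l m)" using nd by simp
    then have fin: "finite {i. m i \<noteq> None}" by (intro finite_requesters[of m "kept (net g x) l"]) simp
    have "expect (favor_stage g (trigger(i := \<tau>)) x m) (\<lambda>a. potential i (x @ [(l, m, a)])) \<le> favor_value i x l m"
      by (rule expect_le[OF finite_favor_stage[OF fin] potential_le_favor_value[OF i node]])
    moreover have "expect (favor_stage g trigger x m) (\<lambda>a. potential i (x @ [(l, m, a)])) = favor_value i x l m"
      by (rule expect_const[OF potential_eq_favor_value[OF i node]])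
    ultimately show ?thesis unfolding Favor_Node expect_period_end_Favor by simp
  qed
  also have "expect (period_end S g trigger nd) (potential i) =
      expect (period_end S g (trigger(i := trigger i)) nd) (potential i)" by simp
  also have "\<dots> \<le> continuation_payoff S g (trigger(i := trigger i)) i nd"
  proof (rule continuation_payoff_le_or_ge(2)[where I="clean i" and L=L])
    show "\<forall>x. feasible x \<longrightarrow> clean i x \<longrightarrow>
        expect (period_end S g (trigger(i := trigger i)) (Link_Node x)) (potential i) \<ge> W (card (alive (net g x) i x))"
      unfolding fun_upd_triv by (intro allI impI eq_refl[OF sym] potential_Link_eq i)
  qed (fact nd(1), erule clean_period_end[OF i nd], erule (2) step, rule L)
  finally show ?thesis by simp
qed

lemma trigger_on_path:
  assumes "x \<in> set_pmf (history_pmf S g trigger t)"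
  shows "net g x = g \<and> (\<forall>(l, m, a)\<in>set x. \<forall>i. m i \<noteq> None \<longrightarrow> a i = Some Coop)"
  using assms
proof (induction t arbitrary: x)
  case (Suc t)
  obtain y where y: "y \<in> set_pmf (history_pmf S g trigger t)"
    "x \<in> set_pmf (period_end S g trigger (Link_Node y))"
    using Suc.prems unfolding history_pmf.simps set_bind_pmf by (elim UN_E)
  note IH = Suc.IH[OF y(1)]
  obtain l m a where x: "x = y @ [(l, m, a)]" and l: "l \<in> set_pmf (link_stage g trigger y)"
    and m: "m \<in> set_pmf (match_stage S (kept (net g y) l))" and a: "a \<in> set_pmf (favor_stage g trigger y m)"
    using y(2) unfolding set_period_end_Link by blast
  have good: "good i j y" for i j
    using IH unfolding good_def by fastforce
  have "l (i, j) = Keep" for i j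
  proof -
    have "if {i, j} \<in> net g y then l (i, j) \<in> set_pmf (fst (trigger i (private_history g i y) j)) else l (i, j) = Keep"
      using l unfolding link_stage_Pi by blast
    then show ?thesis by (simp add: trigger_private_history good split: if_splits)
  qed
  then have "l = (\<lambda>_. Keep)" by (auto simp: fun_eq_iff)
  moreover have "a i = Some Coop" if "m i \<noteq> None" for i
    using favor_stage_trigger[OF finite_requesters[OF m] a, of i] that good by auto
  ultimately show ?case using IH by (simp add: x)
qed simp

end

section \<open>Limits of beliefs\<close>

text \<open>All supports lie in one finite set, so no mass escapes and the pointwise limits sum to
  1.\<close>

lemma pmf_limit_exists:
  fixes q :: "nat \<Rightarrow> 'a pmf"
  assumes fin: "finite A" and sub: "\<And>k. set_pmf (q k) \<subseteq> A"
    and conv: "\<And>y. y \<in> A \<Longrightarrow> convergent (\<lambda>k. pmf (q k) y)"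
  shows "\<exists>r. \<forall>y. (\<lambda>k. pmf (q k) y) \<longlonglongrightarrow> pmf r y"
proof -
  define b where "b = (\<lambda>y. lim (\<lambda>k. pmf (q k) y))"
  have lim: "(\<lambda>k. pmf (q k) y) \<longlonglongrightarrow> b y" for y
  proof (cases "y \<in> A")
    case True
    then show ?thesis using conv unfolding b_def by (simp add: convergent_LIMSEQ_iff)
  next
    case False
    then have "pmf (q k) y = 0" for k using sub[of k] by (auto simp: pmf_eq_0_set_pmf)
    then show ?thesis unfolding b_def by simp
  qed
  have out: "b y = 0" if "y \<notin> A" for y
  proof -
    have "pmf (q k) y = 0" for k using sub[of k] that by (auto simp: pmf_eq_0_set_pmf)
    then show ?thesis unfolding b_def by simp
  qed
  have nn: "0 \<le> b y" for y by (rule LIMSEQ_le_const[OF lim]) simp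
  have "(\<lambda>k. \<Sum>y\<in>A. pmf (q k) y) \<longlonglongrightarrow> (\<Sum>y\<in>A. b y)" by (intro tendsto_sum lim)
  moreover have "(\<Sum>y\<in>A. pmf (q k) y) = 1" for k by (rule sum_pmf_eq_1[OF fin sub])
  ultimately have sum1: "(\<Sum>y\<in>A. b y) = 1" by (simp add: LIMSEQ_const_iff)
  have "(\<integral>\<^sup>+y. ennreal (b y) \<partial>count_space UNIV) = (\<Sum>y\<in>A. ennreal (b y))"
    by (rule nn_integral_count_space'[OF fin]) (simp_all add: out)
  also have "\<dots> = 1" using sum1 nn by (simp add: sum_ennreal)
  finally have "pmf (embed_pmf b) y = b y" for y using nn by (intro pmf_embed_pmf)
  then show ?thesis using lim by (intro exI[of _ "embed_pmf b"]) simp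
qed

text \<open>
  If all trembles have probability \<open>e\<close>, then the probability of a node is a product of factors \<open>e\<close>, \<open>1 - e\<close>
  and constants, and a Bayesian belief is a ratio of sums of such products.
\<close>

definition leading :: "(real \<Rightarrow> real) \<Rightarrow> bool" where
  "leading f \<longleftrightarrow> (\<exists>C>0. \<exists>n. ((\<lambda>e. f e / e ^ n) \<longlongrightarrow> C) (at_right 0))"

lemma leadingI: "C > 0 \<Longrightarrow> ((\<lambda>e. f e / e ^ n) \<longlongrightarrow> C) (at_right 0) \<Longrightarrow> leading f"
  unfolding leading_def by blast

lemma eventually_at_right_pos: "\<forall>\<^sub>F e :: real in at_right 0. 0 < e"
  by (rule eventually_at_right_less)

lemma tendsto_power_at_right: "((\<lambda>e :: real. e ^ n) \<longlongrightarrow> 0 ^ n) (at_right 0)"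
  by (intro tendsto_power tendsto_ident_at)

lemma leading_cong:
  assumes "leading f" "\<forall>\<^sub>F e in at_right 0. f e = h e"
  shows "leading h"
proof -
  obtain C n where C: "C > 0" "((\<lambda>e. f e / e ^ n) \<longlongrightarrow> C) (at_right 0)"
    using assms(1) unfolding leading_def by blast
  have "((\<lambda>e. h e / e ^ n) \<longlongrightarrow> C) (at_right 0)"
    by (rule Lim_transform_eventually[OF C(2)]) (use assms(2) in eventually_elim, simp)
  then show ?thesis by (rule leadingI[OF C(1)])
qed

lemma leading_const: "0 < k \<Longrightarrow> leading (\<lambda>_. k)"
  by (rule leadingI[where n=0 and C=k]) simp_all

lemma leading_tremble: "leading (\<lambda>e. if b then e else 1 - e)"
proof (cases b)
  case True
  have "((\<lambda>e::real. 1) \<longlongrightarrow> 1) (at_right 0)" by simp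
  moreover have "\<forall>\<^sub>F e :: real in at_right 0. 1 = e / e ^ 1"
    using eventually_at_right_pos by eventually_elim simp
  ultimately have "((\<lambda>e::real. e / e ^ 1) \<longlongrightarrow> 1) (at_right 0)" by (rule Lim_transform_eventually)
  then show ?thesis using True by (intro leadingI[where n=1 and C=1]) simp_all
next
  case False
  have "((\<lambda>e::real. 1 - e) \<longlongrightarrow> 1 - 0) (at_right 0)" by (intro tendsto_intros tendsto_ident_at)
  then show ?thesis using False by (intro leadingI[where n=0 and C=1]) simp_all
qed

lemma leading_mult:
  assumes "leading f" "leading h"
  shows "leading (\<lambda>e. f e * h e)"
proof -
  obtain C n D m where C: "C > 0" "((\<lambda>e. f e / e ^ n) \<longlongrightarrow> C) (at_right 0)"
    and D: "D > 0" "((\<lambda>e. h e / e ^ m) \<longlongrightarrow> D) (at_right 0)"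
    using assms unfolding leading_def by blast
  have "((\<lambda>e. f e / e ^ n * (h e / e ^ m)) \<longlongrightarrow> C * D) (at_right 0)"
    by (intro tendsto_mult C D)
  then show ?thesis using C D by (intro leadingI[where n="n + m" and C="C * D"]) (simp_all add: power_add)
qed

lemma leading_prod: "finite A \<Longrightarrow> (\<And>z. z \<in> A \<Longrightarrow> leading (f z)) \<Longrightarrow> leading (\<lambda>e. \<Prod>z\<in>A. f z e)"
proof (induction A rule: finite_induct)
  case empty
  then show ?case using leading_const[of 1] by simp
next
  case (insert z A)
  then show ?case using leading_mult[of "f z" "\<lambda>e. \<Prod>z\<in>A. f z e"] by simp
qed

text \<open>Positive coefficients cannot cancel, so the smaller exponent prevails. The factor
  \<open>0 ^ (m - n)\<close> is 1 for equal exponents and 0 otherwise, which treats both cases in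
  one limit.\<close>

lemma leading_add_le:
  assumes C: "C > 0" "((\<lambda>e. f e / e ^ n) \<longlongrightarrow> C) (at_right 0)"
    and D: "D > 0" "((\<lambda>e. h e / e ^ m) \<longlongrightarrow> D) (at_right 0)" and nm: "n \<le> m"
  shows "leading (\<lambda>e. f e + h e)"
proof (rule leadingI)
  have "((\<lambda>e. f e / e ^ n + h e / e ^ m * e ^ (m - n)) \<longlongrightarrow> C + D * 0 ^ (m - n)) (at_right 0)"
    by (intro tendsto_intros C D tendsto_power_at_right)
  moreover have "\<forall>\<^sub>F e in at_right 0. f e / e ^ n + h e / e ^ m * e ^ (m - n) = (f e + h e) / e ^ n"
    using eventually_at_right_pos
  proof eventually_elim
    case (elim e)
    have "e ^ m = e ^ n * e ^ (m - n)" using nm by (simp add: power_add[symmetric])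
    then show ?case using elim by (simp add: add_divide_distrib)
  qed
  ultimately show "((\<lambda>e. (f e + h e) / e ^ n) \<longlongrightarrow> C + D * 0 ^ (m - n)) (at_right 0)"
    by (rule Lim_transform_eventually)
  show "0 < C + D * 0 ^ (m - n)" using C D by (simp add: add_pos_nonneg)
qed

lemma leading_add:
  assumes "leading f" "leading h"
  shows "leading (\<lambda>e. f e + h e)"
proof -
  obtain C n D m where C: "C > 0" "((\<lambda>e. f e / e ^ n) \<longlongrightarrow> C) (at_right 0)"
    and D: "D > 0" "((\<lambda>e. h e / e ^ m) \<longlongrightarrow> D) (at_right 0)"
    using assms unfolding leading_def by blast
  show ?thesis
  proof (cases "n \<le> m")
    case True
    then show ?thesis by (rule leading_add_le[OF C D])
  next
    case False
    then have "leading (\<lambda>e. h e + f e)" by (intro leading_add_le[OF D C]) simp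
    then show ?thesis by (simp add: add.commute)
  qed
qed

lemma leading_sum:
  "finite A \<Longrightarrow> A \<noteq> {} \<Longrightarrow> (\<And>z. z \<in> A \<Longrightarrow> leading (f z)) \<Longrightarrow> leading (\<lambda>e. \<Sum>z\<in>A. f z e)"
proof (induction A rule: finite_ne_induct)
  case (insert z A)
  then show ?case using leading_add[of "f z" "\<lambda>e. \<Sum>z\<in>A. f z e"] by simp
qed simp

text \<open>From f below h the exponent of f is at least that of h. The ratio then behaves like a
  constant times a nonnegative power of e and converges.\<close>

lemma leading_ratio:
  assumes "leading f" "leading h" and le: "\<forall>\<^sub>F e in at_right 0. f e \<le> h e"
  shows "\<exists>L. ((\<lambda>e. f e / h e) \<longlongrightarrow> L) (at_right 0)"
proof -
  obtain C n D m where C: "C > 0" "((\<lambda>e. f e / e ^ n) \<longlongrightarrow> C) (at_right 0)"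
    and D: "D > 0" "((\<lambda>e. h e / e ^ m) \<longlongrightarrow> D) (at_right 0)"
    using assms unfolding leading_def by blast
  have "m \<le> n"
  proof (rule ccontr)
    assume "\<not> m \<le> n"
    then have zero: "(0::real) ^ (m - n) = 0" by simp
    have "((\<lambda>e. h e / e ^ m * e ^ (m - n)) \<longlongrightarrow> D * 0) (at_right 0)"
      using tendsto_mult[OF D(2) tendsto_power_at_right[of "m - n"]] unfolding zero .
    moreover have "\<forall>\<^sub>F e in at_right 0. f e / e ^ n \<le> h e / e ^ m * e ^ (m - n)"
      using eventually_at_right_pos le
    proof eventually_elim
      case (elim e)
      have "e ^ m = e ^ n * e ^ (m - n)" using \<open>\<not> m \<le> n\<close> by (simp add: power_add[symmetric])
      then show ?case using elim by (simp add: divide_right_mono)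
    qed
    ultimately have "C \<le> D * 0"
      by (intro tendsto_le[OF trivial_limit_at_right_real _ C(2)])
    then show False using C(1) by simp
  qed
  have "((\<lambda>e. f e / e ^ n / (h e / e ^ m) * e ^ (n - m)) \<longlongrightarrow> C / D * 0 ^ (n - m)) (at_right 0)"
    using D(1) by (intro tendsto_mult tendsto_divide C D tendsto_power_at_right) simp
  moreover have "\<forall>\<^sub>F e in at_right 0. f e / e ^ n / (h e / e ^ m) * e ^ (n - m) = f e / h e"
    using eventually_at_right_pos
  proof eventually_elim
    case (elim e)
    have "e ^ n = e ^ m * e ^ (n - m)" using \<open>m \<le> n\<close> by (simp add: power_add[symmetric])
    then show ?case using elim by simp
  qed
  ultimately have "((\<lambda>e. f e / h e) \<longlongrightarrow> C / D * 0 ^ (n - m)) (at_right 0)"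
    by (rule Lim_transform_eventually)
  then show ?thesis ..
qed

text \<open>\<open>A\<close> contains the choices visible to the player, which contribute equally to
  both products. Outside \<open>A\<close>, the cleaned product has only factors 1 - e, each at least
  1/2. The original one is at most 1, and at most e if \<open>Q\<close> supplies an unseen
  tremble.\<close>

lemma prod_tremble_bound:
  fixes e :: real
  assumes fin: "finite E" "finite E'" and e: "0 < e" "e \<le> 1 / 2"
    and EA: "E \<inter> A = E' \<inter> A" and same: "\<And>z. z \<in> E \<inter> A \<Longrightarrow> t z = t' z"
    and clean: "\<And>z. z \<in> E' - A \<Longrightarrow> \<not> t' z"
    and dirty: "Q \<Longrightarrow> \<exists>z\<in>E - A. t z"
  shows "(\<Prod>z\<in>E. if t z then e else 1 - e) \<le>
    2 ^ card E' * (if Q then e else 1) * (\<Prod>z\<in>E'. if t' z then e else 1 - e)"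
proof -
  define w where "w = (\<lambda>b. if b then e else 1 - e)"
  have w: "0 \<le> w b" "w b \<le> 1" for b using e by (simp_all add: w_def)
  have split: "(\<Prod>z\<in>F. w (s z)) = (\<Prod>z\<in>F \<inter> A. w (s z)) * (\<Prod>z\<in>F - A. w (s z))" if "finite F" for F s
    using that by (subst prod.union_disjoint[symmetric]) (auto intro!: prod.cong)
  have A: "(\<Prod>z\<in>E \<inter> A. w (t z)) = (\<Prod>z\<in>E' \<inter> A. w (t' z))"
    using same unfolding EA by (intro prod.cong refl) simp
  have A0: "0 \<le> (\<Prod>z\<in>E \<inter> A. w (t z))" by (intro prod_nonneg) (simp add: w)
  have "(\<Prod>z\<in>E' - A. w (t' z)) = (1 - e) ^ card (E' - A)"
    using clean by (simp add: w_def)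
  moreover have "(1 / 2) ^ card E' \<le> (1 / 2 :: real) ^ card (E' - A)"
    using fin by (intro power_decreasing card_mono) auto
  moreover have "(1 / 2) ^ card (E' - A) \<le> (1 - e) ^ card (E' - A)"
    using e by (intro power_mono) auto
  ultimately have "(1 / 2) ^ card E' \<le> (\<Prod>z\<in>E' - A. w (t' z))" by linarith
  then have "2 ^ card E' * (1 / 2) ^ card E' \<le> 2 ^ card E' * (\<Prod>z\<in>E' - A. w (t' z))"
    by (intro mult_left_mono) auto
  then have E': "1 \<le> 2 ^ card E' * (\<Prod>z\<in>E' - A. w (t' z))"
    by (simp add: power_mult_distrib[symmetric])
  have E: "(\<Prod>z\<in>E - A. w (t z)) \<le> (if Q then e else 1)"
  proof (cases Q)
    case True
    then obtain z where z: "z \<in> E - A" "t z" using dirty by blast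
    have "(\<Prod>z\<in>E - A. w (t z)) = w (t z) * (\<Prod>z\<in>E - A - {z}. w (t z))"
      using fin z by (intro prod.remove) auto
    also have "\<dots> \<le> e * 1"
      using e z w by (intro mult_mono prod_le_1 prod_nonneg) (auto simp: w_def)
    finally show ?thesis using True by simp
  next
    case False
    then show ?thesis using w by (auto intro!: prod_le_1)
  qed
  have Q0: "0 \<le> (if Q then e else 1)" using e by simp
  have "(\<Prod>z\<in>E. w (t z)) \<le> (\<Prod>z\<in>E \<inter> A. w (t z)) * (if Q then e else 1)"
    unfolding split[OF fin(1)] using E A0 by (rule mult_left_mono)
  also have "\<dots> \<le> (\<Prod>z\<in>E \<inter> A. w (t z)) * (if Q then e else 1) * (2 ^ card E' * (\<Prod>z\<in>E' - A. w (t' z)))"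
    using mult_left_mono[OF E' mult_nonneg_nonneg[OF A0 Q0]] by simp
  also have "\<dots> = 2 ^ card E' * (if Q then e else 1) * (\<Prod>z\<in>E'. w (t' z))"
    unfolding split[OF fin(2)] A by (simp only: mult_ac)
  finally show ?thesis unfolding w_def .
qed

section \<open>Uniform trembles around the trigger profile\<close>

definition coin :: "real \<Rightarrow> 'a \<Rightarrow> 'a \<Rightarrow> 'a pmf" where
  "coin e a b = map_pmf (\<lambda>t. if t then a else b) (bernoulli_pmf e)"

lemma pmf_coin:
  assumes "0 \<le> e" "e \<le> 1" "a \<noteq> b"
  shows "pmf (coin e a b) a = e" "pmf (coin e a b) b = 1 - e"
proof -
  have "inj (\<lambda>t. if t then a else b)" using assms(3) by (auto simp: inj_def)
  from pmf_map_inj'[OF this, of "bernoulli_pmf e" True] pmf_map_inj'[OF this, of "bernoulli_pmf e" False]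
  show "pmf (coin e a b) a = e" "pmf (coin e a b) b = 1 - e" using assms by (simp_all add: coin_def)
qed

lemma set_coin: "0 < e \<Longrightarrow> e < 1 \<Longrightarrow> set_pmf (coin e a b) = {a, b}"
  by (auto simp: coin_def set_pmf_bernoulli)

definition tremble :: "real \<Rightarrow> profile" where
  "tremble e = (\<lambda>i h j. if trusted h j then (coin e Remove Keep, coin e Defect Coop)
                         else (coin e Keep Remove, coin e Coop Defect))"

lemma pmf_tremble:
  assumes "0 \<le> e" "e \<le> 1"
  shows "pmf (fst (tremble e i h j)) y = (if (y = Keep) \<noteq> trusted h j then e else 1 - e)"
    and "pmf (snd (tremble e i h j)) z = (if (z = Coop) \<noteq> trusted h j then e else 1 - e)"
  using assms by (cases y; cases z; simp add: tremble_def pmf_coin)+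

lemma pmf_trigger:
  "pmf (fst (trigger i h j)) y = (if (y = Keep) \<noteq> trusted h j then 0 else 1)"
  "pmf (snd (trigger i h j)) z = (if (z = Coop) \<noteq> trusted h j then 0 else 1)"
  by (cases y; cases z; simp add: trigger_def)+

lemma completely_mixed_tremble:
  assumes "0 < e" "e < 1"
  shows "completely_mixed (tremble e)"
proof -
  have "UNIV = {Keep, Remove}" "UNIV = {Coop, Defect}"
    using link_choice.exhaust favor_choice.exhaust by auto
  then show ?thesis using assms by (auto simp: completely_mixed_def tremble_def set_coin)
qed

subsection \<open>Removing the deviations that a player does not observe\<close>

definition purify_links :: "player \<Rightarrow> link_choices \<Rightarrow> link_choices" where
  "purify_links i l = (\<lambda>(j, k). if j = i \<or> k = i then l (j, k) else Keep)"

definition purify_favors :: "player \<Rightarrow> matching \<Rightarrow> favors \<Rightarrow> favors" where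
  "purify_favors i m a = (\<lambda>j. if a j = None \<or> j = i \<or> m j = Some i then a j else Some Coop)"

text \<open>Matchings are left as they are. They stay possible because undoing removals only
  enlarges the network, and they fix what i observes of her own interactions.\<close>

definition purify :: "player \<Rightarrow> history \<Rightarrow> history" where
  "purify i = map (\<lambda>(l, m, a). (purify_links i l, m, purify_favors i m a))"

fun purify_node :: "player \<Rightarrow> node \<Rightarrow> node" where
  "purify_node i (Link_Node x) = Link_Node (purify i x)"
| "purify_node i (Favor_Node x l m) = Favor_Node (purify i x) (purify_links i l) m"

lemma purify_Nil [simp]: "purify i [] = []"
  by (simp add: purify_def)

lemma purify_snoc [simp]:
  "purify i (x @ [(l, m, a)]) = purify i x @ [(purify_links i l, m, purify_favors i m a)]"
  by (simp add: purify_def)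

lemma length_purify [simp]: "length (purify i x) = length x"
  by (simp add: purify_def)

lemma clean_links_purify: "clean_links i (purify_links i l)"
  by (simp add: clean_links_def purify_links_def)

lemma clean_favors_purify: "clean_favors i m (purify_favors i m a)"
  by (auto simp: clean_favors_def purify_favors_def)

lemma clean_purify: "clean i (purify i x)"
proof (induction x rule: rev_induct)
  case (snoc z x)
  then show ?case by (cases z) (simp add: clean_snoc clean_links_purify clean_favors_purify)
qed simp

lemma observe_purify: "observe i (purify_links i l, m, purify_favors i m a) = observe i (l, m, a)"
  by (auto simp: purify_links_def purify_favors_def fun_eq_iff)

lemma mem_net_purify:
  "{j, k} \<in> net g (purify i x) \<longleftrightarrow> {j, k} \<in> g \<and> (j = i \<or> k = i \<longrightarrow> {j, k} \<in> net g x)"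
proof (induction x rule: rev_induct)
  case (snoc z x)
  obtain l m a where "z = (l, m, a)" by (cases z)
  then show ?case using snoc net_subset[of g x] by (auto simp: mem_kept purify_links_def)
qed auto

lemma nbrs_net_purify: "nbrs (net g (purify i x)) i = nbrs (net g x) i"
  using net_subset[of g x] by (auto simp: nbrs_def mem_net_purify)

lemma private_history_purify: "private_history g i (purify i x) = private_history g i x"
proof -
  have take: "take s (purify i x) = purify i (take s x)" for s
    by (simp add: purify_def take_map)
  have obs: "observe i (purify i x ! s) = observe i (x ! s)" if "s < length x" for s
  proof -
    obtain l m a where z: "x ! s = (l, m, a)" by (cases "x ! s")
    then have "purify i x ! s = (purify_links i l, m, purify_favors i m a)"
      using that by (simp add: purify_def)
    then show ?thesis unfolding z by (simp only: observe_purify)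
  qed
  show ?thesis
    unfolding private_history_def length_purify take nbrs_net_purify using obs by simp
qed

lemma good_purify: "good i j (purify i x) = good i j x" "good j i (purify i x) = good j i x"
proof -
  show *: "good i j (purify i x) = good i j x"
    \<comment> \<open>Whether a partner is trusted depends on the recorded observations alone, so
      any network serves in the private history.\<close>
    unfolding trusted_private_history[where g="{}", symmetric] private_history_purify ..
  then show "good j i (purify i x) = good j i x" by (simp add: good_sym)
qed

section \<open>Node probabilities under trembles, before and after purification\<close>

context favor_network
begin

lemma kept_purify: "kept (net g x) l \<subseteq> kept (net g (purify i x)) (purify_links i l)"
proof
  fix e assume e: "e \<in> kept (net g x) l"
  then have "e \<in> g" using kept_net_subset by blast
  then obtain j k where jk: "e = {j, k}" using link_cases by blast
  show "e \<in> kept (net g (purify i x)) (purify_links i l)"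
    using e \<open>e \<in> g\<close> unfolding jk mem_kept mem_net_purify by (auto simp: purify_links_def)
qed

lemma feasible_links_purify:
  "feasible_links (net g x) l \<Longrightarrow> feasible_links (net g (purify i x)) (purify_links i l)"
  unfolding feasible_links_def mem_net_purify purify_links_def using net_subset[of g x] by auto

lemma feasible_favors_purify: "feasible_favors m a \<Longrightarrow> feasible_favors m (purify_favors i m a)"
  by (auto simp: feasible_favors_def purify_favors_def)

lemma match_purify:
  "m \<in> set_pmf (match_stage S (kept (net g x) l)) \<Longrightarrow>
    m \<in> set_pmf (match_stage S (kept (net g (purify i x)) (purify_links i l)))"
  using match_stage_mono[OF kept_purify kept_net_subset] by blast

lemma feasible_purify: "feasible x \<Longrightarrow> feasible (purify i x)"
proof (induction rule: feasible.induct)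
  case (snoc x l m a)
  then show ?case
    unfolding purify_snoc
    by (intro feasible.snoc feasible_links_purify match_purify feasible_favors_purify)
qed (simp add: feasible.Nil)

lemma purify_node:
  "feasible_node nd \<Longrightarrow> feasible_node (purify_node i nd)"
  "same_stage nd (purify_node i nd)"
  "view g i (purify_node i nd) = view g i nd"
  by (cases nd; simp add: feasible_purify feasible_links_purify match_purify private_history_purify;
      simp add: purify_links_def)+

lemma pmf_history_snoc:
  "pmf (history_pmf S g \<sigma> (length (x @ [(l, m, a)]))) (x @ [(l, m, a)]) =
    pmf (history_pmf S g \<sigma> (length x)) x * (pmf (link_stage g \<sigma> x) l *
      (pmf (match_stage S (kept (net g x) l)) m * pmf (favor_stage g \<sigma> x m) a))"
proof -
  let ?y = "x @ [(l, m, a)]"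
  have "pmf (history_pmf S g \<sigma> (length ?y)) ?y =
      pmf (history_pmf S g \<sigma> (length x)) x * pmf (period_end S g \<sigma> (Link_Node x)) ?y"
    unfolding length_append_singleton history_pmf.simps by (rule pmf_bind_unique) auto
  also have "pmf (period_end S g \<sigma> (Link_Node x)) ?y =
      pmf (link_stage g \<sigma> x) l * pmf (bind_pmf (match_stage S (kept (net g x) l))
        (\<lambda>m. bind_pmf (favor_stage g \<sigma> x m) (\<lambda>a. return_pmf (x @ [(l, m, a)])))) ?y"
    unfolding period_end.simps by (rule pmf_bind_unique) auto
  also have "pmf (bind_pmf (match_stage S (kept (net g x) l))
        (\<lambda>m. bind_pmf (favor_stage g \<sigma> x m) (\<lambda>a. return_pmf (x @ [(l, m, a)])))) ?y =
      pmf (match_stage S (kept (net g x) l)) m *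
        pmf (bind_pmf (favor_stage g \<sigma> x m) (\<lambda>a. return_pmf (x @ [(l, m, a)]))) ?y"
    by (rule pmf_bind_unique) auto
  also have "pmf (bind_pmf (favor_stage g \<sigma> x m) (\<lambda>a. return_pmf (x @ [(l, m, a)]))) ?y =
      pmf (favor_stage g \<sigma> x m) a * pmf (return_pmf ?y) ?y"
    by (rule pmf_bind_unique) auto
  finally show ?thesis by simp
qed

lemma pmf_node_Link:
  "pmf (node_pmf S g \<sigma> (Link_Node x)) (Link_Node x) = pmf (history_pmf S g \<sigma> (length x)) x"
  unfolding node_pmf.simps by (rule pmf_map_inj') (simp add: inj_def)

lemma pmf_node_Favor:
  "pmf (node_pmf S g \<sigma> (Favor_Node x l m)) (Favor_Node x l m) =
    pmf (history_pmf S g \<sigma> (length x)) x *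
      (pmf (link_stage g \<sigma> x) l * pmf (match_stage S (kept (net g x) l)) m)"
proof -
  let ?y = "Favor_Node x l m"
  have "pmf (node_pmf S g \<sigma> ?y) ?y = pmf (history_pmf S g \<sigma> (length x)) x *
      pmf (bind_pmf (link_stage g \<sigma> x) (\<lambda>l. bind_pmf (match_stage S (kept (net g x) l))
        (\<lambda>m. return_pmf (Favor_Node x l m)))) ?y"
    unfolding node_pmf.simps by (rule pmf_bind_unique) auto
  also have "pmf (bind_pmf (link_stage g \<sigma> x) (\<lambda>l. bind_pmf (match_stage S (kept (net g x) l))
        (\<lambda>m. return_pmf (Favor_Node x l m)))) ?y =
      pmf (link_stage g \<sigma> x) l * pmf (bind_pmf (match_stage S (kept (net g x) l))
        (\<lambda>m. return_pmf (Favor_Node x l m))) ?y"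
    by (rule pmf_bind_unique) auto
  also have "pmf (bind_pmf (match_stage S (kept (net g x) l)) (\<lambda>m. return_pmf (Favor_Node x l m))) ?y =
      pmf (match_stage S (kept (net g x) l)) m * pmf (return_pmf ?y) ?y"
    by (rule pmf_bind_unique) auto
  finally show ?thesis by simp
qed

lemma node_pmf_cong: "same_stage nd nd' \<Longrightarrow> node_pmf S g \<sigma> nd = node_pmf S g \<sigma> nd'"
  by (cases nd; cases nd') auto

abbreviation links :: "network \<Rightarrow> (player \<times> player) set" where
  "links G \<equiv> {(j, k). {j, k} \<in> G}"

text \<open>The recorded choice contradicts \<open>trigger\<close>, so it has probability e under
  \<open>tremble e\<close>.\<close>

definition link_tremble :: "history \<Rightarrow> link_choices \<Rightarrow> player \<times> player \<Rightarrow> bool" where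
  "link_tremble x l = (\<lambda>(j, k). (l (j, k) = Keep) \<noteq> good j k x)"

definition favor_tremble :: "history \<Rightarrow> matching \<Rightarrow> favors \<Rightarrow> player \<Rightarrow> bool" where
  "favor_tremble x m a j \<longleftrightarrow> (a j = Some Coop) \<noteq> good (the (m j)) j x"

lemma pmf_link_stage_tremble:
  assumes "feasible_links (net g x) l" "0 \<le> e" "e \<le> 1"
  shows "pmf (link_stage g (tremble e) x) l = (\<Prod>z\<in>links (net g x). if link_tremble x l z then e else 1 - e)"
proof -
  have "pmf (link_stage g (tremble e) x) l =
      (\<Prod>z\<in>links (net g x). pmf (case z of (i, j) \<Rightarrow> fst (tremble e i (private_history g i x) j)) (l z))"
    unfolding link_stage_def using assms(1)
    by (intro pmf_Pi' finite_links[OF net_subset]) (auto simp: feasible_links_def)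
  also have "\<dots> = (\<Prod>z\<in>links (net g x). if link_tremble x l z then e else 1 - e)"
    by (intro prod.cong refl)
       (simp add: pmf_tremble[OF assms(2,3)] trusted_private_history link_tremble_def split: prod.split)
  finally show ?thesis .
qed

lemma pmf_favor_stage_tremble:
  assumes "feasible_favors m a" "finite {j. m j \<noteq> None}" "0 \<le> e" "e \<le> 1"
  shows "pmf (favor_stage g (tremble e) x m) a = (\<Prod>j\<in>{j. m j \<noteq> None}. if favor_tremble x m a j then e else 1 - e)"
proof -
  have "pmf (favor_stage g (tremble e) x m) a = (\<Prod>j\<in>{j. m j \<noteq> None}.
      pmf (let k = the (m j) in map_pmf Some (snd (tremble e k (private_history g k x) j))) (a j))"
    unfolding favor_stage_def using assms(1)
    by (intro pmf_Pi' assms(2)) (simp add: feasible_favors_def)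
  also have "\<dots> = (\<Prod>j\<in>{j. m j \<noteq> None}. if favor_tremble x m a j then e else 1 - e)"
  proof (intro prod.cong refl)
    fix j assume "j \<in> {j. m j \<noteq> None}"
    then obtain u where u: "a j = Some u" using assms(1)[unfolded feasible_favors_def, rule_format, of j] by auto
    show "pmf (let k = the (m j) in map_pmf Some (snd (tremble e k (private_history g k x) j))) (a j) =
        (if favor_tremble x m a j then e else 1 - e)"
      unfolding Let_def u
      by (subst pmf_map_inj') (simp_all add: pmf_tremble[OF assms(3,4)] trusted_private_history favor_tremble_def u)
  qed
  finally show ?thesis .
qed

lemma eventually_tremble_range: "\<forall>\<^sub>F e :: real in at_right 0. 0 < e \<and> e \<le> 1 / 2"
  by (rule eventually_at_rightI[of 0 "1/2"]) auto

lemma leading_link_stage: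
  assumes "feasible_links (net g x) l"
  shows "leading (\<lambda>e. pmf (link_stage g (tremble e) x) l)"
proof (rule leading_cong)
  show "leading (\<lambda>e. \<Prod>z\<in>links (net g x). if link_tremble x l z then e else 1 - e)"
    by (intro leading_prod finite_links[OF net_subset] leading_tremble)
  show "\<forall>\<^sub>F e in at_right 0. (\<Prod>z\<in>links (net g x). if link_tremble x l z then e else 1 - e) =
      pmf (link_stage g (tremble e) x) l"
    using eventually_tremble_range by eventually_elim (simp add: pmf_link_stage_tremble[OF assms])
qed

lemma leading_favor_stage:
  assumes "feasible_favors m a" "finite {j. m j \<noteq> None}"
  shows "leading (\<lambda>e. pmf (favor_stage g (tremble e) x m) a)"
proof (rule leading_cong)
  show "leading (\<lambda>e. \<Prod>j\<in>{j. m j \<noteq> None}. if favor_tremble x m a j then e else 1 - e)"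
    by (intro leading_prod assms(2) leading_tremble)
  show "\<forall>\<^sub>F e in at_right 0. (\<Prod>j\<in>{j. m j \<noteq> None}. if favor_tremble x m a j then e else 1 - e) =
      pmf (favor_stage g (tremble e) x m) a"
    using eventually_tremble_range by eventually_elim (simp add: pmf_favor_stage_tremble[OF assms])
qed

lemma leading_history: "feasible x \<Longrightarrow> leading (\<lambda>e. pmf (history_pmf S g (tremble e) (length x)) x)"
proof (induction rule: feasible.induct)
  case Nil
  then show ?case using leading_const[of 1] by simp
next
  case (snoc x l m a)
  have "0 < pmf (match_stage S (kept (net g x) l)) m" using snoc.hyps(3) by (rule pmf_positive)
  then show ?case
    unfolding pmf_history_snoc
    by (intro leading_mult snoc.IH leading_link_stage leading_const leading_favor_stage snoc.hyps
        finite_requesters[OF snoc.hyps(3)])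
qed

lemma leading_node:
  assumes "feasible_node nd"
  shows "leading (\<lambda>e. pmf (node_pmf S g (tremble e) nd) nd)"
proof (cases nd)
  case (Link_Node x)
  then show ?thesis using assms unfolding Link_Node pmf_node_Link by (intro leading_history) simp
next
  case (Favor_Node x l m)
  then have x: "feasible x" "feasible_links (net g x) l" "m \<in> set_pmf (match_stage S (kept (net g x) l))"
    using assms by simp_all
  show ?thesis
    unfolding Favor_Node pmf_node_Favor
    by (intro leading_mult leading_history leading_link_stage leading_const x pmf_positive)
qed

text \<open>An instance of \<open>prod_tremble_bound\<close> with the ordered pairs containing i as
  visible choices. The factor e requires a clean past: after an earlier quarrel among the others,
  removing their link is what \<open>trigger\<close> prescribes, but then the past already carries a
  factor e.\<close>

lemma link_stage_bound:
  assumes "feasible_links (net g x) l" "0 < e" "e \<le> 1 / 2"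
  shows "pmf (link_stage g (tremble e) x) l \<le>
    2 ^ card (links (net g (purify i x))) * (if clean i x \<and> \<not> clean_links i l then e else 1) *
      pmf (link_stage g (tremble e) (purify i x)) (purify_links i l)"
proof -
  have e: "0 \<le> e" "e \<le> 1" using assms by simp_all
  show ?thesis
    unfolding pmf_link_stage_tremble[OF assms(1) e] pmf_link_stage_tremble[OF feasible_links_purify[OF assms(1)] e]
  proof (rule prod_tremble_bound[where A="{(j, k). j = i \<or> k = i}", OF finite_links[OF net_subset] finite_links[OF net_subset] assms(2,3)])
    show "links (net g x) \<inter> {(j, k). j = i \<or> k = i} = links (net g (purify i x)) \<inter> {(j, k). j = i \<or> k = i}"
      using net_subset[of g x] by (auto simp: mem_net_purify)
    show "link_tremble x l z = link_tremble (purify i x) (purify_links i l) z"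
      if "z \<in> links (net g x) \<inter> {(j, k). j = i \<or> k = i}" for z
      using that by (cases z) (auto simp: link_tremble_def purify_links_def good_purify)
    show "\<not> link_tremble (purify i x) (purify_links i l) z"
      if "z \<in> links (net g (purify i x)) - {(j, k). j = i \<or> k = i}" for z
      using that clean_good[OF clean_purify]
      by (cases z) (auto simp: link_tremble_def purify_links_def)
    assume *: "clean i x \<and> \<not> clean_links i l"
    then obtain j k where jk: "j \<noteq> i" "k \<noteq> i" "l (j, k) \<noteq> Keep" unfolding clean_links_def by blast
    then have "{j, k} \<in> net g x" using assms(1) unfolding feasible_links_def by blast
    then show "\<exists>z\<in>links (net g x) - {(j, k). j = i \<or> k = i}. link_tremble x l z"
      using jk * clean_good[of i x j k] by (intro bexI[of _ "(j, k)"]) (auto simp: link_tremble_def)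
  qed
qed

lemma favor_stage_bound:
  assumes "feasible_favors m a" "finite {j. m j \<noteq> None}" "0 < e" "e \<le> 1 / 2"
  shows "pmf (favor_stage g (tremble e) x m) a \<le>
    2 ^ card {j. m j \<noteq> None} * (if clean i x \<and> \<not> clean_favors i m a then e else 1) *
      pmf (favor_stage g (tremble e) (purify i x) m) (purify_favors i m a)"
proof -
  have e: "0 \<le> e" "e \<le> 1" using assms by simp_all
  show ?thesis
    unfolding pmf_favor_stage_tremble[OF assms(1,2) e] pmf_favor_stage_tremble[OF feasible_favors_purify[OF assms(1)] assms(2) e]
  proof (rule prod_tremble_bound[where A="{j. j = i \<or> m j = Some i}", OF assms(2,2,3,4) refl])
    show "favor_tremble x m a j = favor_tremble (purify i x) m (purify_favors i m a) j"
      if "j \<in> {j. m j \<noteq> None} \<inter> {j. j = i \<or> m j = Some i}" for j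
      using that by (auto simp: favor_tremble_def purify_favors_def good_purify)
    show "\<not> favor_tremble (purify i x) m (purify_favors i m a) j"
      if "j \<in> {j. m j \<noteq> None} - {j. j = i \<or> m j = Some i}" for j
    proof -
      have "a j \<noteq> None" using that assms(1)[unfolded feasible_favors_def, rule_format, of j] by simp
      then show ?thesis
        using that clean_good[OF clean_purify, of "the (m j)" i j x]
        by (auto simp: favor_tremble_def purify_favors_def)
    qed
    assume *: "clean i x \<and> \<not> clean_favors i m a"
    then obtain j k where jk: "j \<noteq> i" "k \<noteq> i" "m j = Some k" "a j = Some Defect" unfolding clean_favors_def by blast
    then show "\<exists>j\<in>{j. m j \<noteq> None} - {j. j = i \<or> m j = Some i}. favor_tremble x m a j"
      using * clean_good[of i x k j] by (intro bexI[of _ j]) (auto simp: favor_tremble_def)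
  qed
qed

text \<open>The first stage with an unseen deviation contributes a factor e, and every other stage
  is bounded by a constant. The constant M depends on the history but not on e, which is what the
  limit requires.\<close>

lemma history_bound:
  "feasible x \<Longrightarrow> \<exists>M>0. \<forall>e. 0 < e \<longrightarrow> e \<le> 1 / 2 \<longrightarrow>
    pmf (history_pmf S g (tremble e) (length x)) x \<le>
      M * (if clean i x then 1 else e) * pmf (history_pmf S g (tremble e) (length (purify i x))) (purify i x)"
proof (induction rule: feasible.induct)
  case Nil
  show ?case by (rule exI[of _ 1]) simp
next
  case (snoc x l m a)
  obtain M where M: "M > 0" and IH: "\<And>e. 0 < e \<Longrightarrow> e \<le> 1 / 2 \<Longrightarrow>
    pmf (history_pmf S g (tremble e) (length x)) x \<le>
      M * (if clean i x then 1 else e) * pmf (history_pmf S g (tremble e) (length (purify i x))) (purify i x)"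
    using snoc.IH by blast
  define K1 where "K1 = (2::real) ^ card (links (net g (purify i x)))"
  define K3 where "K3 = (2::real) ^ card {j. m j \<noteq> None}"
  define mp where "mp = pmf (match_stage S (kept (net g (purify i x)) (purify_links i l))) m"
  have mp: "0 < mp" unfolding mp_def by (intro pmf_positive match_purify snoc.hyps)
  have K: "0 < K1" "0 < K3" by (simp_all add: K1_def K3_def)
  show ?case
  proof (intro exI conjI allI impI)
    show "0 < M * (K1 * (1 / mp * K3))" using M K mp by simp
    fix e :: real assume e: "0 < e" "e \<le> 1 / 2"
    define c0 where "c0 = (if clean i x then 1 else e)"
    define c1 where "c1 = (if clean i x \<and> \<not> clean_links i l then e else 1)"
    define c3 where "c3 = (if clean i x \<and> \<not> clean_favors i m a then e else 1)"
    define h where "h = pmf (history_pmf S g (tremble e) (length (purify i x))) (purify i x)"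
    define lp where "lp = pmf (link_stage g (tremble e) (purify i x)) (purify_links i l)"
    define fp where "fp = pmf (favor_stage g (tremble e) (purify i x) m) (purify_favors i m a)"
    have c: "0 \<le> c0" "0 \<le> c1" "0 \<le> c3" using e by (simp_all add: c0_def c1_def c3_def)
    have nn: "0 \<le> h" "0 \<le> lp" "0 \<le> fp" by (simp_all add: h_def lp_def fp_def)
    have "pmf (history_pmf S g (tremble e) (length (x @ [(l, m, a)]))) (x @ [(l, m, a)]) \<le>
        (M * c0 * h) * ((K1 * c1 * lp) * (1 / mp * mp * (K3 * c3 * fp)))"
      unfolding pmf_history_snoc
    proof (intro mult_mono mult_nonneg_nonneg pmf_nonneg)
      show "pmf (history_pmf S g (tremble e) (length x)) x \<le> M * c0 * h"
        unfolding c0_def h_def by (rule IH[OF e])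
      show "pmf (link_stage g (tremble e) x) l \<le> K1 * c1 * lp"
        unfolding K1_def c1_def lp_def by (rule link_stage_bound[OF snoc.hyps(2) e])
      \<comment> \<open>The right side is 1, written so that the matching probability
        \<open>mp\<close> of the purified history can be split off. It is positive and does not vary
        with e.\<close>
      show "pmf (match_stage S (kept (net g x) l)) m \<le> 1 / mp * mp"
        using mp by (simp add: pmf_le_1)
      show "pmf (favor_stage g (tremble e) x m) a \<le> K3 * c3 * fp"
        unfolding K3_def c3_def fp_def
        by (rule favor_stage_bound[OF snoc.hyps(4) finite_requesters[OF snoc.hyps(3)] e])
    qed (use M K mp c nn in simp_all)
    also have "\<dots> = M * (K1 * (1 / mp * K3)) * (c0 * c1 * c3) * (h * (lp * (mp * fp)))"
      by (simp only: mult_ac)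
    also have "\<dots> \<le> M * (K1 * (1 / mp * K3)) * (if clean i (x @ [(l, m, a)]) then 1 else e) * (h * (lp * (mp * fp)))"
    proof (intro mult_right_mono mult_left_mono)
      have "e * e \<le> e" using mult_left_le[of e e] e by simp
      then show "c0 * c1 * c3 \<le> (if clean i (x @ [(l, m, a)]) then 1 else e)"
        using e by (simp add: c0_def c1_def c3_def clean_snoc)
    qed (use M K mp nn in simp_all)
    also have "h * (lp * (mp * fp)) =
        pmf (history_pmf S g (tremble e) (length (purify i (x @ [(l, m, a)])))) (purify i (x @ [(l, m, a)]))"
      unfolding purify_snoc pmf_history_snoc h_def lp_def mp_def fp_def ..
    finally show "pmf (history_pmf S g (tremble e) (length (x @ [(l, m, a)]))) (x @ [(l, m, a)]) \<le>
        M * (K1 * (1 / mp * K3)) * (if clean i (x @ [(l, m, a)]) then 1 else e) *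
        pmf (history_pmf S g (tremble e) (length (purify i (x @ [(l, m, a)])))) (purify i (x @ [(l, m, a)]))" .
  qed
qed

lemma node_bound:
  assumes "feasible_node nd"
  shows "\<exists>M>0. \<forall>e. 0 < e \<longrightarrow> e \<le> 1 / 2 \<longrightarrow> pmf (node_pmf S g (tremble e) nd) nd \<le>
      M * (if clean_node i nd then 1 else e) * pmf (node_pmf S g (tremble e) (purify_node i nd)) (purify_node i nd)"
proof (cases nd)
  case (Link_Node x)
  then show ?thesis
    using history_bound[of x i] assms unfolding Link_Node purify_node.simps pmf_node_Link clean_node.simps by simp
next
  case (Favor_Node x l m)
  then have x: "feasible x" "feasible_links (net g x) l" "m \<in> set_pmf (match_stage S (kept (net g x) l))"
    using assms by simp_all
  obtain M where M: "M > 0" and IH: "\<And>e. 0 < e \<Longrightarrow> e \<le> 1 / 2 \<Longrightarrow>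
    pmf (history_pmf S g (tremble e) (length x)) x \<le>
      M * (if clean i x then 1 else e) * pmf (history_pmf S g (tremble e) (length (purify i x))) (purify i x)"
    using history_bound[OF x(1), of i] by blast
  define K1 where "K1 = (2::real) ^ card (links (net g (purify i x)))"
  define mp where "mp = pmf (match_stage S (kept (net g (purify i x)) (purify_links i l))) m"
  have mp: "0 < mp" unfolding mp_def by (intro pmf_positive match_purify x)
  have K: "0 < K1" by (simp add: K1_def)
  show ?thesis
  proof (intro exI conjI allI impI)
    show "0 < M * (K1 * (1 / mp))" using M K mp by simp
    fix e :: real assume e: "0 < e" "e \<le> 1 / 2"
    define c0 where "c0 = (if clean i x then 1 else e)"
    define c1 where "c1 = (if clean i x \<and> \<not> clean_links i l then e else 1)"
    define h where "h = pmf (history_pmf S g (tremble e) (length (purify i x))) (purify i x)"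
    define lp where "lp = pmf (link_stage g (tremble e) (purify i x)) (purify_links i l)"
    have c: "0 \<le> c0" "0 \<le> c1" using e by (simp_all add: c0_def c1_def)
    have nn: "0 \<le> h" "0 \<le> lp" by (simp_all add: h_def lp_def)
    have "pmf (node_pmf S g (tremble e) nd) nd \<le> (M * c0 * h) * ((K1 * c1 * lp) * (1 / mp * mp))"
      unfolding Favor_Node pmf_node_Favor
    proof (intro mult_mono mult_nonneg_nonneg pmf_nonneg)
      show "pmf (history_pmf S g (tremble e) (length x)) x \<le> M * c0 * h"
        unfolding c0_def h_def by (rule IH[OF e])
      show "pmf (link_stage g (tremble e) x) l \<le> K1 * c1 * lp"
        unfolding K1_def c1_def lp_def by (rule link_stage_bound[OF x(2) e])
      show "pmf (match_stage S (kept (net g x) l)) m \<le> 1 / mp * mp"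
        using mp by (simp add: pmf_le_1)
    qed (use M K mp c nn in simp_all)
    also have "\<dots> = M * (K1 * (1 / mp)) * (c0 * c1) * (h * (lp * mp))"
      by (simp only: mult_ac)
    also have "\<dots> \<le> M * (K1 * (1 / mp)) * (if clean_node i nd then 1 else e) * (h * (lp * mp))"
    proof (intro mult_right_mono mult_left_mono)
      show "c0 * c1 \<le> (if clean_node i nd then 1 else e)"
        using e by (simp add: c0_def c1_def Favor_Node)
    qed (use M K mp nn in simp_all)
    also have "h * (lp * mp) = pmf (node_pmf S g (tremble e) (purify_node i nd)) (purify_node i nd)"
      unfolding Favor_Node purify_node.simps pmf_node_Favor h_def lp_def mp_def ..
    finally show "pmf (node_pmf S g (tremble e) nd) nd \<le> M * (K1 * (1 / mp)) * (if clean_node i nd then 1 else e) *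
        pmf (node_pmf S g (tremble e) (purify_node i nd)) (purify_node i nd)" .
  qed
qed

section \<open>Limits of Bayesian beliefs\<close>

definition info_set :: "player \<Rightarrow> node \<Rightarrow> node set" where
  "info_set i nd = {nd'. feasible_node nd' \<and> same_stage nd nd' \<and> view g i nd' = view g i nd}"

text \<open>Nodes of one information set are at the same stage and share one law, so each
  probability may be written with the node's own \<open>node_pmf\<close>. In this form
  \<open>leading_node\<close> and \<open>node_bound\<close> apply to each term.\<close>

lemma bayes_belief_tremble:
  assumes nd: "feasible_node nd" and e: "0 < e" "e < 1"
  shows "set_pmf (bayes_belief S g (tremble e) i nd) = info_set i nd"
    and "nd' \<in> info_set i nd \<Longrightarrow> pmf (bayes_belief S g (tremble e) i nd) nd' =
      pmf (node_pmf S g (tremble e) nd') nd' / (\<Sum>nd''\<in>info_set i nd. pmf (node_pmf S g (tremble e) nd'') nd'')"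
proof -
  let ?P = "node_pmf S g (tremble e) nd" and ?V = "{nd'. view g i nd' = view g i nd}"
  note set = completely_mixed_node_pmf[OF completely_mixed_tremble[OF e], of nd]
  have info: "set_pmf ?P \<inter> ?V = info_set i nd" unfolding set info_set_def by blast
  have "nd \<in> info_set i nd" using nd by (simp add: info_set_def)
  then have ne: "set_pmf ?P \<inter> ?V \<noteq> {}" unfolding info by blast
  show "set_pmf (bayes_belief S g (tremble e) i nd) = info_set i nd"
    unfolding bayes_belief_def set_cond_pmf[OF ne] info ..
  assume nd': "nd' \<in> info_set i nd"
  have cong: "pmf ?P nd'' = pmf (node_pmf S g (tremble e) nd'') nd''" if "nd'' \<in> info_set i nd" for nd''
    using node_pmf_cong[of nd nd''] that by (simp add: info_set_def)
  have "measure_pmf.prob ?P ?V = measure_pmf.prob ?P (info_set i nd)"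
    unfolding info[symmetric] by (subst Int_commute) (rule measure_Int_set_pmf[symmetric])
  also have "\<dots> = (\<Sum>nd''\<in>info_set i nd. pmf ?P nd'')"
  proof (rule measure_measure_pmf_finite)
    show "finite (info_set i nd)"
      unfolding info[symmetric] using finite_node_pmf by blast
  qed
  also have "\<dots> = (\<Sum>nd''\<in>info_set i nd. pmf (node_pmf S g (tremble e) nd'') nd'')"
    by (rule sum.cong[OF refl cong])
  finally show "pmf (bayes_belief S g (tremble e) i nd) nd' =
      pmf (node_pmf S g (tremble e) nd') nd' / (\<Sum>nd''\<in>info_set i nd. pmf (node_pmf S g (tremble e) nd'') nd'')"
    using nd' unfolding bayes_belief_def pmf_cond[OF ne] cong[OF nd', symmetric]
    by (simp add: info_set_def)
qed

lemma finite_info_set: "finite (info_set i nd)"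
proof (rule finite_subset)
  show "info_set i nd \<subseteq> set_pmf (node_pmf S g (tremble (1 / 2)) nd)"
    unfolding completely_mixed_node_pmf[OF completely_mixed_tremble[of "1 / 2", simplified]]
    by (auto simp: info_set_def)
qed (rule finite_node_pmf)

lemma view_same_stage: "view g i nd = view g i nd' \<Longrightarrow> same_stage nd nd'"
proof (cases nd; cases nd')
  fix x x' l l' m m'
  have len: "length x = length x'" if "private_history g i x = private_history g i x'"
    using arg_cong[OF that, of "\<lambda>h. length (fst h)"] by (simp only: length_private_history)
  show "same_stage nd nd'" if "view g i nd = view g i nd'" "nd = Link_Node x" "nd' = Link_Node x'"
    using that len by simp
  show "same_stage nd nd'" if "view g i nd = view g i nd'" "nd = Favor_Node x l m" "nd' = Favor_Node x' l' m'"
    using that len by simp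
qed simp_all

text \<open>The shift by 2 keeps every tremble within (0, 1/2], the range in which the bounds
  hold.\<close>

definition tremble_size :: "nat \<Rightarrow> real" where
  "tremble_size k = 1 / (real k + 2)"

lemma tremble_size: "0 < tremble_size k" "tremble_size k \<le> 1 / 2"
  by (simp_all add: tremble_size_def field_simps)

lemma tremble_size_lim: "filterlim tremble_size (at_right 0) sequentially"
proof -
  have "tremble_size \<longlonglongrightarrow> 0"
    using LIMSEQ_ignore_initial_segment[OF lim_1_over_n[where 'a=real], of 2]
    by (simp add: tremble_size_def[abs_def] add.commute)
  then show ?thesis
    unfolding filterlim_at using tremble_size(1) by (simp add: less_imp_neq[symmetric])
qed

text \<open>Numerator and normalising sum both have a leading power of e, so their ratio converges.
  A node that is not clean has at most \<open>M * e\<close> times the probability of its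
  purification. As the latter lies in the same information set, the belief in the former tends to
  0.\<close>

lemma bayes_belief_limit:
  assumes nd: "feasible_node nd"
  shows "\<exists>r. (\<forall>y. (\<lambda>k. pmf (bayes_belief S g (tremble (tremble_size k)) i nd) y) \<longlonglongrightarrow> pmf r y) \<and>
    (\<forall>y\<in>set_pmf r. feasible_node y \<and> clean_node i y)"
proof -
  let ?q = "\<lambda>k. bayes_belief S g (tremble (tremble_size k)) i nd"
  let ?P = "\<lambda>e nd. pmf (node_pmf S g (tremble e) nd) nd"
  let ?D = "\<lambda>e. \<Sum>nd''\<in>info_set i nd. ?P e nd''"
  have size: "0 < tremble_size k" "tremble_size k < 1" for k using tremble_size[of k] by simp_all
  note fin = finite_info_set[of i nd]
  have self: "nd \<in> info_set i nd" using nd by (simp add: info_set_def)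
  have le: "?P e y \<le> ?D e" if "y \<in> info_set i nd" for e y
    by (rule member_le_sum[OF that _ fin]) simp
  have "convergent (\<lambda>k. pmf (?q k) y)" if y: "y \<in> info_set i nd" for y
  proof -
    have "leading (\<lambda>e. ?P e y)" using y by (intro leading_node) (simp add: info_set_def)
    moreover have "leading ?D"
    proof (rule leading_sum[OF fin])
      show "info_set i nd \<noteq> {}" using self by blast
      show "leading (\<lambda>e. ?P e z)" if "z \<in> info_set i nd" for z
        using that by (intro leading_node) (simp add: info_set_def)
    qed
    ultimately obtain L where "((\<lambda>e. ?P e y / ?D e) \<longlongrightarrow> L) (at_right 0)"
      using leading_ratio[of "\<lambda>e. ?P e y" ?D] le[OF y] by (auto intro!: always_eventually)
    then have "(\<lambda>k. ?P (tremble_size k) y / ?D (tremble_size k)) \<longlonglongrightarrow> L"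
      by (rule filterlim_compose[OF _ tremble_size_lim])
    then show ?thesis
      unfolding bayes_belief_tremble(2)[OF nd size y] by (rule convergentI)
  qed
  then obtain r where r: "\<And>y. (\<lambda>k. pmf (?q k) y) \<longlonglongrightarrow> pmf r y"
    using pmf_limit_exists[OF fin, of ?q] bayes_belief_tremble(1)[OF nd size] by blast
  have "feasible_node y \<and> clean_node i y" if y: "y \<in> set_pmf r" for y
  proof -
    have info: "y \<in> info_set i nd"
    proof (rule ccontr)
      assume "y \<notin> info_set i nd"
      then have "pmf (?q k) y = 0" for k
        unfolding pmf_eq_0_set_pmf bayes_belief_tremble(1)[OF nd size] .
      then have "pmf r y = 0" using r[of y] by (simp add: LIMSEQ_const_iff)
      then show False using y by (simp add: set_pmf_iff)
    qed
    then have feas: "feasible_node y" by (simp add: info_set_def)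
    have "clean_node i y"
    proof (rule ccontr)
      assume dirty: "\<not> clean_node i y"
      obtain M where M: "M > 0" and bound: "\<And>e. 0 < e \<Longrightarrow> e \<le> 1 / 2 \<Longrightarrow>
          ?P e y \<le> M * e * ?P e (purify_node i y)"
        using node_bound[OF feas, of i] dirty by auto
      have same: "same_stage nd (purify_node i y)"
        using info purify_node(2)[of y i] unfolding info_set_def
        by (cases nd; cases y) auto
      have pure: "purify_node i y \<in> info_set i nd"
        using info same purify_node(1)[OF feas, of i] purify_node(3)[of i y] by (simp add: info_set_def)
      have "pmf (?q k) y \<le> M * tremble_size k" for k
      proof -
        let ?e = "tremble_size k"
        have "0 < pmf (?q k) nd"
          using self bayes_belief_tremble(1)[OF nd size, of k i] by (intro pmf_positive) simp
        then have D: "0 < ?D ?e"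
          unfolding bayes_belief_tremble(2)[OF nd size self]
          by (simp add: zero_less_divide_iff sum_nonneg leD)
        have "?P ?e y \<le> M * ?e * ?P ?e (purify_node i y)" by (rule bound[OF tremble_size])
        also have "\<dots> \<le> M * ?e * ?D ?e"
          using le[OF pure] M tremble_size[of k] by (intro mult_left_mono) auto
        finally show ?thesis
          unfolding bayes_belief_tremble(2)[OF nd size info] using D by (simp add: divide_le_eq)
      qed
      moreover have "(\<lambda>k. M * tremble_size k) \<longlonglongrightarrow> M * 0"
        using tremble_size_lim unfolding filterlim_at by (intro tendsto_intros) simp
      ultimately have "pmf r y \<le> M * 0"
        by (intro LIMSEQ_le[OF r]) auto
      then show False using y by (simp add: set_pmf_iff)
    qed
    with feas show ?thesis by blast
  qed
  with r show ?thesis by blast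
qed

end

text \<open>The limit beliefs weigh only clean nodes, so \<open>trigger_optimal\<close> holds at
  every node of their support and survives averaging.\<close>

lemma (in regular_network) stable: "stable_network S g"
proof -
  \<comment> \<open>Beliefs are indexed by views, Bayes' rule by nodes. A representative node links
    the two, and \<open>bayes_rep\<close> shows that its choice does not matter.\<close>
  define rep where "rep = (\<lambda>i w. SOME nd. nd \<in> info_nodes S g i \<and> view g i nd = w)"
  \<comment> \<open>A view that occurs at no node has an arbitrary representative, hence the guard
    by feasibility.\<close>
  have "\<exists>r. feasible_node (rep i w) \<longrightarrow>
      (\<forall>y. (\<lambda>k. pmf (bayes_belief S g (tremble (tremble_size k)) i (rep i w)) y) \<longlonglongrightarrow> pmf r y) \<and>
      (\<forall>y\<in>set_pmf r. feasible_node y \<and> clean_node i y)" for i w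
    using bayes_belief_limit by blast
  then obtain \<mu> where \<mu>: "\<And>i w. feasible_node (rep i w) \<Longrightarrow>
      (\<forall>y. (\<lambda>k. pmf (bayes_belief S g (tremble (tremble_size k)) i (rep i w)) y) \<longlonglongrightarrow> pmf (\<mu> i w) y) \<and>
      (\<forall>y\<in>set_pmf (\<mu> i w). feasible_node y \<and> clean_node i y)"
    by metis
  have rep: "feasible_node (rep i (view g i nd))" "view g i (rep i (view g i nd)) = view g i nd"
    if "nd \<in> info_nodes S g i" for i nd
    using someI[of "\<lambda>nd'. nd' \<in> info_nodes S g i \<and> view g i nd' = view g i nd" nd] that
    by (simp_all add: rep_def info_nodes_def nodes_eq)
  have bayes_rep: "bayes_belief S g \<sigma> i (rep i (view g i nd)) = bayes_belief S g \<sigma> i nd"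
    if "nd \<in> info_nodes S g i" for \<sigma> i nd
  proof -
    have "node_pmf S g \<sigma> (rep i (view g i nd)) = node_pmf S g \<sigma> nd"
      by (rule node_pmf_cong[OF view_same_stage[OF rep(2)[OF that]]])
    then show ?thesis unfolding bayes_belief_def rep(2)[OF that] by simp
  qed
  have "sequentially_rational S g trigger \<mu>"
    unfolding sequentially_rational_def
  proof (intro ballI allI)
    fix i nd and \<tau> :: strategy assume i: "i \<in> players S" and nd: "nd \<in> info_nodes S g i"
    let ?\<mu> = "\<mu> i (view g i nd)"
    have clean: "feasible_node y" "clean_node i y" if "y \<in> set_pmf ?\<mu>" for y
      using \<mu>[OF rep(1)[OF nd]] that by blast+
    have fin: "finite (set_pmf ?\<mu>)"
    proof (rule finite_subset)
      show "finite (info_set i nd)" by (rule finite_info_set)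
      show "set_pmf ?\<mu> \<subseteq> info_set i nd"
      proof
        fix y assume y: "y \<in> set_pmf ?\<mu>"
        show "y \<in> info_set i nd"
        proof (rule ccontr)
          assume out: "y \<notin> info_set i nd"
          have nd': "feasible_node nd" using nd by (simp add: info_nodes_def nodes_eq)
          have "pmf (bayes_belief S g (tremble (tremble_size k)) i nd) y = 0" for k
            using out bayes_belief_tremble(1)[OF nd', of "tremble_size k" i] tremble_size[of k]
            by (simp add: pmf_eq_0_set_pmf)
          moreover have "(\<lambda>k. pmf (bayes_belief S g (tremble (tremble_size k)) i nd) y) \<longlonglongrightarrow> pmf ?\<mu> y"
            using \<mu>[OF rep(1)[OF nd]] unfolding bayes_rep[OF nd] by blast
          ultimately have "pmf ?\<mu> y = 0" by (simp add: LIMSEQ_const_iff)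
          then show False using y by (simp add: set_pmf_iff)
        qed
      qed
    qed
    show "expect ?\<mu> (continuation_payoff S g (trigger(i := \<tau>)) i) \<le> expect ?\<mu> (continuation_payoff S g trigger i)"
      using clean by (intro expect_mono fin trigger_optimal i)
  qed
  moreover have "consistent S g trigger \<mu>"
    unfolding consistent_def
  proof (intro exI[of _ "\<lambda>k. tremble (tremble_size k)"] conjI allI ballI)
    have lim: "tremble_size \<longlonglongrightarrow> 0" using tremble_size_lim unfolding filterlim_at by simp
    have size: "0 \<le> tremble_size k" "tremble_size k \<le> 1" for k using tremble_size[of k] by simp_all
    show "completely_mixed (tremble (tremble_size k))" for k
      using tremble_size[of k] by (intro completely_mixed_tremble) simp_all
    have lim1: "(\<lambda>k. 1 - tremble_size k) \<longlonglongrightarrow> 1" using tendsto_diff[OF tendsto_const lim, of 1] by simp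
    show "(\<lambda>k. pmf (fst (tremble (tremble_size k) i h j)) y) \<longlonglongrightarrow> pmf (fst (trigger i h j)) y" for i h j y
      unfolding pmf_tremble(1)[OF size] pmf_trigger using lim lim1 by simp
    show "(\<lambda>k. pmf (snd (tremble (tremble_size k) i h j)) y) \<longlonglongrightarrow> pmf (snd (trigger i h j)) y" for i h j y
      unfolding pmf_tremble(2)[OF size] pmf_trigger using lim lim1 by simp
    show "(\<lambda>k. pmf (bayes_belief S g (tremble (tremble_size k)) i nd) y) \<longlonglongrightarrow> pmf (\<mu> i (view g i nd)) y"
      if "nd \<in> info_nodes S g i" for i nd y
      using \<mu>[OF rep(1)[OF that]] unfolding bayes_rep[OF that] by blast
  qed
  ultimately have "bilateral_equilibrium S g trigger"
    unfolding bilateral_equilibrium_def sequential_equilibrium_def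
    using trigger_bilaterally_measurable by blast
  then have "stable_bilateral_equilibrium S g trigger"
    unfolding stable_bilateral_equilibrium_def using trigger_on_path by blast
  then show ?thesis unfolding stable_network_def by blast
qed

section \<open>The bound on the degrees\<close>

text \<open>The gain c - \<gamma> from one refusal is a fixed positive number, while the value of
  the d-th link is at most \<open>K * (1 - p) ^ (d - 1)\<close>, which tends to 0.\<close>

lemma finite_sustainable:
  assumes "favor_game G" "0 < \<alpha>" "0 < p" "p < 1" "0 < \<delta>" "\<delta> < 1"
  shows "finite {d. sustainable \<alpha> p G \<delta> d}"
proof -
  define K where "K = \<delta> / (1 - \<delta>) * (\<alpha> * (benefit G * p))"
  have G: "refusal G < cost G" "0 < cost G" using assms(1) by (auto simp: favor_game_def)
  have "(\<lambda>n. K * (1 - p) ^ n) \<longlonglongrightarrow> K * 0"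
    using assms by (intro tendsto_mult tendsto_const LIMSEQ_realpow_zero) auto
  then have "eventually (\<lambda>n. K * (1 - p) ^ n < cost G - refusal G) sequentially"
    using G by (intro order_tendstoD(2)) auto
  then obtain N where N: "\<And>n. N \<le> n \<Longrightarrow> K * (1 - p) ^ n < cost G - refusal G"
    by (auto simp: eventually_sequentially)
  have "d \<le> N" if d: "sustainable \<alpha> p G \<delta> d" for d
  proof (rule ccontr)
    assume "\<not> d \<le> N"
    then have "K * (1 - p) ^ (d - 1) < cost G - refusal G" by (intro N) simp
    also have "\<dots> \<le> \<delta> / (1 - \<delta>) * (\<alpha> * (benefit G * (p * (1 - p) ^ (d - 1)) - cost G * selection_prob p d))"
      using d by (simp add: sustainable_def)
    also have "\<dots> \<le> \<delta> / (1 - \<delta>) * (\<alpha> * (benefit G * (p * (1 - p) ^ (d - 1))))"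
    proof -
      have "0 \<le> selection_prob p d"
        using assms by (simp add: selection_prob_def power_le_one)
      then show ?thesis using assms G by (intro mult_left_mono) auto
    qed
    also have "\<dots> = K * (1 - p) ^ (d - 1)" by (simp add: K_def)
    finally show False by simp
  qed
  then have "{d. sustainable \<alpha> p G \<delta> d} \<subseteq> {..N}" by auto
  then show ?thesis by (rule finite_subset) simp
qed

text \<open>Inserting 0 gives the maximum a nonempty set when no degree is sustainable. A stable
  network yields a sustainable degree at least as large as any given positive degree, and the
  maximum is itself sustainable or 0, so both directions need only this extremal element.\<close>

definition degree_bound :: "real \<Rightarrow> real \<Rightarrow> favor_game \<Rightarrow> real \<Rightarrow> nat" where
  "degree_bound \<alpha> p G \<delta> = Max (insert 0 {d. sustainable \<alpha> p G \<delta> d})"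

theorem theorem1:
  shows "\<exists>B :: real \<Rightarrow> real \<Rightarrow> favor_game \<Rightarrow> real \<Rightarrow> nat.
    \<forall>(S :: society) (p :: real) (g :: network).
      society S \<longrightarrow> 0 < p \<longrightarrow> p < 1 \<longrightarrow> substitutable S p \<longrightarrow> network_on S g \<longrightarrow>
      ((\<exists>j\<in>players S. deg g j > B (need_prob S) p (game S) (discount S)) \<longrightarrow> \<not> stable_network S g) \<and>
      ((\<forall>i\<in>players S. deg g i = B (need_prob S) p (game S) (discount S)) \<longrightarrow> stable_network S g)"
proof (intro exI[of _ degree_bound] allI impI)
  fix S :: society and p :: real and g :: network
  assume "society S" "0 < p" "p < 1" "substitutable S p" "network_on S g"
  then interpret favor_network S p g by unfold_locales
  let ?B = "degree_bound \<alpha> p (game S) \<delta>"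
  have "favor_game (game S)" using soc by (simp add: society_def)
  then have fin: "finite {d. sustainable \<alpha> p (game S) \<delta> d}"
    by (rule finite_sustainable) (use params p0 p1 in simp_all)
  show "((\<exists>j\<in>players S. deg g j > ?B) \<longrightarrow> \<not> stable_network S g) \<and>
      ((\<forall>i\<in>players S. deg g i = ?B) \<longrightarrow> stable_network S g)"
  proof (intro conjI impI notI)
    assume "\<exists>j\<in>players S. deg g j > ?B" and st: "stable_network S g"
    then obtain j where j: "j \<in> players S" "deg g j > ?B" by blast
    obtain d where "deg g j \<le> d" and d: "sustainable \<alpha> p (game S) \<delta> d"
      by (rule stable_imp_sustainable[OF st j(1)]) (use j(2) in auto)
    moreover have "d \<le> ?B" unfolding degree_bound_def using fin d by (intro Max_ge) auto
    ultimately show False using j(2) by simp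
  next
    assume deg: "\<forall>i\<in>players S. deg g i = ?B"
    have "?B \<in> insert 0 {d. sustainable \<alpha> p (game S) \<delta> d}"
      unfolding degree_bound_def using fin by (intro Max_in) auto
    then interpret regular_network S p g ?B by unfold_locales (use deg in auto)
    show "stable_network S g" by (rule stable)
  qed
qed

end
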